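(* AsLimSup and NLimSup are incomparable in expressive power (neither is reducible to the other), and PosLimSup is more expressive than both AsLimSup and NLimSup: both AsLimSup and NLimSup are reducible to PosLimSup, while PosLimSup is reducible to neither of them.
   Context: A probabilistic weighted automaton over a finite alphabet $\Sigma$ is a tuple $A=(Q,\rho_I,\Sigma,\delta,\gamma)$ where $Q$ is a finite set of states, $\rho_I$ is a probability distribution on $Q$, $\delta:Q\times\Sigma\to\mathcal D(Q)$ assigns to each state and letter a probability distribution on $Q$, and $\gamma:Q\times\Sigma\times Q\to\mathbb Q$ is a weight function. A run over an infinite word $w=\sigma_1\sigma_2\dots$ is a sequence $r=q_0\sigma_1q_1\sigma_2\dots$ with $\rho_I(q_0)>0$ and $\delta(q_i,\sigma_{i+1})(q_{i+1})>0$ for all $i$; its weight sequence is $\gamma(r)=v_0v_1\dots$ with $v_i=\gamma(q_i,\sigma_{i+1},q_{i+1})$. For each $w$, the probabilities of finite run prefixes $\rho_I(q_0)\prod_{i=1}^k\delta(q_{i-1},\sigma_i)(q_i)$ induce a probability measure $\mathbb P^A$ on runs over $w$. For a value function $\mathrm{Val}$, the positive semantics is $L^{>0}_A(w)=\sup\{\eta\mid \mathbb P^A(\{r:\mathrm{Val}(\gamma(r))\ge\eta\})>0\}$ and the almost-sure semantics is $L^{=1}_A(w)=\sup\{\eta\mid \mathbb P^A(\{r:\mathrm{Val}(\gamma(r))\ge\eta\})=1\}$. Ignoring probabilities (initial states are those with $\rho_I(q)>0$, transitions those with $\delta(q,\sigma)(q')>0$) gives a nondeterministic automaton with language $L^{\max}_A(w)=\sup\{\mathrm{Val}(\gamma(r))\mid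 r\text{ run over }w\}$. Here $\mathsf{LimSup}(v)=\limsup_{n\to\infty}v_n$. NLimSup, PosLimSup, AsLimSup denote the classes of $\mathsf{LimSup}$-automata under nondeterministic, positive, and almost-sure semantics. A class $\mathcal C$ is reducible to $\mathcal C'$ if for every $A\in\mathcal C$ there is $A'\in\mathcal C'$ over the same alphabet defining the same quantitative language $\Sigma^\omega\to\mathbb R$. *)

theory Defs
  imports "HOL-Probability.Probability"
begin

record pwa =
  states :: "nat set"
  init   :: "nat pmf"
  trans  :: "nat \<Rightarrow> nat \<Rightarrow> nat pmf"
  weight :: "nat \<Rightarrow> nat \<Rightarrow> nat \<Rightarrow> rat"

definition wf_pwa :: "nat set \<Rightarrow> pwa \<Rightarrow> bool" where
  "wf_pwa \<Sigma> A \<longleftrightarrow> finite (states A) \<and> set_pmf (init A) \<subseteq> states A \<and>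
     (\<forall>q\<in>states A. \<forall>\<sigma>\<in>\<Sigma>. set_pmf (trans A q \<sigma>) \<subseteq> states A)"

definition is_run :: "pwa \<Rightarrow> (nat \<Rightarrow> nat) \<Rightarrow> (nat \<Rightarrow> nat) \<Rightarrow> bool" where
  "is_run A w r \<longleftrightarrow> pmf (init A) (r 0) > 0 \<and>
     (\<forall>i. pmf (trans A (r i) (w i)) (r (Suc i)) > 0)"

definition weight_seq :: "pwa \<Rightarrow> (nat \<Rightarrow> nat) \<Rightarrow> (nat \<Rightarrow> nat) \<Rightarrow> nat \<Rightarrow> rat" where
  "weight_seq A w r i = weight A (r i) (w i) (r (Suc i))"

definition LimSup :: "(nat \<Rightarrow> rat) \<Rightarrow> real" where
  "LimSup v = real_of_ereal (limsup (\<lambda>n. ereal (real_of_rat (v n))))"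

definition val :: "pwa \<Rightarrow> (nat \<Rightarrow> nat) \<Rightarrow> (nat \<Rightarrow> nat) \<Rightarrow> real" where
  "val A w r = LimSup (weight_seq A w r)"

definition run_measure :: "pwa \<Rightarrow> (nat \<Rightarrow> nat) \<Rightarrow> (nat \<Rightarrow> nat) measure" where
  "run_measure A w = (THE M. prob_space M \<and>
      sets M = sets (PiM UNIV (\<lambda>_. count_space (UNIV :: nat set))) \<and>
      (\<forall>n qs. emeasure M {r. \<forall>i\<le>n. r i = qs i} =
          ennreal (pmf (init A) (qs 0) * (\<Prod>i<n. pmf (trans A (qs i) (w i)) (qs (Suc i))))))"

definition L_pos :: "pwa \<Rightarrow> (nat \<Rightarrow> nat) \<Rightarrow> real" where
  "L_pos A w = Sup {\<eta>. measure (run_measure A w) {r. \<eta> \<le> val A w r} > 0}"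

definition L_as :: "pwa \<Rightarrow> (nat \<Rightarrow> nat) \<Rightarrow> real" where
  "L_as A w = Sup {\<eta>. measure (run_measure A w) {r. \<eta> \<le> val A w r} = 1}"

definition L_max :: "pwa \<Rightarrow> (nat \<Rightarrow> nat) \<Rightarrow> real" where
  "L_max A w = Sup {val A w r | r. is_run A w r}"

definition reducible ::
  "(pwa \<Rightarrow> (nat \<Rightarrow> nat) \<Rightarrow> real) \<Rightarrow> (pwa \<Rightarrow> (nat \<Rightarrow> nat) \<Rightarrow> real) \<Rightarrow> bool" where
  "reducible L1 L2 \<longleftrightarrow> (\<forall>\<Sigma>. finite \<Sigma> \<longrightarrow> (\<forall>A. wf_pwa \<Sigma> A \<longrightarrow>
      (\<exists>B. wf_pwa \<Sigma> B \<and> (\<forall>w. range w \<subseteq> \<Sigma> \<longrightarrow> L1 A w = L2 B w))))"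

end

(* Positive semantics simulates nondeterminism because a nondeterministic automaton is deterministic in the
   limit: guess the threshold v, follow one run for a while, then switch to a deterministic breakpoint
   construction, so that an accepting guess is a single path of positive probability. It simulates the
   almost-sure semantics because, after resampling the state uniformly from the set of currently reachable states
   at every transition of weight at least v, such transitions recur with probability 1 if they did so before and
   with probability 0 otherwise.
   "From some time on only the letter 1" is not almost-sure: an almost-sure automaton is close to certain to see
   weight 1 within long blocks of 1s, also when these are separated by infinitely many letters 0.
   Conversely, an almost-sure automaton can accept a block of n letters 0 with probability 2^-n. It accepts a
   word with infinitely many blocks of equal length, but not one whose blocks grow linearly in length, and pumping
   turns an accepting run of a nondeterministic automaton on the former into one on the latter.
   The two remaining claims follow by transitivity of reducibility. *)

theory Submission
  imports Defs
begin


section \<open>Time-inhomogeneous Markov chains\<close>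

text \<open>\<open>LimSup\<close> along a run is one of finitely many weights, so
  \<open>\<eta> <= L\<close> says of a single event, infinitely many transitions of weight at least
  \<open>\<eta>\<close>, that it has positive measure, has measure 1 or contains a run. Languages
  are compared through these statements, one \<open>\<eta>\<close> at a time, so a construction has
  to treat only one threshold from a finite set. Drawing the threshold at random makes the positive
  semantics a disjunction over all thresholds; the least weight is what a failed guess still earns.
  An arbitrary word makes the chain time-inhomogeneous, so recurrence cannot be read off a finite
  graph. The resampling argument instead takes the supremum \<open>C\<close> of the recurrence
  probabilities after late resampling steps and bounds \<open>C\<close> by a fraction below 1 of
  itself. In the pumping argument the run is read along a walk on its positions; one time change
  yields the pumped word, its run and its weights. The number of repetitions in block
  \<open>i\<close> is tuned so that the acceptance probabilities of all blocks sum to at most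
  1/2.\<close>

abbreviation path_space :: "(nat \<Rightarrow> nat) measure" where
  "path_space \<equiv> PiM UNIV (\<lambda>_. count_space UNIV)"

text \<open>The chain is driven by independent noise: the value \<^term>\<open>\<omega> (Suc i, q)\<close> is the successor
  that would be chosen at time \<^term>\<open>i\<close> in state \<^term>\<open>q\<close>, and \<^term>\<open>\<omega> (0, 0)\<close> is the initial state.\<close>

definition noise :: "nat pmf \<Rightarrow> (nat \<Rightarrow> nat \<Rightarrow> nat pmf) \<Rightarrow> (nat \<times> nat \<Rightarrow> nat) measure" where
  "noise p k = PiM UNIV (\<lambda>(i, q). measure_pmf (case i of 0 \<Rightarrow> p | Suc j \<Rightarrow> k j q))"

primrec driven_path :: "(nat \<times> nat \<Rightarrow> nat) \<Rightarrow> nat \<Rightarrow> nat" where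
  "driven_path \<omega> 0 = \<omega> (0, 0)"
| "driven_path \<omega> (Suc i) = \<omega> (Suc i, driven_path \<omega> i)"

definition chain :: "nat pmf \<Rightarrow> (nat \<Rightarrow> nat \<Rightarrow> nat pmf) \<Rightarrow> (nat \<Rightarrow> nat) measure" where
  "chain p k = distr (noise p k) path_space driven_path"

lemma sets_noise: "sets (noise p k) = sets (PiM UNIV (\<lambda>_. count_space UNIV))"
  unfolding noise_def by (rule sets_PiM_cong) (auto split: prod.splits)

lemma space_noise [simp]: "space (noise p k) = UNIV"
  using sets_eq_imp_space_eq[OF sets_noise] by (simp add: space_PiM)

lemma prob_space_noise: "prob_space (noise p k)"
  unfolding noise_def by (rule prob_space_PiM) (auto split: prod.splits simp: prob_space_measure_pmf)

lemma measurable_noise_component: "(\<lambda>\<omega>. \<omega> x) \<in> noise p k \<rightarrow>\<^sub>M count_space UNIV"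
proof -
  have "(\<lambda>\<omega>. \<omega> x) \<in> PiM UNIV (\<lambda>_. count_space UNIV) \<rightarrow>\<^sub>M count_space UNIV"
    by measurable
  then show ?thesis
    using measurable_cong_sets[OF sets_noise refl] by blast
qed

text \<open>Which noise coordinate is read depends on the path itself; as there are only countably
  many states, the composition is still measurable.\<close>

lemma measurable_driven_path_component:
  "(\<lambda>\<omega>. driven_path \<omega> i) \<in> noise p k \<rightarrow>\<^sub>M count_space UNIV"
proof (induction i)
  case 0
  then show ?case by (simp add: measurable_noise_component)
next
  case (Suc i)
  have "(\<lambda>\<omega>. (\<lambda>q. \<omega> (Suc i, q)) (driven_path \<omega> i)) \<in> noise p k \<rightarrow>\<^sub>M count_space UNIV"
    by (rule measurable_compose_countable[OF measurable_noise_component Suc])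
  then show ?case by simp
qed

lemma measurable_driven_path: "driven_path \<in> noise p k \<rightarrow>\<^sub>M path_space"
  by (rule measurable_PiM_single') (auto simp: measurable_driven_path_component)

lemma sets_chain [simp, measurable_cong]: "sets (chain p k) = sets path_space"
  by (simp add: chain_def)

lemma space_path_space: "space path_space = UNIV"
  by (simp add: space_PiM)

lemma space_chain [simp]: "space (chain p k) = UNIV"
  by (simp add: chain_def space_path_space)

lemma prob_space_chain: "prob_space (chain p k)"
  unfolding chain_def by (rule prob_space.prob_space_distr[OF prob_space_noise measurable_driven_path])

interpretation chain: prob_space "chain p k" for p k
  by (rule prob_space_chain)

lemma measurable_path_component [measurable]: "(\<lambda>r. r i) \<in> path_space \<rightarrow>\<^sub>M count_space UNIV"
  by measurable

lemma measurable_path_prefix [measurable]: "(\<lambda>r. map r [0..<n]) \<in> path_space \<rightarrow>\<^sub>M count_space UNIV"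
proof (induction n)
  case (Suc n)
  have "(\<lambda>r. (\<lambda>l. l @ [r n]) (map r [0..<n])) \<in> path_space \<rightarrow>\<^sub>M count_space UNIV"
  proof (rule measurable_compose_countable[OF _ Suc])
    fix l :: "nat list"
    show "(\<lambda>r. l @ [r n]) \<in> path_space \<rightarrow>\<^sub>M count_space UNIV"
      by (rule measurable_compose[OF measurable_path_component]) auto
  qed
  then show ?case by simp
qed simp

lemma sets_path_Collect: "Measurable.pred path_space P \<Longrightarrow> {r. P r} \<in> sets path_space"
  by (simp add: pred_def space_path_space)

text \<open>Along a prescribed path the states are known, so a cylinder pulls back to a condition on
  finitely many fixed noise coordinates, to which independence applies.\<close>

lemma driven_path_cylinder_iff:
  "(\<forall>i\<le>n. driven_path \<omega> i = qs i) \<longleftrightarrow> \<omega> (0, 0) = qs 0 \<and> (\<forall>i<n. \<omega> (Suc i, qs i) = qs (Suc i))"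
proof (induction n)
  case (Suc n)
  have "(\<forall>i\<le>Suc n. driven_path \<omega> i = qs i) \<longleftrightarrow>
      (\<forall>i\<le>n. driven_path \<omega> i = qs i) \<and> driven_path \<omega> (Suc n) = qs (Suc n)"
    by (auto simp: le_Suc_eq)
  also have "\<dots> \<longleftrightarrow> (\<forall>i\<le>n. driven_path \<omega> i = qs i) \<and> \<omega> (Suc n, qs n) = qs (Suc n)"
    by auto
  finally show ?case using Suc by (auto simp: less_Suc_eq)
qed simp

lemma emeasure_chain_cylinder:
  "emeasure (chain p k) {r. \<forall>i\<le>n. r i = qs i} =
    ennreal (pmf p (qs 0) * (\<Prod>i<n. pmf (k i (qs i)) (qs (Suc i))))"
proof -
  define M where "M = (\<lambda>(i, q). measure_pmf (case i of 0 \<Rightarrow> p | Suc j \<Rightarrow> k j q))"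
  \<comment> \<open>The coordinates read along \<open>qs\<close>. The time stamp
    \<open>Suc i\<close> keeps them distinct, so the masses multiply even if \<open>qs\<close>
    revisits a state.\<close>
  define J where "J = insert (0, 0) ((\<lambda>i. (Suc i, qs i)) ` {..<n})"
  define X where "X = (\<lambda>(i, q :: nat). {qs i})"
  have M: "prob_space (M x)" for x
    by (auto simp: M_def prob_space_measure_pmf split: prod.splits)
  have spM: "space (M x) = UNIV" "sets (M x) = UNIV" for x
    by (auto simp: M_def split: prod.splits)
  have cyl: "{r. \<forall>i\<le>n. r i = qs i} \<in> sets path_space"
    by (rule sets_path_Collect) measurable
  have "emeasure (chain p k) {r. \<forall>i\<le>n. r i = qs i} =
      emeasure (noise p k) {\<omega>. \<forall>i\<le>n. driven_path \<omega> i = qs i}"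
    unfolding chain_def using cyl
    by (subst emeasure_distr[OF measurable_driven_path]) (auto simp: vimage_def)
  also have "{\<omega>. \<forall>i\<le>n. driven_path \<omega> i = qs i} = prod_emb UNIV M J (Pi\<^sub>E J X)"
    unfolding driven_path_cylinder_iff
    by (auto simp: prod_emb_def spM J_def X_def PiE_iff space_PiM)
  also have "emeasure (noise p k) \<dots> = (\<Prod>x\<in>J. emeasure (M x) (X x))"
    unfolding noise_def M_def[symmetric]
    by (rule emeasure_PiM_emb) (auto simp: M spM J_def)
  also have "\<dots> = emeasure (M (0, 0)) (X (0, 0)) *
      (\<Prod>x\<in>(\<lambda>i. (Suc i, qs i)) ` {..<n}. emeasure (M x) (X x))"
    unfolding J_def by (subst prod.insert) auto
  also have "(\<Prod>x\<in>(\<lambda>i. (Suc i, qs i)) ` {..<n}. emeasure (M x) (X x)) =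
      (\<Prod>i<n. emeasure (M (Suc i, qs i)) (X (Suc i, qs i)))"
    by (subst prod.reindex) (auto simp: inj_on_def)
  also have "emeasure (M (0, 0)) (X (0, 0)) * \<dots> =
      ennreal (pmf p (qs 0)) * (\<Prod>i<n. ennreal (pmf (k i (qs i)) (qs (Suc i))))"
    by (simp add: M_def X_def emeasure_pmf_single)
  also have "\<dots> = ennreal (pmf p (qs 0) * (\<Prod>i<n. pmf (k i (qs i)) (qs (Suc i))))"
    by (simp add: prod_ennreal ennreal_mult prod_nonneg)
  finally show ?thesis .
qed

section \<open>Uniqueness of a path measure with given cylinder masses\<close>

lemma map_upt_eq_iff: "map r [0..<Suc n] = l \<longleftrightarrow> length l = Suc n \<and> (\<forall>i\<le>n. r i = l ! i)"
  by (auto simp: list_eq_iff_nth_eq less_Suc_eq_le simp del: upt_Suc)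

text \<open>Prefixes form a countable type, so their law is determined by singletons, and the
  preimage of a singleton is a cylinder or empty.\<close>

lemma distr_prefix_eqI:
  assumes M: "sets M = sets path_space" and N: "sets N = sets path_space"
    and eq: "\<And>qs. emeasure M {r. \<forall>i\<le>n. r i = qs i} = emeasure N {r. \<forall>i\<le>n. r i = qs i}"
  shows "distr M (count_space UNIV) (\<lambda>r. map r [0..<Suc n]) =
    distr N (count_space UNIV) (\<lambda>r. map r [0..<Suc n])"
proof (rule measure_eqI_countable[of _ UNIV])
  fix l :: "nat list"
  have mM: "(\<lambda>r. map r [0..<Suc n]) \<in> M \<rightarrow>\<^sub>M count_space UNIV"
    using measurable_path_prefix measurable_cong_sets[OF M refl] by blast
  have mN: "(\<lambda>r. map r [0..<Suc n]) \<in> N \<rightarrow>\<^sub>M count_space UNIV"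
    using measurable_path_prefix measurable_cong_sets[OF N refl] by blast
  have sp: "space M = UNIV" "space N = UNIV"
    using sets_eq_imp_space_eq[OF M] sets_eq_imp_space_eq[OF N] by (simp_all add: space_path_space)
  have *: "(\<lambda>r. map r [0..<Suc n]) -` {l} = (if length l = Suc n then {r. \<forall>i\<le>n. r i = l ! i} else {})"
    using map_upt_eq_iff[of _ n l] by (auto simp del: upt_Suc)
  show "emeasure (distr M (count_space UNIV) (\<lambda>r. map r [0..<Suc n])) {l} =
      emeasure (distr N (count_space UNIV) (\<lambda>r. map r [0..<Suc n])) {l}"
    using eq[of "\<lambda>i. l ! i"] emeasure_distr[OF mM, of "{l}"] emeasure_distr[OF mN, of "{l}"]
    unfolding * sp by (simp del: upt_Suc)
qed auto

lemma emeasure_prefix_event_eqI: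
  assumes M: "sets M = sets path_space" and N: "sets N = sets path_space"
    and eq: "\<And>qs. emeasure M {r. \<forall>i\<le>n. r i = qs i} = emeasure N {r. \<forall>i\<le>n. r i = qs i}"
  shows "emeasure M {r. P (map r [0..<Suc n])} = emeasure N {r. P (map r [0..<Suc n])}"
proof -
  have mM: "(\<lambda>r. map r [0..<Suc n]) \<in> M \<rightarrow>\<^sub>M count_space UNIV"
    using measurable_path_prefix measurable_cong_sets[OF M refl] by blast
  have mN: "(\<lambda>r. map r [0..<Suc n]) \<in> N \<rightarrow>\<^sub>M count_space UNIV"
    using measurable_path_prefix measurable_cong_sets[OF N refl] by blast
  have sp: "space M = UNIV" "space N = UNIV"
    using sets_eq_imp_space_eq[OF M] sets_eq_imp_space_eq[OF N] by (simp_all add: space_path_space)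
  have "emeasure (distr M (count_space UNIV) (\<lambda>r. map r [0..<Suc n])) {l. P l} =
      emeasure (distr N (count_space UNIV) (\<lambda>r. map r [0..<Suc n])) {l. P l}"
    using distr_prefix_eqI[OF assms] by simp
  then show ?thesis
    by (simp add: emeasure_distr[OF mM] emeasure_distr[OF mN] sp vimage_def del: upt_Suc)
qed

text \<open>The generating rectangles constrain an arbitrary finite index set and are no cylinders,
  but each of them is an event of a sufficiently long prefix.\<close>

lemma path_measure_eqI:
  assumes M: "sets M = sets path_space" and N: "sets N = sets path_space"
    and fin: "finite_measure M"
    and eq: "\<And>n qs. emeasure M {r. \<forall>i\<le>n. r i = qs i} = emeasure N {r. \<forall>i\<le>n. r i = qs i}"
  shows "M = N"
proof (rule measure_eqI_PiM_infinite[OF M N _ fin])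
  fix A :: "nat \<Rightarrow> nat set" and J :: "nat set"
  assume J: "finite J"
  \<comment> \<open>The inserted 0 covers the case of an empty \<open>J\<close>.\<close>
  define n where "n = Max (insert 0 J)"
  have Jn: "j \<le> n" if "j \<in> J" for j
    using that J by (simp add: n_def)
  define P where "P = (\<lambda>l. \<forall>j\<in>J. l ! j \<in> A j)"
  have "prod_emb UNIV (\<lambda>_. count_space UNIV) J (Pi\<^sub>E J A) = {r. \<forall>j\<in>J. r j \<in> A j}"
    by (auto simp: prod_emb_def space_PiM PiE_iff)
  also have "\<dots> = {r. P (map r [0..<Suc n])}"
    unfolding P_def by (intro Collect_cong ball_cong refl) (auto simp: Jn le_imp_less_Suc simp del: upt_Suc)
  finally show "emeasure M (prod_emb UNIV (\<lambda>_. count_space UNIV) J (Pi\<^sub>E J A)) =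
      emeasure N (prod_emb UNIV (\<lambda>_. count_space UNIV) J (Pi\<^sub>E J A))"
    using emeasure_prefix_event_eqI[OF M N eq, where n=n and P=P] by simp
qed

text \<open>\<open>run_measure\<close> is a definite description: the noise construction gives
  existence, and agreement on cylinders gives uniqueness.\<close>

lemma run_measure_eq_chain: "run_measure A w = chain (init A) (\<lambda>i q. trans A q (w i))"
  unfolding run_measure_def
proof (rule the_equality)
  show "prob_space (chain (init A) (\<lambda>i q. trans A q (w i))) \<and>
      sets (chain (init A) (\<lambda>i q. trans A q (w i))) = sets path_space \<and>
      (\<forall>n qs. emeasure (chain (init A) (\<lambda>i q. trans A q (w i))) {r. \<forall>i\<le>n. r i = qs i} =
        ennreal (pmf (init A) (qs 0) * (\<Prod>i<n. pmf (trans A (qs i) (w i)) (qs (Suc i)))))"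
    by (simp add: prob_space_chain emeasure_chain_cylinder)
next
  fix M :: "(nat \<Rightarrow> nat) measure"
  assume *: "prob_space M \<and> sets M = sets path_space \<and>
      (\<forall>n qs. emeasure M {r. \<forall>i\<le>n. r i = qs i} =
        ennreal (pmf (init A) (qs 0) * (\<Prod>i<n. pmf (trans A (qs i) (w i)) (qs (Suc i)))))"
  then interpret prob_space M by blast
  show "M = chain (init A) (\<lambda>i q. trans A q (w i))"
    using * by (intro path_measure_eqI) (auto simp: emeasure_chain_cylinder finite_measure_axioms)
qed

lemma measure_chain_prefix_event_cong:
  assumes "\<And>i q. i < n \<Longrightarrow> k i q = k' i q"
  shows "measure (chain p k) {r. P (map r [0..<Suc n])} = measure (chain p k') {r. P (map r [0..<Suc n])}"
proof -
  have "emeasure (chain p k) {r. P (map r [0..<Suc n])} = emeasure (chain p k') {r. P (map r [0..<Suc n])}"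
    proof (rule emeasure_prefix_event_eqI)
    fix qs :: "nat \<Rightarrow> nat"
    have "(\<Prod>i<n. pmf (k i (qs i)) (qs (Suc i))) = (\<Prod>i<n. pmf (k' i (qs i)) (qs (Suc i)))"
      by (intro prod.cong refl) (use assms in auto)
    then show "emeasure (chain p k) {r. \<forall>i\<le>n. r i = qs i} = emeasure (chain p k') {r. \<forall>i\<le>n. r i = qs i}"
      by (simp add: emeasure_chain_cylinder)
  qed simp_all
  then show ?thesis by (simp add: measure_def)
qed

text \<open>On the noise, almost every sample has all its countably many coordinates in the
  respective supports, and then every path it can drive is a run.\<close>

lemma AE_chain_run:
  "AE r in chain p k. r 0 \<in> set_pmf p \<and> (\<forall>i. r (Suc i) \<in> set_pmf (k i (r i)))"
proof -
  define M where "M = (\<lambda>(i, q). measure_pmf (case i of 0 \<Rightarrow> p | Suc j \<Rightarrow> k j q))"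
  interpret product_prob_space M UNIV
    by (rule product_prob_spaceI) (auto simp: M_def prob_space_measure_pmf split: prod.splits)
  have noise: "noise p k = PiM UNIV M"
    by (simp add: noise_def M_def)
  have 1: "AE \<omega> in noise p k. \<omega> (0, 0) \<in> set_pmf p"
    unfolding noise
  proof (rule AE_component)
    have "M (0, 0) = measure_pmf p"
      by (simp add: M_def)
    then show "AE q in M (0, 0). q \<in> set_pmf p"
      using AE_measure_pmf[of p] by (rule ssubst)
  qed simp
  have 2: "AE \<omega> in noise p k. \<forall>i q. \<omega> (Suc i, q) \<in> set_pmf (k i q)"
    unfolding noise AE_all_countable
  proof (intro allI AE_component)
    fix i q
    have "M (Suc i, q) = measure_pmf (k i q)"
      by (simp add: M_def)
    then show "AE q' in M (Suc i, q). q' \<in> set_pmf (k i q)"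
      using AE_measure_pmf[of "k i q"] by (rule ssubst)
  qed simp
  have "AE \<omega> in noise p k. driven_path \<omega> 0 \<in> set_pmf p \<and>
      (\<forall>i. driven_path \<omega> (Suc i) \<in> set_pmf (k i (driven_path \<omega> i)))"
    using 1 2 by eventually_elim auto
  moreover have "Measurable.pred path_space (\<lambda>r. r 0 \<in> set_pmf p \<and> (\<forall>i. r (Suc i) \<in> set_pmf (k i (r i))))"
  proof -
    have "Measurable.pred path_space (\<lambda>r. r (Suc i) \<in> set_pmf (k i (r i)))" for i
      by (rule measurable_compose_countable[OF _ measurable_path_component]) measurable
    then show ?thesis by measurable
  qed
  ultimately show ?thesis
    unfolding chain_def
    by (subst AE_distr_iff[OF measurable_driven_path]) (simp_all add: pred_def space_path_space)
qed

section \<open>First-step decomposition and Markov property\<close>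

lemma measurable_case_nat_path [measurable]: "case_nat q \<in> path_space \<rightarrow>\<^sub>M path_space"
proof (rule measurable_PiM_single')
  fix i show "(\<lambda>r. case_nat q r i) \<in> path_space \<rightarrow>\<^sub>M count_space UNIV"
    by (cases i) simp_all
qed (auto simp: space_PiM)

lemma measurable_path_Suc [measurable]: "(\<lambda>r i. r (Suc i)) \<in> path_space \<rightarrow>\<^sub>M path_space"
  by (rule measurable_PiM_single') (auto simp: space_PiM)

lemma measurable_path_shift [measurable]: "(\<lambda>r i. r (n + i)) \<in> path_space \<rightarrow>\<^sub>M path_space"
  by (rule measurable_PiM_single') (auto simp: space_PiM)

text \<open>Given the first state \<open>q\<close>, the rest of the path is a chain with initial law
  \<open>k 0 q\<close> and shifted kernels. Comparing cylinder masses is enough.\<close>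

lemma chain_eq_bind:
  "chain p k = measure_pmf p \<bind> (\<lambda>q. distr (chain (k 0 q) (\<lambda>i. k (Suc i))) path_space (case_nat q))"
  (is "_ = measure_pmf p \<bind> ?N")
proof -
  have mcase: "case_nat q \<in> chain p' k' \<rightarrow>\<^sub>M path_space" for q p' k'
    using measurable_case_nat_path measurable_cong_sets[OF sets_chain refl] by blast
  have ps: "prob_space (?N q)" for q
    by (rule chain.prob_space_distr[OF mcase])
  have m: "?N \<in> measure_pmf p \<rightarrow>\<^sub>M subprob_algebra path_space"
    using ps by (auto simp: measurable_def space_subprob_algebra prob_space_imp_subprob_space)
  have sets: "sets (measure_pmf p \<bind> ?N) = sets path_space"
    by (rule sets_bind) auto
  show ?thesis
  proof (rule path_measure_eqI)
    fix n and qs :: "nat \<Rightarrow> nat"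
    define C where "C = {r :: nat \<Rightarrow> nat. \<forall>i\<le>n. r i = qs i}"
    have C: "C \<in> sets path_space"
      unfolding C_def by (rule sets_path_Collect) measurable
    define c where "c = (\<Prod>i<n. pmf (k i (qs i)) (qs (Suc i)))"
    have "emeasure (measure_pmf p \<bind> ?N) C = (\<integral>\<^sup>+ q. emeasure (?N q) C \<partial>measure_pmf p)"
      by (rule emeasure_bind[OF _ m C]) simp
    also have "\<dots> = (\<integral>\<^sup>+ q. indicator {qs 0} q * ennreal c \<partial>measure_pmf p)"
    proof (rule nn_integral_cong)
      fix q
      have *: "emeasure (?N q) C = emeasure (chain (k 0 q) (\<lambda>i. k (Suc i))) {r. case_nat q r \<in> C}"
        by (subst emeasure_distr[OF mcase C]) (simp add: vimage_def)
      show "emeasure (?N q) C = indicator {qs 0} q * ennreal c"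
      proof (cases "q = qs 0")
        case False
        then have "{r. case_nat q r \<in> C} = {}" by (auto simp: C_def)
        then show ?thesis using * False by simp
      next
        case True
        show ?thesis
        proof (cases n)
          case 0
          then have "{r. case_nat q r \<in> C} = UNIV" using True by (auto simp: C_def)
          then show ?thesis using * True 0 chain.emeasure_space_1 by (simp add: c_def)
        next
          case (Suc m)
          have "{r. case_nat q r \<in> C} = {r. \<forall>i\<le>m. r i = qs (Suc i)}"
            using True Suc by (auto simp: C_def split: nat.splits)
          then show ?thesis
            using * True Suc by (simp add: emeasure_chain_cylinder c_def prod.lessThan_Suc_shift del: prod.lessThan_Suc)
        qed
      qed
    qed
    also have "\<dots> = ennreal c * emeasure (measure_pmf p) {qs 0}"
      by (simp add: nn_integral_multc mult.commute)
    also have "\<dots> = emeasure (chain p k) C"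
      unfolding C_def emeasure_chain_cylinder
      by (simp add: emeasure_pmf_single c_def ennreal_mult prod_nonneg mult.commute)
    finally show "emeasure (chain p k) {r. \<forall>i\<le>n. r i = qs i} =
        emeasure (measure_pmf p \<bind> ?N) {r. \<forall>i\<le>n. r i = qs i}"
      by (simp add: C_def)
  qed (simp_all add: sets chain.finite_measure_axioms)
qed

lemma integrable_pmf_bounded:
  fixes f :: "'a \<Rightarrow> real"
  assumes "\<And>x. \<bar>f x\<bar> \<le> B"
  shows "integrable (measure_pmf p) f"
  by (rule measure_pmf.integrable_const_bound[where B=B]) (use assms in auto)

lemma measure_chain_bind:
  assumes "E \<in> sets path_space"
  shows "measure (chain p k) E =
    (\<integral>q. measure (chain (k 0 q) (\<lambda>i. k (Suc i))) {r. case_nat q r \<in> E} \<partial>measure_pmf p)"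
proof -
  have mcase: "case_nat q \<in> chain p' k' \<rightarrow>\<^sub>M path_space" for q p' k'
    using measurable_case_nat_path measurable_cong_sets[OF sets_chain refl] by blast
  let ?N = "\<lambda>q. distr (chain (k 0 q) (\<lambda>i. k (Suc i))) path_space (case_nat q)"
  have ps: "prob_space (?N q)" for q
    by (rule chain.prob_space_distr[OF mcase])
  have m: "?N \<in> measure_pmf p \<rightarrow>\<^sub>M subprob_algebra path_space"
    using ps by (auto simp: measurable_def space_subprob_algebra prob_space_imp_subprob_space)
  have "emeasure (chain p k) E = (\<integral>\<^sup>+ q. emeasure (?N q) E \<partial>measure_pmf p)"
    by (subst chain_eq_bind, rule emeasure_bind[OF _ m assms]) simp
  also have "\<dots> = (\<integral>\<^sup>+ q. ennreal (measure (chain (k 0 q) (\<lambda>i. k (Suc i))) {r. case_nat q r \<in> E}) \<partial>measure_pmf p)"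
    by (rule nn_integral_cong, subst emeasure_distr[OF mcase assms])
       (simp add: vimage_def chain.emeasure_eq_measure)
  also have "\<dots> = ennreal (\<integral>q. measure (chain (k 0 q) (\<lambda>i. k (Suc i))) {r. case_nat q r \<in> E} \<partial>measure_pmf p)"
    by (rule nn_integral_eq_integral) (auto intro!: integrable_pmf_bounded[where B=1])
  finally show ?thesis
    by (simp add: chain.emeasure_eq_measure integral_nonneg)
qed

lemma measure_chain_return:
  assumes "E \<in> sets path_space"
  shows "measure (chain (return_pmf q) k) E =
    measure (chain (k 0 q) (\<lambda>i. k (Suc i))) {r. case_nat q r \<in> E}"
  by (subst measure_chain_bind[OF assms]) simp

lemma measure_chain_initial:
  assumes "E \<in> sets path_space"
  shows "measure (chain p k) E = (\<integral>q. measure (chain (return_pmf q) k) E \<partial>measure_pmf p)"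
  by (simp add: measure_chain_return[OF assms]) (rule measure_chain_bind[OF assms])

text \<open>The law of the chain that is in state \<^term>\<open>q\<close> at time \<^term>\<open>n\<close>; its paths are indexed from \<open>0\<close>.\<close>

abbreviation chain_from :: "(nat \<Rightarrow> nat \<Rightarrow> nat pmf) \<Rightarrow> nat \<Rightarrow> nat \<Rightarrow> (nat \<Rightarrow> nat) measure" where
  "chain_from k n q \<equiv> chain (return_pmf q) (\<lambda>i. k (n + i))"

lemma measure_chain_from_step:
  assumes "E \<in> sets path_space"
  shows "measure (chain_from k n q) E =
    (\<integral>q'. measure (chain_from k (Suc n) q') {r. case_nat q r \<in> E} \<partial>measure_pmf (k n q))"
proof -
  have E': "{r. case_nat q r \<in> E} \<in> sets path_space"
    using measurable_sets[OF measurable_case_nat_path assms]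
    by (simp add: vimage_def space_path_space)
  show ?thesis
    using measure_chain_return[OF assms, of q "\<lambda>i. k (n + i)"]
      measure_chain_initial[OF E', of "k n q" "\<lambda>i. k (Suc n + i)"] by simp
qed

lemma AE_chain_from_0: "AE r in chain_from k n q. r 0 = q"
  using AE_chain_run by eventually_elim simp

primrec marginal :: "nat pmf \<Rightarrow> (nat \<Rightarrow> nat \<Rightarrow> nat pmf) \<Rightarrow> nat \<Rightarrow> nat pmf" where
  "marginal p k 0 = p"
| "marginal p k (Suc n) = bind_pmf (marginal p k n) (k n)"

lemma integral_bind_pmf_bounded:
  fixes f :: "nat \<Rightarrow> real"
  assumes f: "\<And>x. 0 \<le> f x" "\<And>x. f x \<le> 1"
  shows "(\<integral>x. f x \<partial>measure_pmf (bind_pmf p h)) = (\<integral>q. (\<integral>x. f x \<partial>measure_pmf (h q)) \<partial>measure_pmf p)"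
proof -
  have i: "integrable (measure_pmf p') f" for p'
    by (rule integrable_pmf_bounded[where B=1]) (use f in simp)
  have 01: "0 \<le> (\<integral>x. f x \<partial>measure_pmf p')" "(\<integral>x. f x \<partial>measure_pmf p') \<le> 1" for p'
    using f measure_pmf.integral_le_const[OF i, of 1] by (auto intro!: integral_nonneg)
  have "ennreal (\<integral>x. f x \<partial>measure_pmf (bind_pmf p h)) = (\<integral>\<^sup>+x. ennreal (f x) \<partial>measure_pmf (bind_pmf p h))"
    using f by (intro nn_integral_eq_integral[symmetric] i) auto
  also have "\<dots> = (\<integral>\<^sup>+q. (\<integral>\<^sup>+x. ennreal (f x) \<partial>measure_pmf (h q)) \<partial>measure_pmf p)"
    by simp
  also have "\<dots> = (\<integral>\<^sup>+q. ennreal (\<integral>x. f x \<partial>measure_pmf (h q)) \<partial>measure_pmf p)"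
    using f by (intro nn_integral_cong nn_integral_eq_integral i) auto
  also have "\<dots> = ennreal (\<integral>q. (\<integral>x. f x \<partial>measure_pmf (h q)) \<partial>measure_pmf p)"
    using 01 01(1)[THEN abs_of_nonneg]
    by (intro nn_integral_eq_integral integrable_pmf_bounded[where B=1]) simp_all
  finally show ?thesis
    using 01 by (simp add: integral_nonneg)
qed

lemma measure_chain_Suc:
  assumes "E \<in> sets path_space"
  shows "measure (chain p k) {r. (\<lambda>i. r (Suc i)) \<in> E} = measure (chain (bind_pmf p (k 0)) (\<lambda>i. k (Suc i))) E"
proof -
  have E': "{r. (\<lambda>i. r (Suc i)) \<in> E} \<in> sets path_space"
    using measurable_sets[OF measurable_path_Suc assms] by (simp add: vimage_def space_path_space)
  have "measure (chain p k) {r. (\<lambda>i. r (Suc i)) \<in> E} =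
      (\<integral>q. measure (chain (k 0 q) (\<lambda>i. k (Suc i))) E \<partial>measure_pmf p)"
    by (simp add: measure_chain_bind[OF E'])
  also have "\<dots> = (\<integral>q. (\<integral>q'. measure (chain (return_pmf q') (\<lambda>i. k (Suc i))) E \<partial>measure_pmf (k 0 q)) \<partial>measure_pmf p)"
    by (subst measure_chain_initial[OF assms]) simp
  also have "\<dots> = measure (chain (bind_pmf p (k 0)) (\<lambda>i. k (Suc i))) E"
    by (subst (2) measure_chain_initial[OF assms], subst integral_bind_pmf_bounded) auto
  finally show ?thesis .
qed

text \<open>The Markov property at a fixed time, by iterating the one-step shift.\<close>

lemma measure_chain_shift:
  assumes "E \<in> sets path_space"
  shows "measure (chain p k) {r. (\<lambda>i. r (n + i)) \<in> E} = measure (chain (marginal p k n) (\<lambda>i. k (n + i))) E"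
  using assms
proof (induction n arbitrary: E)
  case (Suc n)
  have E': "{r. (\<lambda>i. r (Suc i)) \<in> E} \<in> sets path_space"
    using measurable_sets[OF measurable_path_Suc Suc.prems] by (simp add: vimage_def space_path_space)
  show ?case
    using Suc.IH[OF E'] measure_chain_Suc[OF Suc.prems, of "marginal p k n" "\<lambda>i. k (n + i)"] by simp
qed simp

lemma measure_chain_at_time:
  assumes "E \<in> sets path_space"
  shows "measure (chain p k) {r. (\<lambda>i. r (n + i)) \<in> E} =
    (\<integral>q. measure (chain_from k n q) E \<partial>measure_pmf (marginal p k n))"
  unfolding measure_chain_shift[OF assms] by (rule measure_chain_initial[OF assms])

lemma measure_chain_state: "measure (chain p k) {r. r n = s} = pmf (marginal p k n) s"
proof -
  have E: "{r. r 0 = s} \<in> sets path_space"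
    by (rule sets_path_Collect) measurable
  have "measure (chain p' k') {r. r 0 = s} = pmf p' s" for p' k'
    using emeasure_chain_cylinder[of p' k' 0 "\<lambda>_. s"] by (simp add: chain.emeasure_eq_measure)
  then show ?thesis
    using measure_chain_shift[OF E, of p k n] by simp
qed

text \<open>The masses of the cylinders around \<open>x\<close> stop shrinking once all further
  steps are deterministic, and their limit is the mass of \<open>x\<close>.\<close>

lemma measure_chain_singleton_pos:
  assumes 0: "pmf p (x 0) > 0" and step: "\<And>i. pmf (k i (x i)) (x (Suc i)) > 0"
    and det: "\<And>i. n \<le> i \<Longrightarrow> pmf (k i (x i)) (x (Suc i)) = 1"
  shows "measure (chain p k) {x} > 0"
proof -
  define C where "C = (\<lambda>N. {r :: nat \<Rightarrow> nat. \<forall>i\<le>N. r i = x i})"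
  define c where "c = (\<lambda>N. pmf p (x 0) * (\<Prod>i<N. pmf (k i (x i)) (x (Suc i))))"
  have c_pos: "c N > 0" for N
    using 0 step by (auto simp: c_def intro!: mult_pos_pos prod_pos)
  have mC: "measure (chain p k) (C N) = c N" for N
    using emeasure_chain_cylinder[of p k N x] c_pos[of N]
    by (simp add: C_def c_def chain.emeasure_eq_measure)
  have C: "C N \<in> sets path_space" for N
    unfolding C_def by (rule sets_path_Collect) measurable
  have "c (n + j) = c n" for j
    by (induction j) (auto simp: c_def det)
  then have "(\<lambda>N. measure (chain p k) (C N)) \<longlonglongrightarrow> c n"
    unfolding mC by (intro LIMSEQ_offset[of c n]) (simp add: add.commute[of _ n])
  moreover have "(\<lambda>N. measure (chain p k) (C N)) \<longlonglongrightarrow> measure (chain p k) (\<Inter>N. C N)"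
    by (rule chain.finite_Lim_measure_decseq) (use C in \<open>auto simp: decseq_def C_def\<close>)
  ultimately have "measure (chain p k) (\<Inter>N. C N) = c n"
    using LIMSEQ_unique by blast
  moreover have "(\<Inter>N. C N) = {x}"
    by (auto simp: C_def)
  ultimately show ?thesis using c_pos by simp
qed

section \<open>Threshold characterisations of the three semantics\<close>

text \<open>Each of the finitely many values outside \<open>S\<close> occurs only finitely often, so
  the sequence eventually stays in \<open>S\<close>, and it returns to \<open>Max S\<close>
  forever.\<close>

lemma LimSup_eq_Max:
  assumes fin: "finite (range v)"
  defines "S \<equiv> {x. \<exists>\<^sub>\<infinity>i. v i = x}"
  shows "finite S" "S \<noteq> {}" "LimSup v = real_of_rat (Max S)" "\<forall>\<^sub>\<infinity>i. v i \<le> Max S"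
proof -
  have sub: "S \<subseteq> range v"
    by (auto simp: S_def dest!: INFM_EX)
  then show fS: "finite S"
    using fin finite_subset by blast
  obtain x where "infinite {a \<in> UNIV. v a = v x}"
    using pigeonhole_infinite[of UNIV v] fin by auto
  then show neS: "S \<noteq> {}"
    by (auto simp: S_def INFM_iff_infinite)
  have "\<forall>\<^sub>\<infinity>i. v i \<notin> range v - S"
  proof -
    have "finite (\<Union>x\<in>range v - S. {i. v i = x})"
      using fin by (auto simp: S_def INFM_iff_infinite)
    moreover have "{i. v i \<in> range v - S} \<subseteq> (\<Union>x\<in>range v - S. {i. v i = x})"
      by blast
    ultimately show ?thesis
      unfolding MOST_iff_cofinite using finite_subset by auto
  qed
  then show ev: "\<forall>\<^sub>\<infinity>i. v i \<le> Max S"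
    by (rule MOST_mono) (use fS in auto)
  have "limsup (\<lambda>n. ereal (real_of_rat (v n))) \<le> ereal (real_of_rat (Max S))"
  proof (rule Limsup_bounded)
    show "eventually (\<lambda>n. ereal (real_of_rat (v n)) \<le> ereal (real_of_rat (Max S))) sequentially"
      using ev unfolding cofinite_eq_sequentially by eventually_elim (simp add: of_rat_less_eq)
  qed
  moreover have "ereal (real_of_rat (Max S)) \<le> limsup (\<lambda>n. ereal (real_of_rat (v n)))"
  proof (rule ccontr)
    assume "\<not> ?thesis"
    then have "eventually (\<lambda>n. ereal (real_of_rat (v n)) < ereal (real_of_rat (Max S))) sequentially"
      by (intro Limsup_lessD) auto
    then have "\<forall>\<^sub>\<infinity>n. v n \<noteq> Max S"
      unfolding cofinite_eq_sequentially by eventually_elim auto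
    moreover have "\<exists>\<^sub>\<infinity>n. v n = Max S"
      using Max_in[OF fS neS] by (simp add: S_def)
    ultimately show False
      by (simp add: not_INFM[symmetric])
  qed
  ultimately show "LimSup v = real_of_rat (Max S)"
    unfolding LimSup_def by (metis antisym real_of_ereal.simps(1))
qed

lemma LimSup_in_range:
  assumes "finite (range v)"
  shows "LimSup v \<in> real_of_rat ` range v"
proof -
  have "Max {x. \<exists>\<^sub>\<infinity>i. v i = x} \<in> {x. \<exists>\<^sub>\<infinity>i. v i = x}"
    using LimSup_eq_Max(1,2)[OF assms] by (rule Max_in)
  then show ?thesis
    unfolding LimSup_eq_Max(3)[OF assms] by (metis (mono_tags, lifting) INFM_EX imageI mem_Collect_eq rangeI)
qed

text \<open>The finite range is essential: values increasing strictly to \<open>\<eta>\<close> have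
  limit superior \<open>\<eta>\<close> without ever reaching it.\<close>

lemma le_LimSup_iff:
  assumes fin: "finite (range v)"
  shows "\<eta> \<le> LimSup v \<longleftrightarrow> (\<exists>\<^sub>\<infinity>i. \<eta> \<le> real_of_rat (v i))"
proof
  let ?S = "{x. \<exists>\<^sub>\<infinity>i. v i = x}"
  note L = LimSup_eq_Max[OF fin]
  have M: "\<exists>\<^sub>\<infinity>i. v i = Max ?S"
    using Max_in[OF L(1,2)] by simp
  show "\<exists>\<^sub>\<infinity>i. \<eta> \<le> real_of_rat (v i)" if "\<eta> \<le> LimSup v"
    by (rule INFM_mono[OF M]) (use that L(3) in auto)
  show "\<eta> \<le> LimSup v" if "\<exists>\<^sub>\<infinity>i. \<eta> \<le> real_of_rat (v i)"
  proof -
    have "\<exists>i. \<eta> \<le> real_of_rat (v i) \<and> v i \<le> Max ?S"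
      using INFM_conjI[OF that L(4)] by (rule INFM_EX)
    then obtain i where "\<eta> \<le> real_of_rat (v i)" "v i \<le> Max ?S"
      by blast
    moreover from this(2) have "real_of_rat (v i) \<le> real_of_rat (Max ?S)"
      by (simp add: of_rat_less_eq)
    ultimately show ?thesis unfolding L(3) by linarith
  qed
qed

definition weights :: "nat set \<Rightarrow> pwa \<Rightarrow> rat set" where
  "weights \<Sigma> A = (\<lambda>(q, \<sigma>, q'). weight A q \<sigma> q') ` (states A \<times> \<Sigma> \<times> states A)"

text \<open>The Buechi condition that replaces \<open>\<eta> \<le> val A w r\<close>. The two agree
  on runs; other paths may leave the state set and collect unbounded weights, but they form a null
  set.\<close>

definition io_ge :: "pwa \<Rightarrow> (nat \<Rightarrow> nat) \<Rightarrow> real \<Rightarrow> (nat \<Rightarrow> nat) \<Rightarrow> bool" where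
  "io_ge A w \<eta> r \<longleftrightarrow> (\<exists>\<^sub>\<infinity>i. \<eta> \<le> real_of_rat (weight_seq A w r i))"

lemma finite_weights: "wf_pwa \<Sigma> A \<Longrightarrow> finite \<Sigma> \<Longrightarrow> finite (weights \<Sigma> A)"
  by (auto simp: weights_def wf_pwa_def)

lemma weightsI: "q \<in> states A \<Longrightarrow> \<sigma> \<in> \<Sigma> \<Longrightarrow> q' \<in> states A \<Longrightarrow> weight A q \<sigma> q' \<in> weights \<Sigma> A"
  by (force simp: weights_def)

lemma is_run_iff: "is_run A w r \<longleftrightarrow>
    r 0 \<in> set_pmf (init A) \<and> (\<forall>i. r (Suc i) \<in> set_pmf (trans A (r i) (w i)))"
  by (simp add: is_run_def pmf_positive_iff)

lemma is_run_states:
  assumes "wf_pwa \<Sigma> A" "range w \<subseteq> \<Sigma>" "is_run A w r"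
  shows "r i \<in> states A"
proof (induction i)
  case (Suc i)
  have "w i \<in> \<Sigma>" using assms(2) by auto
  with Suc assms(1,3) show ?case
    unfolding is_run_iff wf_pwa_def by blast
qed (use assms in \<open>auto simp: is_run_iff wf_pwa_def\<close>)

lemma weight_seq_in_weights:
  assumes "wf_pwa \<Sigma> A" "range w \<subseteq> \<Sigma>" "is_run A w r"
  shows "weight_seq A w r i \<in> weights \<Sigma> A"
  unfolding weight_seq_def using assms is_run_states[OF assms] by (intro weightsI) auto

lemma finite_range_weight_seq:
  assumes "wf_pwa \<Sigma> A" "finite \<Sigma>" "range w \<subseteq> \<Sigma>" "is_run A w r"
  shows "finite (range (weight_seq A w r))"
  using weight_seq_in_weights[OF assms(1,3,4)] finite_weights[OF assms(1,2)]
  by (meson finite_subset image_subsetI)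

lemma le_val_iff:
  assumes "wf_pwa \<Sigma> A" "finite \<Sigma>" "range w \<subseteq> \<Sigma>" "is_run A w r"
  shows "\<eta> \<le> val A w r \<longleftrightarrow> io_ge A w \<eta> r"
  unfolding val_def io_ge_def by (rule le_LimSup_iff[OF finite_range_weight_seq[OF assms]])

lemma val_in_weights:
  assumes "wf_pwa \<Sigma> A" "finite \<Sigma>" "range w \<subseteq> \<Sigma>" "is_run A w r"
  shows "val A w r \<in> real_of_rat ` weights \<Sigma> A"
  using LimSup_in_range[OF finite_range_weight_seq[OF assms]] weight_seq_in_weights[OF assms(1,3,4)]
  unfolding val_def by auto

abbreviation word_kernel :: "pwa \<Rightarrow> (nat \<Rightarrow> nat) \<Rightarrow> nat \<Rightarrow> nat \<Rightarrow> nat pmf" where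
  "word_kernel A w \<equiv> \<lambda>i q. trans A q (w i)"

lemma AE_is_run: "AE r in chain (init A) (word_kernel A w). is_run A w r"
  using AE_chain_run[of "init A" "word_kernel A w"] by eventually_elim (simp add: is_run_iff)

text \<open>Almost every path is a run and the whole space has measure 1, so a run exists.\<close>

lemma ex_run: obtains r where "is_run A w r"
proof -
  have "\<exists>r. is_run A w r"
  proof (rule ccontr)
    assume "\<nexists>r. is_run A w r"
    then have "AE r in chain (init A) (word_kernel A w). False"
      using AE_is_run[of A w] by simp
    then show False by (simp add: chain.AE_False)
  qed
  then show ?thesis using that by blast
qed

lemma pred_transition:
  "Measurable.pred path_space (\<lambda>r. W (r i) (r (Suc i)))"
  by (rule measurable_compose_countable[OF measurable_compose_countable[OF measurable_const]])
     (auto intro: measurable_path_component)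

lemma pred_io_transition: "Measurable.pred path_space (\<lambda>r. \<exists>\<^sub>\<infinity>i. W i (r i) (r (Suc i)))"
  unfolding INFM_nat using pred_transition by measurable

lemma sets_io_ge: "{r. io_ge A w \<eta> r} \<in> sets path_space"
  unfolding io_ge_def weight_seq_def
  by (rule sets_path_Collect[OF pred_io_transition])

lemma measurable_val: "val A w \<in> borel_measurable path_space"
proof -
  have *: "(\<lambda>r. ereal (real_of_rat (weight A (r i) (w i) (r (Suc i))))) \<in> borel_measurable path_space" for i
    by (rule measurable_compose_countable[OF measurable_compose_countable[OF measurable_const]])
       (auto intro: measurable_path_component)
  show ?thesis
    unfolding val_def LimSup_def weight_seq_def
    by (intro borel_measurable_real_of_ereal borel_measurable_limsup *)
qed

lemma sets_le_val: "{r. \<eta> \<le> val A w r} \<in> sets path_space"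
  by (rule sets_path_Collect) (use measurable_val in measurable)

text \<open>The thresholds form a closed ray \<open>{..m}\<close> whose end point is the largest
  admissible element of \<open>V\<close>; this excludes an unspecified \<open>Sup\<close> of an
  empty or unbounded set.\<close>

lemma le_Sup_downset_iff:
  fixes Q :: "real \<Rightarrow> bool"
  assumes fin: "finite V" and down: "\<And>\<eta> \<eta>'. Q \<eta> \<Longrightarrow> \<eta>' \<le> \<eta> \<Longrightarrow> Q \<eta>'"
    and attained: "\<And>\<eta>. Q \<eta> \<Longrightarrow> \<exists>x\<in>V. \<eta> \<le> x \<and> Q x" and ex: "Q \<eta>0"
  shows "\<eta> \<le> Sup {\<eta>. Q \<eta>} \<longleftrightarrow> Q \<eta>"
proof -
  define m where "m = Max {x \<in> V. Q x}"
  have ne: "{x \<in> V. Q x} \<noteq> {}" using attained[OF ex] by auto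
  have "m \<in> {x \<in> V. Q x}"
    unfolding m_def using fin ne by (intro Max_in) auto
  moreover have "x \<le> m" if Qx: "Q x" for x
  proof -
    obtain y where "y \<in> {x \<in> V. Q x}" "x \<le> y"
      using attained[OF Qx] by auto
    moreover from this(1) have "y \<le> m"
      unfolding m_def using fin by (intro Max_ge) auto
    ultimately show ?thesis by simp
  qed
  ultimately have "{\<eta>. Q \<eta>} = {..m}"
    using down by auto
  moreover from this have "Q \<eta> \<longleftrightarrow> \<eta> \<le> m" by auto
  ultimately show ?thesis by simp
qed

text \<open>\<open>R\<close> stands for "positive" or "equal to 1". That \<open>R 1\<close> holds
  makes the least weight an admissible threshold, and the failure of \<open>R 0\<close> excludes
  thresholds above all weights.\<close>

lemma le_Sup_measure_iff:
  assumes wf: "wf_pwa \<Sigma> A" and \<Sigma>: "finite \<Sigma>" and w: "range w \<subseteq> \<Sigma>"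
    and R: "\<And>a b. R a \<Longrightarrow> a \<le> b \<Longrightarrow> b \<le> 1 \<Longrightarrow> R b" "R 1" "\<not> R 0"
  shows "\<eta> \<le> Sup {\<eta>. R (measure (run_measure A w) {r. \<eta> \<le> val A w r})} \<longleftrightarrow>
    R (measure (chain (init A) (word_kernel A w)) {r. io_ge A w \<eta> r})"
proof -
  define k where "k = word_kernel A w"
  define P where "P = (\<lambda>\<eta>. measure (chain (init A) k) {r. \<eta> \<le> val A w r})"
  define V where "V = real_of_rat ` weights \<Sigma> A"
  have finV: "finite V" using finite_weights[OF wf \<Sigma>] by (simp add: V_def)
  have run: "AE r in chain (init A) k. is_run A w r"
    unfolding k_def by (rule AE_is_run)
  have mono: "P \<eta> \<le> P \<eta>'" if "\<And>r. is_run A w r \<Longrightarrow> \<eta> \<le> val A w r \<Longrightarrow> \<eta>' \<le> val A w r" for \<eta> \<eta>'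
    unfolding P_def by (rule chain.finite_measure_mono_AE)
      (use run that sets_le_val in \<open>auto elim: eventually_mono\<close>)
  have eq: "measure (chain (init A) k) {r. io_ge A w \<eta> r} = P \<eta>" for \<eta>
    unfolding P_def
    by (rule chain.finite_measure_eq_AE)
       (use run le_val_iff[OF wf \<Sigma> w] sets_le_val sets_io_ge in \<open>auto elim: eventually_mono\<close>)
  have "\<eta> \<le> Sup {\<eta>. R (P \<eta>)} \<longleftrightarrow> R (P \<eta>)"
  proof (rule le_Sup_downset_iff[OF finV])
    fix \<eta> \<eta>' :: real assume "R (P \<eta>)" "\<eta>' \<le> \<eta>"
    moreover have "P \<eta> \<le> P \<eta>'" by (rule mono) (use \<open>\<eta>' \<le> \<eta>\<close> in simp)
    moreover have "P \<eta>' \<le> 1" by (simp add: P_def)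
    ultimately show "R (P \<eta>')" using R(1) by blast
  next
    fix \<eta> assume "R (P \<eta>)"
    \<comment> \<open>The threshold is rounded up to the next weight. Runs have weights as values,
      so the probability does not drop.\<close>
    define U where "U = {x \<in> V. \<eta> \<le> x}"
    have "U \<noteq> {}"
    proof
      assume "U = {}"
      from run have "AE r in chain (init A) k. r \<notin> {r. \<eta> \<le> val A w r}"
        by eventually_elim (use \<open>U = {}\<close> val_in_weights[OF wf \<Sigma> w] in \<open>auto simp: U_def V_def\<close>)
      then have "P \<eta> = 0"
        unfolding P_def using sets_le_val by (simp add: chain.prob_eq_0)
      then show False using R(3) \<open>R (P \<eta>)\<close> by simp
    qed
    have finU: "finite U" using finV by (simp add: U_def)
    have MU: "Min U \<in> U" using finU \<open>U \<noteq> {}\<close> by (rule Min_in)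
    have "P \<eta> \<le> P (Min U)"
    proof (rule mono)
      fix r assume "is_run A w r" "\<eta> \<le> val A w r"
      then have "val A w r \<in> U"
        using val_in_weights[OF wf \<Sigma> w] by (auto simp: U_def V_def)
      then show "Min U \<le> val A w r" using finU by simp
    qed
    moreover have "P (Min U) \<le> 1" by (simp add: P_def)
    ultimately have "R (P (Min U))" using R(1) \<open>R (P \<eta>)\<close> by blast
    then show "\<exists>x\<in>V. \<eta> \<le> x \<and> R (P x)" using MU by (auto simp: U_def)
  next
    have "AE r in chain (init A) k. r \<in> {r. Min V \<le> val A w r}"
      using run by eventually_elim (use val_in_weights[OF wf \<Sigma> w] finV in \<open>auto simp: V_def\<close>)
    then have "P (Min V) = 1"
      unfolding P_def using sets_le_val by (simp add: chain.prob_eq_1)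
    then show "R (P (Min V))" using R(2) by simp
  qed
  then show ?thesis
    using eq by (simp add: run_measure_eq_chain P_def k_def)
qed

lemma le_L_pos_iff:
  assumes "wf_pwa \<Sigma> A" "finite \<Sigma>" "range w \<subseteq> \<Sigma>"
  shows "\<eta> \<le> L_pos A w \<longleftrightarrow> measure (chain (init A) (word_kernel A w)) {r. io_ge A w \<eta> r} > 0"
  unfolding L_pos_def by (rule le_Sup_measure_iff[OF assms]) auto

lemma le_L_as_iff:
  assumes "wf_pwa \<Sigma> A" "finite \<Sigma>" "range w \<subseteq> \<Sigma>"
  shows "\<eta> \<le> L_as A w \<longleftrightarrow> measure (chain (init A) (word_kernel A w)) {r. io_ge A w \<eta> r} = 1"
  unfolding L_as_def by (rule le_Sup_measure_iff[OF assms]) auto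

lemma le_L_max_iff:
  assumes wf: "wf_pwa \<Sigma> A" and \<Sigma>: "finite \<Sigma>" and w: "range w \<subseteq> \<Sigma>"
  shows "\<eta> \<le> L_max A w \<longleftrightarrow> (\<exists>r. is_run A w r \<and> io_ge A w \<eta> r)"
proof -
  let ?S = "{val A w r | r. is_run A w r}"
  have "?S \<subseteq> real_of_rat ` weights \<Sigma> A"
    using val_in_weights[OF wf \<Sigma> w] by auto
  then have fin: "finite ?S"
    using finite_weights[OF wf \<Sigma>] finite_subset by blast
  obtain r0 where "is_run A w r0" by (rule ex_run)
  then have ne: "?S \<noteq> {}" by auto
  have "\<eta> \<le> L_max A w \<longleftrightarrow> (\<exists>x\<in>?S. \<eta> \<le> x)"
    unfolding L_max_def cSup_eq_Max[OF fin ne] by (rule Max_ge_iff[OF fin ne])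
  then show ?thesis
    using le_val_iff[OF wf \<Sigma> w] by auto
qed

lemma eq_if_same_lower_bounds:
  fixes x y :: real
  assumes "\<And>\<eta>. \<eta> \<le> x \<longleftrightarrow> \<eta> \<le> y"
  shows "x = y"
  using assms order_antisym by blast

section \<open>Resampling from the belief support\<close>

lemma integral_pmf_cong:
  fixes f g :: "'a \<Rightarrow> real"
  assumes "\<And>x. x \<in> set_pmf p \<Longrightarrow> f x = g x"
  shows "(\<integral>x. f x \<partial>measure_pmf p) = (\<integral>x. g x \<partial>measure_pmf p)"
  using assms by (intro integral_cong_AE) (auto simp: AE_measure_pmf_iff)

lemma integral_pmf_mono:
  fixes f g :: "'a \<Rightarrow> real"
  assumes "\<And>x. x \<in> set_pmf p \<Longrightarrow> f x \<le> g x" "\<And>x. \<bar>f x\<bar> \<le> B" "\<And>x. \<bar>g x\<bar> \<le> B'"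
  shows "(\<integral>x. f x \<partial>measure_pmf p) \<le> (\<integral>x. g x \<partial>measure_pmf p)"
  using assms
  by (intro integral_mono_AE integrable_pmf_bounded[where B=B] integrable_pmf_bounded[where B=B'])
     (auto simp: AE_measure_pmf_iff)

lemma integral_pmf_eq_0_iff:
  fixes f :: "'a \<Rightarrow> real"
  assumes "\<And>x. 0 \<le> f x" "\<And>x. f x \<le> 1"
  shows "(\<integral>x. f x \<partial>measure_pmf p) = 0 \<longleftrightarrow> (\<forall>x\<in>set_pmf p. f x = 0)"
  using assms
  by (subst integral_nonneg_eq_0_iff_AE) (auto intro!: integrable_pmf_bounded[where B=1] simp: AE_measure_pmf_iff)

lemma integral_pmf_ge_imp_ex:
  fixes f :: "'a \<Rightarrow> real"
  assumes "c \<le> (\<integral>x. f x \<partial>measure_pmf p)" "\<And>x. \<bar>f x\<bar> \<le> 1"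
  shows "\<exists>x\<in>set_pmf p. c \<le> f x"
proof (rule ccontr)
  assume "\<not> ?thesis"
  then have "AE x in measure_pmf p. f x < c"
    by (auto simp: AE_measure_pmf_iff)
  then have "(\<integral>x. f x \<partial>measure_pmf p) < (\<integral>x. c \<partial>measure_pmf p)"
    using assms(2) by (intro measure_pmf.integral_less_AE_space integrable_pmf_bounded[where f=f and B=1] integrable_const)
      (auto simp: measure_pmf.emeasure_space_1)
  then show False using assms(1) by simp
qed

lemma all_nat_iff: "(\<forall>i. P i) \<longleftrightarrow> P 0 \<and> (\<forall>i. P (Suc i))"
  by (metis not0_implies_Suc)

lemma INFM_Suc_iff: "(\<exists>\<^sub>\<infinity>i. P (Suc i)) \<longleftrightarrow> (\<exists>\<^sub>\<infinity>i. P i)"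
  using MOST_Suc_iff[of "\<lambda>i. \<not> P i"] by (simp add: not_INFM[symmetric] del: not_INFM)

lemma INFM_shift_iff: "(\<exists>\<^sub>\<infinity>i. P (n + i :: nat)) \<longleftrightarrow> (\<exists>\<^sub>\<infinity>i. P i)"
proof (induction n)
  case (Suc n)
  then show ?case using INFM_Suc_iff[of "\<lambda>i. P (n + i)"] by simp
qed simp

section \<open>Probabilities of silence and recurrence from a given time and state\<close>

definition prob_quiet :: "(nat \<Rightarrow> nat \<Rightarrow> nat pmf) \<Rightarrow> (nat \<Rightarrow> nat \<Rightarrow> nat \<Rightarrow> bool) \<Rightarrow> nat \<Rightarrow> nat \<Rightarrow> nat \<Rightarrow> real" where
  "prob_quiet k W N n q = measure (chain_from k n q) {r. \<forall>i<N. \<not> W (n + i) (r i) (r (Suc i))}"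

definition prob_never :: "(nat \<Rightarrow> nat \<Rightarrow> nat pmf) \<Rightarrow> (nat \<Rightarrow> nat \<Rightarrow> nat \<Rightarrow> bool) \<Rightarrow> nat \<Rightarrow> nat \<Rightarrow> real" where
  "prob_never k W n q = measure (chain_from k n q) {r. \<forall>i. \<not> W (n + i) (r i) (r (Suc i))}"

definition prob_io :: "(nat \<Rightarrow> nat \<Rightarrow> nat pmf) \<Rightarrow> (nat \<Rightarrow> nat \<Rightarrow> nat \<Rightarrow> bool) \<Rightarrow> nat \<Rightarrow> nat \<Rightarrow> real" where
  "prob_io k W n q = measure (chain_from k n q) {r. \<exists>\<^sub>\<infinity>i. W (n + i) (r i) (r (Suc i))}"

text \<open>The horizon \<open>N\<close> for the first \<open>W\<close> transition permits
  induction. Nothing is lost in the limit, since recurrence implies a first occurrence.\<close>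

definition prob_io_within :: "(nat \<Rightarrow> nat \<Rightarrow> nat pmf) \<Rightarrow> (nat \<Rightarrow> nat \<Rightarrow> nat \<Rightarrow> bool) \<Rightarrow> nat \<Rightarrow> nat \<Rightarrow> nat \<Rightarrow> real" where
  "prob_io_within k W N n q = measure (chain_from k n q)
    {r. (\<exists>\<^sub>\<infinity>i. W (n + i) (r i) (r (Suc i))) \<and> (\<exists>i<N. W (n + i) (r i) (r (Suc i)))}"

lemma prob_bounds [simp]:
  "0 \<le> prob_quiet k W N n q" "prob_quiet k W N n q \<le> 1"
  "0 \<le> prob_never k W n q" "prob_never k W n q \<le> 1"
  "0 \<le> prob_io k W n q" "prob_io k W n q \<le> 1"
  "0 \<le> prob_io_within k W N n q" "prob_io_within k W N n q \<le> 1"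
  by (simp_all add: prob_quiet_def prob_never_def prob_io_def prob_io_within_def)

lemma prob_abs_bounds [simp]:
  "\<bar>prob_never k W n q\<bar> \<le> 1"
  "\<bar>prob_io k W n q\<bar> \<le> 1" "\<bar>prob_io_within k W N n q\<bar> \<le> 1"
  by simp_all

lemma sets_quiet: "{r. \<forall>i<N. \<not> W (n + i) (r i) (r (Suc i))} \<in> sets path_space"
proof (rule sets_path_Collect)
  have "Measurable.pred path_space (\<lambda>r. \<not> W (n + i) (r i) (r (Suc i)))" for i
    by (rule pred_transition)
  then show "Measurable.pred path_space (\<lambda>r. \<forall>i<N. \<not> W (n + i) (r i) (r (Suc i)))"
    by measurable
qed

lemma sets_never: "{r. \<forall>i. \<not> W (n + i) (r i) (r (Suc i))} \<in> sets path_space"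
proof (rule sets_path_Collect)
  have "Measurable.pred path_space (\<lambda>r. \<not> W (n + i) (r i) (r (Suc i)))" for i
    by (rule pred_transition)
  then show "Measurable.pred path_space (\<lambda>r. \<forall>i. \<not> W (n + i) (r i) (r (Suc i)))"
    by measurable
qed

lemma sets_io: "{r. \<exists>\<^sub>\<infinity>i. W (n + i) (r i) (r (Suc i))} \<in> sets path_space"
  by (rule sets_path_Collect[OF pred_io_transition])

lemma sets_io_within:
  "{r. (\<exists>\<^sub>\<infinity>i. W (n + i) (r i) (r (Suc i))) \<and> (\<exists>i<N. W (n + i) (r i) (r (Suc i)))} \<in> sets path_space"
  using sets.Diff[OF sets_io sets_quiet, of W n N W n]
  by (rule back_subst[of "\<lambda>S. S \<in> sets path_space"]) auto

text \<open>\<open>F\<close> may depend on the successor state because the remaining path almost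
  surely starts in it.\<close>

lemma measure_chain_from_step_cong:
  assumes E: "E \<in> sets path_space" and F: "\<And>q'. F q' \<in> sets path_space"
    and EF: "\<And>r. case_nat q r \<in> E \<longleftrightarrow> r \<in> F (r 0)"
  shows "measure (chain_from k n q) E =
    (\<integral>q'. measure (chain_from k (Suc n) q') (F q') \<partial>measure_pmf (k n q))"
  unfolding measure_chain_from_step[OF E]
proof (rule integral_pmf_cong)
  fix q'
  have E': "{r. case_nat q r \<in> E} \<in> sets path_space"
    using measurable_sets[OF measurable_case_nat_path E] by (simp add: vimage_def space_path_space)
  show "measure (chain_from k (Suc n) q') {r. case_nat q r \<in> E} = measure (chain_from k (Suc n) q') (F q')"
    by (rule chain.finite_measure_eq_AE)
       (use AE_chain_from_0[of q' k "Suc n"] E' F EF in \<open>auto elim: eventually_mono\<close>)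
qed

lemma prob_quiet_0 [simp]: "prob_quiet k W 0 n q = 1"
  using chain.prob_space by (simp add: prob_quiet_def)

lemma prob_io_within_0 [simp]: "prob_io_within k W 0 n q = 0"
  by (simp add: prob_io_within_def)

lemma prob_quiet_Suc:
  "prob_quiet k W (Suc N) n q =
    (\<integral>q'. (if W n q q' then 0 else prob_quiet k W N (Suc n) q') \<partial>measure_pmf (k n q))"
proof -
  define F where "F = (\<lambda>q'. if W n q q' then {} else {r. \<forall>i<N. \<not> W (Suc n + i) (r i) (r (Suc i))})"
  have "prob_quiet k W (Suc N) n q = (\<integral>q'. measure (chain_from k (Suc n) q') (F q') \<partial>measure_pmf (k n q))"
    unfolding prob_quiet_def
  proof (rule measure_chain_from_step_cong)
    show "F q' \<in> sets path_space" for q'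
      using sets_quiet[of N W "Suc n"] by (simp add: F_def)
    show "case_nat q r \<in> {r. \<forall>i<Suc N. \<not> W (n + i) (r i) (r (Suc i))} \<longleftrightarrow> r \<in> F (r 0)" for r
      by (simp add: F_def All_less_Suc2)
  qed (rule sets_quiet)
  also have "\<dots> = (\<integral>q'. (if W n q q' then 0 else prob_quiet k W N (Suc n) q') \<partial>measure_pmf (k n q))"
    by (rule integral_pmf_cong) (simp add: F_def prob_quiet_def)
  finally show ?thesis .
qed

lemma prob_never_step:
  "prob_never k W n q =
    (\<integral>q'. (if W n q q' then 0 else prob_never k W (Suc n) q') \<partial>measure_pmf (k n q))"
proof -
  define F where "F = (\<lambda>q'. if W n q q' then {} else {r. \<forall>i. \<not> W (Suc n + i) (r i) (r (Suc i))})"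
  have "prob_never k W n q = (\<integral>q'. measure (chain_from k (Suc n) q') (F q') \<partial>measure_pmf (k n q))"
    unfolding prob_never_def
  proof (rule measure_chain_from_step_cong)
    show "F q' \<in> sets path_space" for q'
      using sets_never[of W "Suc n"] by (simp add: F_def)
    show "case_nat q r \<in> {r. \<forall>i. \<not> W (n + i) (r i) (r (Suc i))} \<longleftrightarrow> r \<in> F (r 0)" for r
      using all_nat_iff[of "\<lambda>i. \<not> W (n + i) (case_nat q r i) (case_nat q r (Suc i))"]
      by (simp add: F_def)
  qed (rule sets_never)
  also have "\<dots> = (\<integral>q'. (if W n q q' then 0 else prob_never k W (Suc n) q') \<partial>measure_pmf (k n q))"
    by (rule integral_pmf_cong) (simp add: F_def prob_never_def)
  finally show ?thesis .
qed

text \<open>Once a \<open>W\<close> transition has occurred the horizon is met, and only the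
  unrestricted recurrence probability remains.\<close>

lemma prob_io_within_Suc:
  "prob_io_within k W (Suc N) n q =
    (\<integral>q'. (if W n q q' then prob_io k W (Suc n) q' else prob_io_within k W N (Suc n) q') \<partial>measure_pmf (k n q))"
proof -
  define F where "F = (\<lambda>q'. if W n q q' then {r. \<exists>\<^sub>\<infinity>i. W (Suc n + i) (r i) (r (Suc i))}
    else {r. (\<exists>\<^sub>\<infinity>i. W (Suc n + i) (r i) (r (Suc i))) \<and> (\<exists>i<N. W (Suc n + i) (r i) (r (Suc i)))})"
  have "prob_io_within k W (Suc N) n q =
      (\<integral>q'. measure (chain_from k (Suc n) q') (F q') \<partial>measure_pmf (k n q))"
    unfolding prob_io_within_def
  proof (rule measure_chain_from_step_cong)
    show "F q' \<in> sets path_space" for q'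
      using sets_io[of W "Suc n"] sets_io_within[of W "Suc n" N] by (simp add: F_def)
    fix r :: "nat \<Rightarrow> nat"
    have "(\<exists>\<^sub>\<infinity>i. W (n + i) (case_nat q r i) (case_nat q r (Suc i))) \<longleftrightarrow>
        (\<exists>\<^sub>\<infinity>i. W (Suc n + i) (r i) (r (Suc i)))"
      using INFM_Suc_iff[of "\<lambda>i. W (n + i) (case_nat q r i) (case_nat q r (Suc i))"] by simp
    then show "case_nat q r \<in> {r. (\<exists>\<^sub>\<infinity>i. W (n + i) (r i) (r (Suc i))) \<and>
        (\<exists>i<Suc N. W (n + i) (r i) (r (Suc i)))} \<longleftrightarrow> r \<in> F (r 0)"
      by (simp add: F_def Ex_less_Suc2)
  qed (rule sets_io_within)
  also have "\<dots> = (\<integral>q'. (if W n q q' then prob_io k W (Suc n) q'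
      else prob_io_within k W N (Suc n) q') \<partial>measure_pmf (k n q))"
    by (rule integral_pmf_cong) (simp add: F_def prob_io_def prob_io_within_def)
  finally show ?thesis .
qed

lemma prob_quiet_tendsto: "(\<lambda>N. prob_quiet k W N n q) \<longlonglongrightarrow> prob_never k W n q"
proof -
  let ?A = "\<lambda>N. {r. \<forall>i<N. \<not> W (n + i) (r i) (r (Suc i))}"
  have "(\<lambda>N. measure (chain_from k n q) (?A N)) \<longlonglongrightarrow> measure (chain_from k n q) (\<Inter>N. ?A N)"
    by (rule chain.finite_Lim_measure_decseq) (use sets_quiet in \<open>auto simp: decseq_def\<close>)
  moreover have "(\<Inter>N. ?A N) = {r. \<forall>i. \<not> W (n + i) (r i) (r (Suc i))}"
    by auto
  ultimately show ?thesis
    by (simp add: prob_quiet_def prob_never_def)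
qed

lemma prob_io_within_tendsto: "(\<lambda>N. prob_io_within k W N n q) \<longlonglongrightarrow> prob_io k W n q"
proof -
  let ?A = "\<lambda>N. {r. (\<exists>\<^sub>\<infinity>i. W (n + i) (r i) (r (Suc i))) \<and> (\<exists>i<N. W (n + i) (r i) (r (Suc i)))}"
  have "(\<lambda>N. measure (chain_from k n q) (?A N)) \<longlonglongrightarrow> measure (chain_from k n q) (\<Union>N. ?A N)"
    by (rule chain.finite_Lim_measure_incseq)
       (use sets_io_within in \<open>auto simp: incseq_def intro: less_le_trans\<close>)
  moreover have "(\<Union>N. ?A N) = {r. \<exists>\<^sub>\<infinity>i. W (n + i) (r i) (r (Suc i))}"
  proof (intro equalityI subsetI)
    fix r assume r: "r \<in> {r. \<exists>\<^sub>\<infinity>i. W (n + i) (r i) (r (Suc i))}"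
    then obtain i where "W (n + i) (r i) (r (Suc i))"
      by (auto dest: INFM_EX)
    with r have "r \<in> ?A (Suc i)" by blast
    then show "r \<in> (\<Union>N. ?A N)" by blast
  qed auto
  ultimately show ?thesis
    by (simp add: prob_io_within_def prob_io_def)
qed

text \<open>\<open>prob_never\<close> is the mean over the successors of terms that vanish on
  \<open>W\<close> transitions, and some value is at least the mean.\<close>

lemma prob_never_ge_step:
  assumes "c \<le> prob_never k W n q" "0 < c"
  shows "\<exists>q'\<in>set_pmf (k n q). c \<le> prob_never k W (Suc n) q'"
proof -
  have "\<exists>q'\<in>set_pmf (k n q). c \<le> (if W n q q' then 0 else prob_never k W (Suc n) q')"
    by (rule integral_pmf_ge_imp_ex) (use assms(1) prob_never_step[of k W n q] in auto)
  then show ?thesis using assms(2) by (auto split: if_splits)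
qed

lemma measure_io_eq_integral:
  "measure (chain p k) {r. \<exists>\<^sub>\<infinity>i. W i (r i) (r (Suc i))} =
    (\<integral>q. prob_io k W n q \<partial>measure_pmf (marginal p k n))"
proof -
  have "{r. \<exists>\<^sub>\<infinity>i. W i (r i) (r (Suc i))} = {r. (\<lambda>i. r (n + i)) \<in> {r. \<exists>\<^sub>\<infinity>i. W (n + i) (r i) (r (Suc i))}}"
    using INFM_shift_iff[of "\<lambda>i. W i (_ i) (_ (Suc i))" n] by auto
  then show ?thesis
    by (simp only: measure_chain_at_time[OF sets_io] prob_io_def)
qed

text \<open>Recurrence fails iff \<open>W\<close> is silent from some time \<open>n\<close> on. This
  is a countable union, so it is null iff each member is, and a mean of nonnegative terms vanishes
  iff all terms on the support do.\<close>

lemma measure_io_eq_1_iff: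
  "measure (chain p k) {r. \<exists>\<^sub>\<infinity>i. W i (r i) (r (Suc i))} = 1 \<longleftrightarrow>
    (\<forall>n. \<forall>q\<in>set_pmf (marginal p k n). prob_never k W n q = 0)"
proof -
  let ?N = "\<lambda>n. {r. \<forall>i. \<not> W (n + i) (r i) (r (Suc i))}"
  have N: "{r. (\<lambda>i. r (n + i)) \<in> ?N n} \<in> sets path_space" for n
    using measurable_sets[OF measurable_path_shift sets_never] by (simp add: vimage_def space_path_space)
  have io: "(\<exists>\<^sub>\<infinity>i. W i (r i) (r (Suc i))) \<longleftrightarrow> (\<forall>n. r \<notin> {r. (\<lambda>i. r (n + i)) \<in> ?N n})" for r
    unfolding INFM_nat_le by (auto simp: le_iff_add)
  have "measure (chain p k) {r. \<exists>\<^sub>\<infinity>i. W i (r i) (r (Suc i))} = 1 \<longleftrightarrow>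
      (AE r in chain p k. r \<in> {r. \<exists>\<^sub>\<infinity>i. W i (r i) (r (Suc i))})"
    using sets_io[of W 0] by (subst chain.prob_eq_1) auto
  also have "\<dots> \<longleftrightarrow> (\<forall>n. AE r in chain p k. r \<notin> {r. (\<lambda>i. r (n + i)) \<in> ?N n})"
    unfolding AE_all_countable[symmetric]
    by (rule arg_cong[where f="\<lambda>P. eventually P (ae_filter (chain p k))"], rule ext) (subst io[symmetric], simp)
  also have "\<dots> \<longleftrightarrow> (\<forall>n. measure (chain p k) {r. (\<lambda>i. r (n + i)) \<in> ?N n} = 0)"
    using N by (subst chain.prob_eq_0) auto
  also have "\<dots> \<longleftrightarrow> (\<forall>n. (\<integral>q. prob_never k W n q \<partial>measure_pmf (marginal p k n)) = 0)"
    by (simp only: measure_chain_at_time[OF sets_never] prob_never_def)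
  also have "\<dots> \<longleftrightarrow> (\<forall>n. \<forall>q\<in>set_pmf (marginal p k n). prob_never k W n q = 0)"
    by (subst integral_pmf_eq_0_iff) simp_all
  finally show ?thesis .
qed

text \<open>The code \<^term>\<open>e n q b\<close> stands for the state \<^term>\<open>q\<close> together with the belief support at time
  \<^term>\<open>n\<close>; the flag \<^term>\<open>b\<close> records that the last transition of the original chain was in \<^term>\<open>W\<close>,
  in which case the state has been resampled.\<close>

locale belief_resampling =
  fixes p :: "nat pmf" and k :: "nat \<Rightarrow> nat \<Rightarrow> nat pmf" and W :: "nat \<Rightarrow> nat \<Rightarrow> nat \<Rightarrow> bool"
    and D :: nat and k' :: "nat \<Rightarrow> nat \<Rightarrow> nat pmf" and W' :: "nat \<Rightarrow> nat \<Rightarrow> nat \<Rightarrow> bool"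
    and e :: "nat \<Rightarrow> nat \<Rightarrow> bool \<Rightarrow> nat"
  assumes finite_support: "finite (set_pmf (marginal p k n))"
    and card_support: "card (set_pmf (marginal p k n)) \<le> D"
    and W'_iff: "W' n x (e (Suc n) q b) \<longleftrightarrow> b"
    and k'_eq: "q \<in> set_pmf (marginal p k n) \<Longrightarrow> k' n (e n q b) =
      bind_pmf (k n q) (\<lambda>q'. if W n q q'
        then map_pmf (\<lambda>q''. e (Suc n) q'' True) (pmf_of_set (set_pmf (marginal p k (Suc n))))
        else return_pmf (e (Suc n) q' False))"
begin

abbreviation "R n \<equiv> set_pmf (marginal p k n)"

abbreviation "p' \<equiv> map_pmf (\<lambda>q. e 0 q False) p"

lemma R_Suc: "q \<in> R n \<Longrightarrow> q' \<in> set_pmf (k n q) \<Longrightarrow> q' \<in> R (Suc n)"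
  by auto

lemma integral_k':
  fixes f :: "nat \<Rightarrow> real"
  assumes "q \<in> R n" "\<And>x. 0 \<le> f x" "\<And>x. f x \<le> 1"
  shows "(\<integral>x. f x \<partial>measure_pmf (k' n (e n q b))) =
    (\<integral>q'. (if W n q q' then (\<Sum>q''\<in>R (Suc n). f (e (Suc n) q'' True)) / card (R (Suc n))
      else f (e (Suc n) q' False)) \<partial>measure_pmf (k n q))"
  unfolding k'_eq[OF assms(1)] integral_bind_pmf_bounded[of f, OF assms(2,3)]
  by (rule integral_pmf_cong)
     (auto simp: integral_pmf_of_set[OF set_pmf_not_empty finite_support] simp del: marginal.simps)

lemma support_marginal': "set_pmf (marginal p' k' n) \<subseteq> {e n q b |q b. q \<in> R n}"
proof (induction n)
  case (Suc n)
  show ?case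
  proof
    fix y assume "y \<in> set_pmf (marginal p' k' (Suc n))"
    then obtain q b where q: "q \<in> R n" and "y \<in> set_pmf (k' n (e n q b))"
      using Suc by auto
    then obtain q' where "q' \<in> set_pmf (k n q)"
      "y \<in> set_pmf (if W n q q' then map_pmf (\<lambda>q''. e (Suc n) q'' True) (pmf_of_set (R (Suc n)))
        else return_pmf (e (Suc n) q' False))"
      unfolding k'_eq[OF q] by auto
    then show "y \<in> {e (Suc n) q b |q b. q \<in> R (Suc n)}"
      using R_Suc[OF q] set_pmf_of_set[OF set_pmf_not_empty finite_support, of "Suc n"]
      by (auto split: if_splits simp del: marginal.simps)
  qed
qed auto

text \<open>The two chains behave alike until the first \<open>W\<close> transition: only such a
  transition triggers resampling, and the current flag has no influence on the future.\<close>

lemma prob_quiet': "q \<in> R n \<Longrightarrow> prob_quiet k' W' N n (e n q b) = prob_quiet k W N n q"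
proof (induction N arbitrary: n q b)
  case (Suc N)
  show ?case
    unfolding prob_quiet_Suc
    by (subst integral_k'[OF Suc.prems])
       (auto simp: W'_iff Suc.IH R_Suc[OF Suc.prems] simp del: marginal.simps intro!: integral_pmf_cong)
qed simp

lemma prob_never': "q \<in> R n \<Longrightarrow> prob_never k' W' n (e n q b) = prob_never k W n q"
  using prob_quiet_tendsto[of k' W' n "e n q b"] prob_quiet_tendsto[of k W n q] LIMSEQ_unique
  by (simp add: prob_quiet')

text \<open>Resampling never leaves the belief support, so each state that the new chain can visit
  inherits a vanishing \<open>prob_never\<close>.\<close>

lemma io_almost_surely:
  assumes "measure (chain p k) {r. \<exists>\<^sub>\<infinity>i. W i (r i) (r (Suc i))} = 1"
  shows "measure (chain p' k') {r. \<exists>\<^sub>\<infinity>i. W' i (r i) (r (Suc i))} = 1"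
  unfolding measure_io_eq_1_iff
proof (intro allI ballI)
  fix n x assume "x \<in> set_pmf (marginal p' k' n)"
  then obtain q b where "x = e n q b" "q \<in> R n"
    using support_marginal' by blast
  then show "prob_never k' W' n x = 0"
    using assms prob_never' by (auto simp: measure_io_eq_1_iff)
qed

text \<open>A state from which \<^term>\<open>W\<close> never recurs with probability at least \<open>c\<close> has a successor with the
  same property, so from some time on every resampling step has a chance of at least \<open>c / D\<close> to be the last one.\<close>

lemma io_null:
  assumes "measure (chain p k) {r. \<exists>\<^sub>\<infinity>i. W i (r i) (r (Suc i))} \<noteq> 1"
  shows "measure (chain p' k') {r. \<exists>\<^sub>\<infinity>i. W' i (r i) (r (Suc i))} = 0"
proof -
  obtain n0 q0 where q0: "q0 \<in> R n0" "prob_never k W n0 q0 \<noteq> 0"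
    using assms by (auto simp: measure_io_eq_1_iff)
  define c where "c = prob_never k W n0 q0"
  have c: "0 < c" "c \<le> 1"
    using q0(2) prob_bounds(3)[of k W n0 q0] by (auto simp: c_def less_le)
  have "\<exists>q\<in>R (n0 + j). c \<le> prob_never k W (n0 + j) q" for j
  proof (induction j)
    case (Suc j)
    then obtain q where q: "q \<in> R (n0 + j)" "c \<le> prob_never k W (n0 + j) q" by blast
    obtain q' where "q' \<in> set_pmf (k (n0 + j) q)" "c \<le> prob_never k W (Suc (n0 + j)) q'"
      using prob_never_ge_step[OF q(2) c(1)] by blast
    then show ?case using R_Suc[OF q(1)] by (metis add_Suc_right)
  qed (use q0 c_def in auto)
  then have bad: "\<exists>q\<in>R m. c \<le> prob_never k W m q" if "n0 \<le> m" for m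
    using that le_iff_add by metis
  \<comment> \<open>The recurrence probability just after a resampling step that ends at time
    \<open>m\<close>.\<close>
  define avg where "avg = (\<lambda>m. (\<Sum>q\<in>R m. prob_io k' W' m (e m q True)) / card (R m))"
  have cardR: "0 < card (R m)" for m
    using finite_support by (simp add: card_gt_0_iff set_pmf_not_empty)
  have avg01: "0 \<le> avg m" "avg m \<le> 1" for m
    using cardR[of m] sum_bounded_above[of "R m" "\<lambda>q. prob_io k' W' m (e m q True)" 1]
    by (auto simp: avg_def sum_nonneg divide_le_eq)
  \<comment> \<open>The supremum starts at \<open>n0\<close> because a state with
    \<open>prob_never\<close> at least \<open>c\<close> is guaranteed only from that time
    on.\<close>
  define C where "C = (SUP m\<in>{n0..}. avg m)"
  have bdd: "bdd_above (avg ` {n0..})"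
    using avg01(2) by (auto intro!: bdd_aboveI[where M=1])
  have avgC: "avg m \<le> C" if "n0 \<le> m" for m
    unfolding C_def by (rule cSUP_upper[OF _ bdd]) (use that in simp)
  have C0: "0 \<le> C" using avg01(1) avgC order_refl order_trans by blast
  have C1: "C \<le> 1" unfolding C_def by (rule cSUP_least) (use avg01 in auto)
  \<comment> \<open>Recurrence needs a first \<open>W\<close> transition, which has probability at
    most one minus that of silence. It triggers a resampling, after which at most \<open>C\<close>
    is left.\<close>
  have within: "prob_io_within k' W' N m (e m q b) \<le> C * (1 - prob_quiet k W N m q)"
    if "n0 \<le> m" "q \<in> R m" for N m q b
    using that
  proof (induction N arbitrary: m q b)
    case (Suc N)
    let ?g = "\<lambda>q'. if W m q q' then 0 else prob_quiet k W N (Suc m) q'"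
    have "prob_io_within k' W' (Suc N) m (e m q b) =
        (\<integral>q'. (if W m q q' then avg (Suc m) else prob_io_within k' W' N (Suc m) (e (Suc m) q' False)) \<partial>measure_pmf (k m q))"
      unfolding prob_io_within_Suc
      by (subst integral_k'[OF Suc.prems(2)]) (auto simp: W'_iff avg_def simp del: marginal.simps intro!: integral_pmf_cong)
    also have "\<dots> \<le> (\<integral>q'. C - C * ?g q' \<partial>measure_pmf (k m q))"
    proof (rule integral_pmf_mono[where B=1 and B'=1])
      fix q' assume "q' \<in> set_pmf (k m q)"
      then have "q' \<in> R (Suc m)" using R_Suc Suc.prems(2) by blast
      then show "(if W m q q' then avg (Suc m) else prob_io_within k' W' N (Suc m) (e (Suc m) q' False)) \<le> C - C * ?g q'"
        using Suc.IH[of "Suc m" q' False] avgC[of "Suc m"] Suc.prems(1) by (auto simp: algebra_simps)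
    next
      fix q'
      have "0 \<le> C * ?g q'" "C * ?g q' \<le> C * 1"
        using C0 by (auto intro: mult_left_mono simp del: mult_1_right)
      then show "\<bar>C - C * ?g q'\<bar> \<le> 1" using C0 C1 by linarith
    qed (use avg01 in auto)
    also have "\<dots> = C - C * prob_quiet k W (Suc N) m q"
      unfolding prob_quiet_Suc
      by (subst Bochner_Integration.integral_diff)
         (auto intro!: integrable_pmf_bounded[where B=1] integrable_mult_right)
    finally show ?case by (simp add: algebra_simps)
  qed simp
  have io_le: "prob_io k' W' m (e m q b) \<le> C * (1 - prob_never k W m q)"
    if "n0 \<le> m" "q \<in> R m" for m q b
    by (rule LIMSEQ_le[OF prob_io_within_tendsto tendsto_mult[OF tendsto_const
          tendsto_diff[OF tendsto_const prob_quiet_tendsto]]])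
       (use within[OF that] in blast)
  have D: "0 < D" using cardR card_support less_le_trans by blast
  \<comment> \<open>In the mean over the belief support each state contributes at most
    \<open>C\<close>, and the bad state at most \<open>C * (1 - c)\<close>; there are at most
    \<open>D\<close> states.\<close>
  have "C \<le> C * (1 - c / D)"
    unfolding C_def
  proof (rule cSUP_least)
    fix m assume "m \<in> {n0..}"
    then have m: "n0 \<le> m" by simp
    obtain q where q: "q \<in> R m" "c \<le> prob_never k W m q" using bad[OF m] by blast
    have "(\<Sum>q\<in>R m. prob_io k' W' m (e m q True)) \<le> (\<Sum>q\<in>R m. C * (1 - prob_never k W m q))"
      by (rule sum_mono) (use io_le[OF m] in blast)
    also have "\<dots> = C * (card (R m) - (\<Sum>q\<in>R m. prob_never k W m q))"
      by (simp add: sum_distrib_left[symmetric] sum_subtractf)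
    also have "\<dots> \<le> C * (card (R m) - c)"
      using member_le_sum[OF q(1), of "prob_never k W m"] q(2) C0 finite_support
      by (intro mult_left_mono) auto
    finally have "avg m \<le> C * (card (R m) - c) / card (R m)"
      unfolding avg_def by (rule divide_right_mono) simp
    also have "\<dots> = C * (1 - c / card (R m))"
      using cardR[of m] by (simp add: field_simps)
    also have "\<dots> \<le> C * (1 - c / D)"
      using C0 c cardR[of m] card_support[of m] D by (intro mult_left_mono diff_left_mono divide_left_mono) auto
    finally show "avg m \<le> (SUP m\<in>{n0..}. avg m) * (1 - c / D)"
      by (simp add: C_def)
  qed simp
  then have "C * (c / D) \<le> 0" by (simp add: algebra_simps)
  then have "C = 0" using C0 c D by (simp add: mult_le_0_iff divide_le_0_iff)
  have "(\<integral>x. prob_io k' W' n0 x \<partial>measure_pmf (marginal p' k' n0)) = (\<integral>x. 0 \<partial>measure_pmf (marginal p' k' n0))"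
  proof (rule integral_pmf_cong)
    fix x assume "x \<in> set_pmf (marginal p' k' n0)"
    then obtain q b where x: "x = e n0 q b" "q \<in> R n0"
      using support_marginal' by blast
    show "prob_io k' W' n0 x = 0"
      using io_le[OF order_refl x(2), of b] \<open>C = 0\<close> prob_bounds(5)[of k' W' n0 x] unfolding x(1) by simp
  qed
  then show ?thesis
    by (simp add: measure_io_eq_integral[of _ _ _ n0])
qed

end

section \<open>Almost-sure to positive semantics\<close>

definition post :: "pwa \<Rightarrow> nat set \<Rightarrow> nat \<Rightarrow> nat set" where
  "post A R \<sigma> = (\<Union>q\<in>R. set_pmf (trans A q \<sigma>))"

text \<open>States of a \<open>pwa\<close> are natural numbers, so tuples go through
  \<open>to_nat\<close>. \<open>set_encode\<close> is faithful on finite sets only, hence the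
  finiteness premises below.\<close>

definition rs_code :: "rat \<Rightarrow> nat \<Rightarrow> nat set \<Rightarrow> bool \<Rightarrow> nat" where
  "rs_code v q R b = to_nat (v, q, set_encode R, b)"

definition rs_flag :: "nat \<Rightarrow> bool" where
  "rs_flag x = (case from_nat x :: rat \<times> nat \<times> nat \<times> bool of (v, q, c, b) \<Rightarrow> b)"

text \<open>The guess \<open>v\<close> is drawn once, at the start. The flag sits in the target
  state, so the weight is read off there; the default \<open>Min V\<close> keeps all weights in
  \<open>V\<close>.\<close>

definition resampler :: "pwa \<Rightarrow> rat set \<Rightarrow> pwa" where
  "resampler A V = \<lparr>
    states = {rs_code v q R b | v q R b. v \<in> V \<and> q \<in> R \<and> R \<subseteq> states A},
    init = bind_pmf (pmf_of_set V) (\<lambda>v. map_pmf (\<lambda>q. rs_code v q (set_pmf (init A)) False) (init A)),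
    trans = (\<lambda>x \<sigma>. case from_nat x :: rat \<times> nat \<times> nat \<times> bool of (v, q, c, b) \<Rightarrow>
      let R = post A (set_decode c) \<sigma> in
      bind_pmf (trans A q \<sigma>) (\<lambda>q'. if v \<le> weight A q \<sigma> q'
        then map_pmf (\<lambda>q''. rs_code v q'' R True) (pmf_of_set R)
        else return_pmf (rs_code v q' R False))),
    weight = (\<lambda>x \<sigma> y. case from_nat y :: rat \<times> nat \<times> nat \<times> bool of (v, q, c, b) \<Rightarrow>
      if b then v else Min V)\<rparr>"

lemma trans_resampler:
  "finite R \<Longrightarrow> trans (resampler A V) (rs_code v q R b) \<sigma> =
    bind_pmf (trans A q \<sigma>) (\<lambda>q'. if v \<le> weight A q \<sigma> q'
      then map_pmf (\<lambda>q''. rs_code v q'' (post A R \<sigma>) True) (pmf_of_set (post A R \<sigma>))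
      else return_pmf (rs_code v q' (post A R \<sigma>) False))"
  unfolding rs_code_def[of v q R b]
  by (simp add: resampler_def set_encode_inverse) (simp add: Let_def)

lemma weight_resampler:
  "weight (resampler A V) x \<sigma> (rs_code v q R b) = (if b then v else Min V)"
  by (simp add: resampler_def rs_code_def)

lemma rs_flag_code [simp]: "rs_flag (rs_code v q R b) = b"
  by (simp add: rs_flag_def rs_code_def)

lemma init_resampler:
  "init (resampler A V) =
    bind_pmf (pmf_of_set V) (\<lambda>v. map_pmf (\<lambda>q. rs_code v q (set_pmf (init A)) False) (init A))"
  by (simp add: resampler_def)

lemma states_resampler:
  "states (resampler A V) = {rs_code v q R b | v q R b. v \<in> V \<and> q \<in> R \<and> R \<subseteq> states A}"
  by (simp add: resampler_def)

lemma rs_code_in_states: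
  "v \<in> V \<Longrightarrow> q \<in> R \<Longrightarrow> R \<subseteq> states A \<Longrightarrow> rs_code v q R b \<in> states (resampler A V)"
  by (auto simp: states_resampler)

lemma post_subset:
  assumes "wf_pwa \<Sigma> A" "\<sigma> \<in> \<Sigma>" "R \<subseteq> states A"
  shows "post A R \<sigma> \<subseteq> states A"
  using assms by (fastforce simp: post_def wf_pwa_def)

lemma postI: "q \<in> R \<Longrightarrow> q' \<in> set_pmf (trans A q \<sigma>) \<Longrightarrow> q' \<in> post A R \<sigma>"
  by (auto simp: post_def)

lemma wf_resampler:
  assumes wf: "wf_pwa \<Sigma> A" and V: "finite V" "V \<noteq> {}"
  shows "wf_pwa \<Sigma> (resampler A V)"
  unfolding wf_pwa_def
proof (intro conjI ballI)
  have fin: "finite (states A)" using wf by (simp add: wf_pwa_def)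
  have "states (resampler A V) \<subseteq>
      (\<lambda>(v, q, R, b). rs_code v q R b) ` (V \<times> states A \<times> Pow (states A) \<times> UNIV)"
    unfolding states_resampler by (force simp: image_iff)
  then show "finite (states (resampler A V))"
    using fin V(1) by (meson finite_SigmaI finite_Pow_iff finite_surj finite)
  show "set_pmf (init (resampler A V)) \<subseteq> states (resampler A V)"
  proof
    fix x assume "x \<in> set_pmf (init (resampler A V))"
    then obtain v q where "v \<in> V" "q \<in> set_pmf (init A)" "x = rs_code v q (set_pmf (init A)) False"
      using V by (auto simp: init_resampler)
    moreover have "set_pmf (init A) \<subseteq> states A" using wf by (simp add: wf_pwa_def)
    ultimately show "x \<in> states (resampler A V)"
      unfolding states_resampler by blast
  qed
  fix x \<sigma> assume "x \<in> states (resampler A V)" and \<sigma>: "\<sigma> \<in> \<Sigma>"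
  then obtain v q R b where x: "x = rs_code v q R b" "v \<in> V" "q \<in> R" "R \<subseteq> states A"
    by (auto simp: states_resampler)
  have sub: "post A R \<sigma> \<subseteq> states A" by (rule post_subset[OF wf \<sigma> x(4)])
  have "finite R" and fin_post: "finite (post A R \<sigma>)"
    using x(4) sub fin finite_subset by auto
  obtain q1 where "q1 \<in> set_pmf (trans A q \<sigma>)"
    using set_pmf_not_empty by fast
  then have "post A R \<sigma> \<noteq> {}" using postI[OF x(3)] by blast
  then have "set_pmf (pmf_of_set (post A R \<sigma>)) = post A R \<sigma>"
    using fin_post by (rule set_pmf_of_set)
  then show "set_pmf (trans (resampler A V) x \<sigma>) \<subseteq> states (resampler A V)"
    unfolding x(1) trans_resampler[OF \<open>finite R\<close>] using x(2) sub postI[OF x(3)]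
    by (auto intro!: rs_code_in_states split: if_splits)
qed

lemma trans_resampler_is_code:
  "finite R \<Longrightarrow> y \<in> set_pmf (trans (resampler A V) (rs_code v q R b) \<sigma>) \<Longrightarrow>
    \<exists>q' b'. y = rs_code v q' (post A R \<sigma>) b'"
  by (auto simp: trans_resampler split: if_splits)

lemma measure_chain_mixture:
  assumes E: "E \<in> sets path_space" and V: "finite V" "V \<noteq> {}"
  shows "measure (chain (bind_pmf (pmf_of_set V) h) k) E = (\<Sum>v\<in>V. measure (chain (h v) k) E) / card V"
proof -
  have "measure (chain (bind_pmf (pmf_of_set V) h) k) E =
      (\<integral>v. (\<integral>q. measure (chain (return_pmf q) k) E \<partial>measure_pmf (h v)) \<partial>measure_pmf (pmf_of_set V))"
    by (subst measure_chain_initial[OF E], rule integral_bind_pmf_bounded) auto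
  also have "\<dots> = (\<integral>v. measure (chain (h v) k) E \<partial>measure_pmf (pmf_of_set V))"
    by (simp add: measure_chain_initial[OF E, symmetric])
  finally show ?thesis
    using V by (simp add: integral_pmf_of_set)
qed

text \<open>This is how a random guess acts as an existential quantifier under the positive
  semantics.\<close>

lemma measure_chain_mixture_pos_iff:
  assumes E: "E \<in> sets path_space" and V: "finite V" "V \<noteq> {}"
  shows "measure (chain (bind_pmf (pmf_of_set V) h) k) E > 0 \<longleftrightarrow> (\<exists>v\<in>V. measure (chain (h v) k) E > 0)"
proof -
  have "(\<Sum>v\<in>V. measure (chain (h v) k) E) > 0 \<longleftrightarrow> (\<exists>v\<in>V. measure (chain (h v) k) E > 0)"
    using sum_nonneg_eq_0_iff[OF V(1), of "\<lambda>v. measure (chain (h v) k) E"]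
      sum_nonneg[of V "\<lambda>v. measure (chain (h v) k) E"] by (auto simp: less_le)
  then show ?thesis
    unfolding measure_chain_mixture[OF assms] using V by (simp add: zero_less_divide_iff card_gt_0_iff)
qed

lemma weights_nonempty:
  assumes "wf_pwa \<Sigma> A" "\<Sigma> \<noteq> {}"
  shows "weights \<Sigma> A \<noteq> {}"
proof -
  obtain q where "q \<in> set_pmf (init A)" using set_pmf_not_empty by fast
  then have "q \<in> states A" using assms(1) by (auto simp: wf_pwa_def)
  with assms(2) weightsI show ?thesis by fast
qed

lemma io_ge_if_below_weights:
  assumes wf: "wf_pwa \<Sigma> A" and w: "range w \<subseteq> \<Sigma>" and run: "is_run A w r"
    and below: "\<And>x. x \<in> weights \<Sigma> A \<Longrightarrow> \<eta> \<le> real_of_rat x"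
  shows "io_ge A w \<eta> r"
  using below[OF weight_seq_in_weights[OF wf w run]] by (simp add: io_ge_def INFM_iff_infinite)

lemma measure_io_ge_eq_1_if_below_weights:
  assumes "wf_pwa \<Sigma> A" "range w \<subseteq> \<Sigma>" "\<And>x. x \<in> weights \<Sigma> A \<Longrightarrow> \<eta> \<le> real_of_rat x"
  shows "measure (chain (init A) (word_kernel A w)) {r. io_ge A w \<eta> r} = 1"
  by (subst chain.prob_eq_1)
     (use AE_is_run[of A w] io_ge_if_below_weights[OF assms(1,2) _ assms(3)] sets_io_ge
      in \<open>auto elim: eventually_mono\<close>)

text \<open>For a fixed guess, the resampled chain obeys a zero-one law. The bound
  \<open>Min V < \<eta>\<close> ensures that unflagged transitions do not count.\<close>

lemma measure_resampler_pos_iff: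
  assumes wf: "wf_pwa \<Sigma> A" and \<Sigma>: "finite \<Sigma>" and w: "range w \<subseteq> \<Sigma>"
    and V: "finite V" "V \<noteq> {}" and v: "v \<in> V" and \<eta>: "real_of_rat (Min V) < \<eta>"
  shows "measure (chain (map_pmf (\<lambda>q. rs_code v q (set_pmf (init A)) False) (init A))
      (word_kernel (resampler A V) w)) {r. io_ge (resampler A V) w \<eta> r} > 0 \<longleftrightarrow>
    \<eta> \<le> real_of_rat v \<and> measure (chain (init A) (word_kernel A w)) {r. io_ge A w (real_of_rat v) r} = 1"
proof -
  define k where "k = word_kernel A w"
  define B where "B = resampler A V"
  define k' where "k' = word_kernel B w"
  define R where "R = (\<lambda>n. set_pmf (marginal (init A) k n))"
  have fin: "finite (states A)" using wf by (simp add: wf_pwa_def)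
  have R_step: "R (Suc n) = post A (R n) (w n)" for n
    by (simp add: R_def k_def post_def)
  then have R_marginal: "set_pmf (marginal (init A) k (Suc n)) = post A (R n) (w n)" for n
    unfolding R_def .
  have R_sub: "R n \<subseteq> states A" for n
  proof (induction n)
    case 0
    then show ?case using wf by (simp add: R_def wf_pwa_def)
  next
    case (Suc n)
    then show ?case unfolding R_step using w by (intro post_subset[OF wf]) auto
  qed
  then have R_fin: "finite (R n)" for n using fin finite_subset by blast
  interpret belief_resampling "init A" k "\<lambda>i q q'. v \<le> weight A q (w i) q'" "card (states A)"
    k' "\<lambda>i x y. rs_flag y" "\<lambda>n q b. rs_code v q (R n) b"
  proof unfold_locales
    show "finite (set_pmf (marginal (init A) k n))" for n
      using R_fin by (simp add: R_def)
    show "card (set_pmf (marginal (init A) k n)) \<le> card (states A)" for n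
      using R_sub fin by (simp add: R_def card_mono)
    show "rs_flag (rs_code v q (R (Suc n)) b) \<longleftrightarrow> b" for n q b
      by simp
    show "k' n (rs_code v q (R n) b) =
      bind_pmf (k n q) (\<lambda>q'. if v \<le> weight A q (w n) q'
        then map_pmf (\<lambda>q''. rs_code v q'' (R (Suc n)) True) (pmf_of_set (set_pmf (marginal (init A) k (Suc n))))
        else return_pmf (rs_code v q' (R (Suc n)) False))" for n q b
      unfolding R_step R_marginal k'_def B_def trans_resampler[OF R_fin] by (simp only: k_def)
  qed
  have pB: "map_pmf (\<lambda>q. rs_code v q (set_pmf (init A)) False) (init A) = p'"
    by (simp add: R_def)
  have "AE r in chain p' k'. \<forall>i. \<exists>q b. r i = rs_code v q (R i) b"
    using AE_chain_run
  proof eventually_elim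
    fix r assume r: "r 0 \<in> set_pmf p' \<and> (\<forall>i. r (Suc i) \<in> set_pmf (k' i (r i)))"
    have "\<exists>q b. r i = rs_code v q (R i) b" for i
    proof (induction i)
      case (Suc i)
      then obtain q b where "r i = rs_code v q (R i) b" by blast
      moreover have "r (Suc i) \<in> set_pmf (trans B (r i) (w i))" using r by (simp add: k'_def)
      ultimately show ?case
        unfolding R_step B_def by (simp only:) (rule trans_resampler_is_code[OF R_fin])
    qed (use r in auto)
    then show "\<forall>i. \<exists>q b. r i = rs_code v q (R i) b" by blast
  qed
  then have AE: "AE r in chain p' k'. io_ge B w \<eta> r \<longleftrightarrow> \<eta> \<le> real_of_rat v \<and> (\<exists>\<^sub>\<infinity>i. rs_flag (r (Suc i)))"
  proof eventually_elim
    fix r assume r: "\<forall>i. \<exists>q b. r i = rs_code v q (R i) b"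
    have "\<eta> \<le> real_of_rat (weight_seq B w r i) \<longleftrightarrow> \<eta> \<le> real_of_rat v \<and> rs_flag (r (Suc i))" for i
    proof -
      obtain q b where "r (Suc i) = rs_code v q (R (Suc i)) b" using r by blast
      then show ?thesis using \<eta> by (simp add: weight_seq_def B_def weight_resampler)
    qed
    then show "io_ge B w \<eta> r \<longleftrightarrow> \<eta> \<le> real_of_rat v \<and> (\<exists>\<^sub>\<infinity>i. rs_flag (r (Suc i)))"
      by (cases "\<eta> \<le> real_of_rat v") (simp_all add: io_ge_def)
  qed
  have flag: "{r. \<exists>\<^sub>\<infinity>i. rs_flag (r (Suc i))} \<in> sets path_space"
    by (rule sets_path_Collect[OF pred_io_transition])
  have "measure (chain p' k') {r. io_ge B w \<eta> r} =
      (if \<eta> \<le> real_of_rat v then measure (chain p' k') {r. \<exists>\<^sub>\<infinity>i. rs_flag (r (Suc i))} else 0)"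
  proof (cases "\<eta> \<le> real_of_rat v")
    case True
    have "measure (chain p' k') {r. io_ge B w \<eta> r} = measure (chain p' k') {r. \<exists>\<^sub>\<infinity>i. rs_flag (r (Suc i))}"
      by (rule chain.finite_measure_eq_AE) (use AE True flag sets_io_ge in \<open>auto elim: eventually_mono\<close>)
    with True show ?thesis by simp
  next
    case False
    then have "measure (chain p' k') {r. io_ge B w \<eta> r} = measure (chain p' k') {}"
      by (intro chain.finite_measure_eq_AE) (use AE sets_io_ge in \<open>auto elim: eventually_mono\<close>)
    with False show ?thesis by simp
  qed
  moreover have "measure (chain p' k') {r. \<exists>\<^sub>\<infinity>i. rs_flag (r (Suc i))} > 0 \<longleftrightarrow>
      measure (chain (init A) k) {r. \<exists>\<^sub>\<infinity>i. v \<le> weight A (r i) (w i) (r (Suc i))} = 1"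
    using io_almost_surely io_null by fastforce
  moreover have "{r. io_ge A w (real_of_rat v) r} = {r. \<exists>\<^sub>\<infinity>i. v \<le> weight A (r i) (w i) (r (Suc i))}"
    by (simp add: io_ge_def weight_seq_def of_rat_less_eq)
  ultimately show ?thesis
    by (simp add: pB[folded k_def] k_def k'_def B_def)
qed

lemma reducible_as_pos: "reducible L_as L_pos"
  unfolding reducible_def
proof (intro allI impI)
  fix \<Sigma> :: "nat set" and A
  assume \<Sigma>: "finite \<Sigma>" and wf: "wf_pwa \<Sigma> A"
  define V where "V = weights \<Sigma> A"
  define B where "B = resampler A V"
  show "\<exists>B. wf_pwa \<Sigma> B \<and> (\<forall>w. range w \<subseteq> \<Sigma> \<longrightarrow> L_as A w = L_pos B w)"
  \<comment> \<open>Without letters there are no words, and \<open>weights\<close> is empty, so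
    nothing could be drawn from it.\<close>
  proof (cases "\<Sigma> = {}")
    case True
    with wf show ?thesis by auto
  next
    case False
    have V: "finite V" "V \<noteq> {}"
      using finite_weights[OF wf \<Sigma>] weights_nonempty[OF wf False] by (simp_all add: V_def)
    have wfB: "wf_pwa \<Sigma> B"
      unfolding B_def by (rule wf_resampler[OF wf V])
    have "L_as A w = L_pos B w" if w: "range w \<subseteq> \<Sigma>" for w
    proof (rule eq_if_same_lower_bounds)
      fix \<eta>
      let ?P = "\<lambda>\<eta>. measure (chain (init A) (word_kernel A w)) {r. io_ge A w \<eta> r}"
      let ?P' = "measure (chain (init B) (word_kernel B w)) {r. io_ge B w \<eta> r}"
      have "?P \<eta> = 1 \<longleftrightarrow> ?P' > 0"
      \<comment> \<open>Below the least weight every transition counts on both sides.\<close>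
      proof (cases "\<eta> \<le> real_of_rat (Min V)")
        case True
        have *: "\<eta> \<le> real_of_rat x" if "x \<in> V" for x
        proof -
          have "real_of_rat (Min V) \<le> real_of_rat x"
            using V that by (simp add: of_rat_less_eq)
          then show ?thesis using True by linarith
        qed
        have "Min V \<in> V" using V by (rule Min_in)
        then have "weights \<Sigma> B \<subseteq> V"
          by (auto simp: weights_def B_def states_resampler weight_resampler split: if_splits)
        then have "?P' = 1"
          using * by (intro measure_io_ge_eq_1_if_below_weights[OF wfB w]) auto
        moreover have "?P \<eta> = 1"
          using * by (intro measure_io_ge_eq_1_if_below_weights[OF wf w]) (auto simp: V_def)
        ultimately show ?thesis by simp
      next
        case False
        then have \<eta>: "real_of_rat (Min V) < \<eta>" by simp
        have "?P' > 0 \<longleftrightarrow> (\<exists>v\<in>V. \<eta> \<le> real_of_rat v \<and> ?P (real_of_rat v) = 1)"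
          unfolding B_def init_resampler measure_chain_mixture_pos_iff[OF sets_io_ge V]
          by (intro bex_cong refl measure_resampler_pos_iff[OF wf \<Sigma> w V _ \<eta>])
        also have "\<dots> \<longleftrightarrow> ?P \<eta> = 1"
        proof
          assume "\<exists>v\<in>V. \<eta> \<le> real_of_rat v \<and> ?P (real_of_rat v) = 1"
          then obtain v where v: "\<eta> \<le> real_of_rat v" "?P (real_of_rat v) = 1" by blast
          have "?P (real_of_rat v) \<le> ?P \<eta>"
          proof (rule chain.finite_measure_mono)
            show "{r. io_ge A w (real_of_rat v) r} \<subseteq> {r. io_ge A w \<eta> r}"
              using v(1) by (auto simp: io_ge_def elim!: INFM_mono)
          qed (simp add: sets_io_ge)
          then show "?P \<eta> = 1" using v(2) by (intro antisym) auto
        next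
          assume P: "?P \<eta> = 1"
          \<comment> \<open>The guess is \<open>\<eta>\<close> rounded up to the next weight; the
            heavy transitions of runs remain the same.\<close>
          define U where "U = {v \<in> V. \<eta> \<le> real_of_rat v}"
          have inU: "weight_seq A w r i \<in> U"
            if "is_run A w r" "\<eta> \<le> real_of_rat (weight_seq A w r i)" for r i
            using weight_seq_in_weights[OF wf w that(1)] that(2) by (simp add: U_def V_def)
          have finU: "finite U" using V by (simp add: U_def)
          have AE: "AE r in chain (init A) (word_kernel A w). is_run A w r \<and> io_ge A w \<eta> r"
            using P AE_is_run[of A w] sets_io_ge by (simp add: chain.prob_eq_1)
          have "U \<noteq> {}"
          proof
            assume "U = {}"
            then have "\<not> (is_run A w r \<and> io_ge A w \<eta> r)" for r
              using inU[of r] INFM_EX[of "\<lambda>i. \<eta> \<le> real_of_rat (weight_seq A w r i)"]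
              unfolding io_ge_def by blast
            with AE have "AE r in chain (init A) (word_kernel A w). False"
              by (auto elim: eventually_mono)
            then show False by (simp add: chain.AE_False)
          qed
          then have MU: "Min U \<in> U" using finU by (intro Min_in)
          have "AE r in chain (init A) (word_kernel A w). io_ge A w (real_of_rat (Min U)) r"
            using AE
          proof eventually_elim
            fix r assume r: "is_run A w r \<and> io_ge A w \<eta> r"
            then have "\<exists>\<^sub>\<infinity>i. \<eta> \<le> real_of_rat (weight_seq A w r i)" by (simp add: io_ge_def)
            then show "io_ge A w (real_of_rat (Min U)) r"
              unfolding io_ge_def
              by (rule INFM_mono) (use r inU finU in \<open>auto simp: of_rat_less_eq\<close>)
          qed
          then have "?P (real_of_rat (Min U)) = 1"
            using sets_io_ge by (subst chain.prob_eq_1) auto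
          then show "\<exists>v\<in>V. \<eta> \<le> real_of_rat v \<and> ?P (real_of_rat v) = 1"
            using MU by (auto simp: U_def)
        qed
        finally show ?thesis by simp
      qed
      then show "\<eta> \<le> L_as A w \<longleftrightarrow> \<eta> \<le> L_pos B w"
        by (simp add: le_L_as_iff[OF wf \<Sigma> w] le_L_pos_iff[OF wfB \<Sigma> w])
    qed
    with wfB show ?thesis by blast
  qed
qed

section \<open>Nondeterministic to positive semantics\<close>

text \<open>If each \<open>q\<close> failed at some index, all of them would fail at the largest of
  these indices.\<close>

lemma finite_choice_of_antimono:
  assumes fin: "finite F" and ex: "\<And>j :: nat. \<exists>q\<in>F. P q j" and anti: "\<And>q j j'. P q j \<Longrightarrow> j' \<le> j \<Longrightarrow> P q j'"
  shows "\<exists>q\<in>F. \<forall>j. P q j"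
proof (rule ccontr)
  assume "\<not> ?thesis"
  then obtain jf where jf: "\<And>q. q \<in> F \<Longrightarrow> \<not> P q (jf q)" by metis
  obtain q where q: "q \<in> F" "P q (Max (jf ` F))" using ex by blast
  then show False using anti[OF q(2), of "jf q"] jf[OF q(1)] fin by simp
qed

text \<open>Koenig's lemma for a tree with levels \<open>R n\<close> and parent map
  \<open>g\<close>; a node stays alive if it has descendants on every later level.\<close>

lemma koenig:
  fixes R :: "nat \<Rightarrow> 'a set" and g :: "nat \<Rightarrow> 'a \<Rightarrow> 'a"
  assumes fin: "\<And>n. finite (R n)" and ne: "\<And>n. R n \<noteq> {}"
    and g: "\<And>n q. q \<in> R (Suc n) \<Longrightarrow> g n q \<in> R n"
  shows "\<exists>r. (\<forall>n. r n \<in> R n) \<and> (\<forall>n. r n = g n (r (Suc n)))"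
proof -
  \<comment> \<open>\<open>anc n j\<close> leads from level \<open>n + j\<close> back to its
    ancestor on level \<open>n\<close>.\<close>
  define anc where "anc = (\<lambda>n. rec_nat (\<lambda>q. q) (\<lambda>j f q. f (g (n + j) q)))"
  have anc0: "anc n 0 q = q" and ancS: "anc n (Suc j) q = anc n j (g (n + j) q)" for n j q
    by (simp_all add: anc_def)
  have anc_in: "anc n j q \<in> R n" if "q \<in> R (n + j)" for n j q
    using that by (induction j arbitrary: q) (auto simp: anc0 ancS g)
  have anc_g: "anc n (Suc j) q = g n (anc (Suc n) j q)" for n j q
    by (induction j arbitrary: q) (auto simp: anc0 ancS)
  define anti where "anti = (\<lambda>n q j. \<exists>q'\<in>R (n + j). anc n j q' = q)"
  have anti_Suc: "anti n q (Suc j) \<Longrightarrow> anti n q j" for n q j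
    unfolding anti_def using g by (auto simp: ancS)
  have anti_le: "anti n q j \<Longrightarrow> j' \<le> j \<Longrightarrow> anti n q j'" for n q j j'
    by (induction j) (auto simp: le_Suc_eq dest: anti_Suc)
  define alive where "alive = (\<lambda>n q. q \<in> R n \<and> (\<forall>j. anti n q j))"
  have "\<exists>q\<in>R 0. \<forall>j. anti 0 q j"
  proof (rule finite_choice_of_antimono[OF fin _ anti_le])
    fix j
    obtain q' where "q' \<in> R (0 + j)" using ne by fastforce
    then show "\<exists>q\<in>R 0. anti 0 q j" using anc_in by (auto simp: anti_def)
  qed
  then have 0: "\<exists>q. alive 0 q" by (auto simp: alive_def)
  have step: "\<exists>q1. alive (Suc n) q1 \<and> q = g n q1" if "alive n q" for n q
  proof -
    have "\<exists>q1\<in>R (Suc n). \<forall>j. anti (Suc n) q1 j \<and> q = g n q1"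
    proof (rule finite_choice_of_antimono[OF fin])
      fix j
      have "anti n q (Suc j)" using that by (simp add: alive_def)
      then obtain q' where "q' \<in> R (Suc n + j)" "anc n (Suc j) q' = q"
        by (auto simp: anti_def)
      then show "\<exists>q1\<in>R (Suc n). anti (Suc n) q1 j \<and> q = g n q1"
        using anc_in[of q' "Suc n" j] anc_g[of n j q'] by (auto simp: anti_def)
    qed (use anti_le in blast)
    then show ?thesis by (auto simp: alive_def)
  qed
  obtain r where "\<And>n. alive n (r n)" "\<And>n. r n = g n (r (Suc n))"
    using dependent_nat_choice[of alive "\<lambda>n q q1. q = g n q1"] 0 step by metis
  then have "(\<forall>n. r n \<in> R n) \<and> (\<forall>n. r n = g n (r (Suc n)))"
    unfolding alive_def by blast
  then show ?thesis by blast
qed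

text \<open>Each state picks a predecessor witnessing its membership in the breakpoint set whenever possible;
  between two resets an infinite branch of the resulting tree must contain a transition in \<^term>\<open>G\<close>.\<close>

lemma koenig_breakpoint:
  fixes R S :: "nat \<Rightarrow> 'a set" and E G :: "nat \<Rightarrow> 'a \<Rightarrow> 'a \<Rightarrow> bool"
  defines "T \<equiv> \<lambda>n. {q'. \<exists>q\<in>R n. E n q q' \<and> (q \<in> S n \<or> G n q q')}"
  assumes fin: "\<And>n. finite (R n)" and ne: "\<And>n. R n \<noteq> {}"
    and pred: "\<And>n q'. q' \<in> R (Suc n) \<Longrightarrow> \<exists>q\<in>R n. E n q q'"
    and S: "\<And>n. S (Suc n) \<subseteq> T n"
    and reset: "\<exists>\<^sub>\<infinity>n. R (Suc n) \<subseteq> T n \<and> S (Suc n) = {}"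
  obtains r where "\<And>n. r n \<in> R n" "\<And>n. E n (r n) (r (Suc n))" "\<exists>\<^sub>\<infinity>n. G n (r n) (r (Suc n))"
proof -
  \<comment> \<open>The preference among parents matters: an arbitrary parent might lie outside
    \<open>S\<close> and lose the information that \<open>G\<close> has been passed.\<close>
  define g where "g = (\<lambda>n q'. SOME q. q \<in> R n \<and> E n q q' \<and> (q' \<in> T n \<longrightarrow> q \<in> S n \<or> G n q q'))"
  have g: "g n q' \<in> R n \<and> E n (g n q') q' \<and> (q' \<in> T n \<longrightarrow> g n q' \<in> S n \<or> G n (g n q') q')"
    if "q' \<in> R (Suc n)" for n q'
    unfolding g_def
  proof (rule someI_ex, cases "q' \<in> T n")
    case True
    then obtain q where "q \<in> R n" "E n q q'" "q \<in> S n \<or> G n q q'"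
      unfolding T_def by blast
    then show "\<exists>q. q \<in> R n \<and> E n q q' \<and> (q' \<in> T n \<longrightarrow> q \<in> S n \<or> G n q q')" by blast
  next
    case False
    then show "\<exists>q. q \<in> R n \<and> E n q q' \<and> (q' \<in> T n \<longrightarrow> q \<in> S n \<or> G n q q')"
      using pred[OF that] by blast
  qed
  have "\<exists>r. (\<forall>n. r n \<in> R n) \<and> (\<forall>n. r n = g n (r (Suc n)))"
    by (rule koenig[OF fin ne]) (use g in blast)
  then obtain r where "(\<forall>n. r n \<in> R n) \<and> (\<forall>n. r n = g n (r (Suc n)))" ..
  then have r: "r n \<in> R n" "r n = g n (r (Suc n))" for n
    by blast+
  have E: "E n (r n) (r (Suc n))" and back_step: "r (Suc n) \<in> T n \<Longrightarrow> r n \<in> S n \<or> G n (r n) (r (Suc n))" for n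
    using g[OF r(1)[of "Suc n"]] unfolding r(2)[of n, symmetric] by blast+
  have "\<exists>\<^sub>\<infinity>n. G n (r n) (r (Suc n))"
  proof (rule ccontr)
    assume "\<not> ?thesis"
    then obtain N where N: "\<And>n. N \<le> n \<Longrightarrow> \<not> G n (r n) (r (Suc n))"
      unfolding INFM_nat_le by blast
    obtain m where m: "N \<le> m" "S (Suc m) = {}"
      using reset unfolding INFM_nat_le by blast
    \<comment> \<open>A reset empties \<open>S\<close>; a branch without \<open>G\<close> cannot
      re-enter it, because membership in \<open>S\<close> would be traced back to \<open>S\<close>
      or to \<open>G\<close>. The next reset demands just that.\<close>
    have notS: "r (Suc m + j) \<notin> S (Suc m + j)" for j
    proof (induction j)
      case (Suc j)
      then show ?case
        using S[of "Suc m + j"] back_step[of "Suc m + j"] N[of "Suc m + j"] m(1) by auto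
    qed (use m in simp)
    obtain m' where m': "Suc m \<le> m'" "R (Suc m') \<subseteq> T m'"
      using reset unfolding INFM_nat_le by blast
    then have "r m' \<in> S m' \<or> G m' (r m') (r (Suc m'))"
      using r(1) by (intro back_step) blast
    moreover have "r m' \<notin> S m'"
      using notS[of "m' - Suc m"] m'(1) by simp
    ultimately show False using N[of m'] m(1) m'(1) by simp
  qed
  with r(1) E show thesis using that by blast
qed

section \<open>The breakpoint construction\<close>

definition good :: "pwa \<Rightarrow> rat \<Rightarrow> nat set \<Rightarrow> nat \<Rightarrow> nat set" where
  "good A v R \<sigma> = {q'. \<exists>q\<in>R. q' \<in> set_pmf (trans A q \<sigma>) \<and> v \<le> weight A q \<sigma> q'}"

text \<open>The breakpoint set: states reached since the last reset by some path with a transition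
  of weight at least \<open>v\<close>. A breakpoint is its equality with the whole reachable
  set.\<close>

definition bp_update :: "pwa \<Rightarrow> rat \<Rightarrow> nat set \<Rightarrow> nat set \<Rightarrow> nat \<Rightarrow> nat set" where
  "bp_update A v X Y \<sigma> = post A Y \<sigma> \<union> good A v X \<sigma>"

definition bp_code :: "rat \<Rightarrow> bool \<Rightarrow> nat set \<Rightarrow> nat set \<Rightarrow> nat" where
  "bp_code v b X Y = to_nat (v, b, set_encode X, set_encode Y)"

definition bp_succ :: "pwa \<Rightarrow> rat \<Rightarrow> bool \<Rightarrow> nat set \<Rightarrow> nat set \<Rightarrow> nat \<Rightarrow> nat set" where
  "bp_succ A v b X Y \<sigma> =
    (if b then {bp_code v True (post A X \<sigma>)
        (if bp_update A v X Y \<sigma> = post A X \<sigma> then {} else bp_update A v X Y \<sigma>)}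
     else (\<lambda>(b', q'). bp_code v b' {q'} {}) ` (UNIV \<times> post A X \<sigma>))"

text \<open>While the flag is unset, the automaton follows a single state \<^term>\<open>q\<close>, coded as \<^term>\<open>{q}\<close>, and may
  switch to the deterministic breakpoint construction in every step.\<close>

definition bp_automaton :: "pwa \<Rightarrow> rat set \<Rightarrow> pwa" where
  "bp_automaton A V = \<lparr>
    states = {bp_code v b X Y | v b X Y. v \<in> V \<and> X \<noteq> {} \<and> X \<subseteq> states A \<and> Y \<subseteq> states A},
    init = pmf_of_set ((\<lambda>(v, q). bp_code v False {q} {}) ` (V \<times> set_pmf (init A))),
    trans = (\<lambda>x \<sigma>. case from_nat x :: rat \<times> bool \<times> nat \<times> nat of (v, b, c, d) \<Rightarrow>
      pmf_of_set (bp_succ A v b (set_decode c) (set_decode d) \<sigma>)),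
    weight = (\<lambda>x \<sigma> y. case from_nat x :: rat \<times> bool \<times> nat \<times> nat of (v, b, c, d) \<Rightarrow>
      if b \<and> bp_update A v (set_decode c) (set_decode d) \<sigma> = post A (set_decode c) \<sigma> then v else Min V)\<rparr>"

lemma trans_bp_automaton:
  "finite X \<Longrightarrow> finite Y \<Longrightarrow>
    trans (bp_automaton A V) (bp_code v b X Y) \<sigma> = pmf_of_set (bp_succ A v b X Y \<sigma>)"
  by (simp add: bp_automaton_def bp_code_def[of v b X Y] set_encode_inverse)

lemma weight_bp_automaton:
  "finite X \<Longrightarrow> finite Y \<Longrightarrow> weight (bp_automaton A V) (bp_code v b X Y) \<sigma> y =
    (if b \<and> bp_update A v X Y \<sigma> = post A X \<sigma> then v else Min V)"
  by (simp add: bp_automaton_def bp_code_def set_encode_inverse)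

lemma bp_code_eq_iff:
  "finite X \<Longrightarrow> finite Y \<Longrightarrow> finite X' \<Longrightarrow> finite Y' \<Longrightarrow>
    bp_code v b X Y = bp_code v' b' X' Y' \<longleftrightarrow> v = v' \<and> b = b' \<and> X = X' \<and> Y = Y'"
  by (auto simp: bp_code_def set_encode_eq)

lemma states_bp_automaton:
  "states (bp_automaton A V) =
    {bp_code v b X Y | v b X Y. v \<in> V \<and> X \<noteq> {} \<and> X \<subseteq> states A \<and> Y \<subseteq> states A}"
  by (simp add: bp_automaton_def)

lemma bp_code_in_states:
  "v \<in> V \<Longrightarrow> X \<noteq> {} \<Longrightarrow> X \<subseteq> states A \<Longrightarrow> Y \<subseteq> states A \<Longrightarrow> bp_code v b X Y \<in> states (bp_automaton A V)"
  unfolding states_bp_automaton by blast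

lemma post_nonempty: "X \<noteq> {} \<Longrightarrow> post A X \<sigma> \<noteq> {}"
  by (simp add: post_def set_pmf_not_empty)

lemma post_mono: "X \<subseteq> Y \<Longrightarrow> post A X \<sigma> \<subseteq> post A Y \<sigma>"
  by (auto simp: post_def)

lemma good_subset_post: "good A v X \<sigma> \<subseteq> post A X \<sigma>"
  by (auto simp: post_def good_def)

lemma bp_update_subset_post: "Y \<subseteq> X \<Longrightarrow> bp_update A v X Y \<sigma> \<subseteq> post A X \<sigma>"
  using post_mono good_subset_post by (simp add: bp_update_def)

lemma set_init_bp_automaton:
  assumes "wf_pwa \<Sigma> A" "finite V" "V \<noteq> {}"
  shows "set_pmf (init (bp_automaton A V)) = (\<lambda>(v, q). bp_code v False {q} {}) ` (V \<times> set_pmf (init A))"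
proof -
  have "finite (set_pmf (init A))" using assms(1) finite_subset by (auto simp: wf_pwa_def)
  then show ?thesis
    using assms set_pmf_not_empty[of "init A"] by (simp add: bp_automaton_def)
qed

lemma finite_bp_succ: "finite (post A X \<sigma>) \<Longrightarrow> finite (bp_succ A v b X Y \<sigma>)"
  by (simp add: bp_succ_def)

lemma bp_succ_nonempty: "X \<noteq> {} \<Longrightarrow> bp_succ A v b X Y \<sigma> \<noteq> {}"
  using post_nonempty[of X A \<sigma>] by (auto simp: bp_succ_def)

lemma set_trans_bp_automaton:
  assumes "wf_pwa \<Sigma> A" "\<sigma> \<in> \<Sigma>" "X \<noteq> {}" "X \<subseteq> states A" "Y \<subseteq> states A"
  shows "set_pmf (trans (bp_automaton A V) (bp_code v b X Y) \<sigma>) = bp_succ A v b X Y \<sigma>"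
proof -
  have "finite (states A)" using assms(1) by (simp add: wf_pwa_def)
  then have "finite X" "finite Y" "finite (post A X \<sigma>)"
    using assms(4,5) post_subset[OF assms(1,2,4)] by (auto dest: finite_subset)
  then show ?thesis
    using assms(3) by (simp add: trans_bp_automaton finite_bp_succ bp_succ_nonempty)
qed

lemma wf_bp_automaton:
  assumes wf: "wf_pwa \<Sigma> A" and V: "finite V" "V \<noteq> {}"
  shows "wf_pwa \<Sigma> (bp_automaton A V)"
  unfolding wf_pwa_def
proof (intro conjI ballI)
  have fin: "finite (states A)" using wf by (simp add: wf_pwa_def)
  have "states (bp_automaton A V) \<subseteq>
      (\<lambda>(v, b, X, Y). bp_code v b X Y) ` (V \<times> UNIV \<times> Pow (states A) \<times> Pow (states A))"
    unfolding states_bp_automaton by (force simp: image_iff)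
  then show "finite (states (bp_automaton A V))"
    using fin V(1) by (meson finite_SigmaI finite_Pow_iff finite_surj finite)
  have "set_pmf (init A) \<subseteq> states A" using wf by (simp add: wf_pwa_def)
  then show "set_pmf (init (bp_automaton A V)) \<subseteq> states (bp_automaton A V)"
    unfolding set_init_bp_automaton[OF wf V] by (auto intro!: bp_code_in_states)
  fix x \<sigma> assume "x \<in> states (bp_automaton A V)" and \<sigma>: "\<sigma> \<in> \<Sigma>"
  then obtain v b X Y where x: "x = bp_code v b X Y" "v \<in> V" "X \<noteq> {}" "X \<subseteq> states A" "Y \<subseteq> states A"
    by (auto simp: states_bp_automaton)
  have sub: "post A X \<sigma> \<subseteq> states A" "post A Y \<sigma> \<subseteq> states A"
    using post_subset[OF wf \<sigma>] x by auto
  then have "bp_update A v X Y \<sigma> \<subseteq> states A"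
    using good_subset_post[of A v X \<sigma>] by (auto simp: bp_update_def)
  then show "set_pmf (trans (bp_automaton A V) x \<sigma>) \<subseteq> states (bp_automaton A V)"
    unfolding x(1) set_trans_bp_automaton[OF wf \<sigma> x(3-5)] bp_succ_def
    using x(2) sub(1) post_nonempty[OF x(3)] by (auto intro!: bp_code_in_states)
qed

lemma weights_bp_automaton:
  assumes wf: "wf_pwa \<Sigma> A" and V: "finite V" "V \<noteq> {}"
  shows "weights \<Sigma> (bp_automaton A V) \<subseteq> V"
proof -
  have "finite X" if "X \<subseteq> states A" for X using wf that finite_subset by (auto simp: wf_pwa_def)
  moreover have "Min V \<in> V" using V by (rule Min_in)
  ultimately show ?thesis
    by (auto simp: weights_def states_bp_automaton weight_bp_automaton split: if_splits)
qed

text \<open>The \<open>X\<close> components are the levels of a finitely branching tree. In the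
  guessing phase they are singletons, so \<open>koenig_breakpoint\<close> handles both phases at
  once.\<close>

lemma run_of_bp_run:
  assumes wf: "wf_pwa \<Sigma> A" and w: "range w \<subseteq> \<Sigma>" and V: "finite V" "V \<noteq> {}"
    and x: "is_run (bp_automaton A V) w x" and io: "io_ge (bp_automaton A V) w \<eta> x"
    and \<eta>: "real_of_rat (Min V) < \<eta>"
  shows "\<exists>r. is_run A w r \<and> io_ge A w \<eta> r"
proof -
  have fin: "finite X" if "X \<subseteq> states A" for X using wf that finite_subset by (auto simp: wf_pwa_def)
  have wi: "w i \<in> \<Sigma>" for i using w by auto
  have "x 0 \<in> set_pmf (init (bp_automaton A V))" using x by (simp add: is_run_iff)
  then obtain v q0 where v: "v \<in> V" and q0: "q0 \<in> set_pmf (init A)" "x 0 = bp_code v False {q0} {}"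
    unfolding set_init_bp_automaton[OF wf V] by auto
  define inv where "inv = (\<lambda>b X Y. X \<noteq> {} \<and> X \<subseteq> states A \<and> Y \<subseteq> X \<and> (\<not> b \<longrightarrow> Y = {}))"
  have step: "x (Suc i) \<in> bp_succ A v b X Y (w i)" if "x i = bp_code v b X Y" "inv b X Y" for i b X Y
  proof -
    have "x (Suc i) \<in> set_pmf (trans (bp_automaton A V) (x i) (w i))"
      using x by (simp add: is_run_iff)
    then show ?thesis
      unfolding that(1) using that(2) by (subst (asm) set_trans_bp_automaton[OF wf wi]) (auto simp: inv_def)
  qed
  have "\<exists>b X Y. x i = bp_code v b X Y \<and> inv b X Y" for i
  proof (induction i)
    case 0
    have "q0 \<in> states A" using q0(1) wf by (auto simp: wf_pwa_def)
    then have "inv False {q0} {}" by (simp add: inv_def)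
    then show ?case using q0(2) by blast
  next
    case (Suc i)
    then obtain b X Y where IH: "x i = bp_code v b X Y" "inv b X Y" by blast
    have sub: "post A X (w i) \<subseteq> states A" "post A X (w i) \<noteq> {}" "bp_update A v X Y (w i) \<subseteq> post A X (w i)"
      using IH(2) post_subset[OF wf wi] post_nonempty bp_update_subset_post by (auto simp: inv_def)
    show ?case
    proof (cases b)
      case True
      let ?Y = "if bp_update A v X Y (w i) = post A X (w i) then {} else bp_update A v X Y (w i)"
      have "x (Suc i) = bp_code v True (post A X (w i)) ?Y"
        using step[OF IH] True by (simp add: bp_succ_def)
      moreover have "inv True (post A X (w i)) ?Y"
        using sub by (simp add: inv_def)
      ultimately show ?thesis by blast
    next
      case False
      then obtain b' q' where "x (Suc i) = bp_code v b' {q'} {}" "q' \<in> post A X (w i)"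
        using step[OF IH] by (auto simp: bp_succ_def)
      moreover from this(2) have "inv b' {q'} {}"
        using sub by (auto simp: inv_def)
      ultimately show ?thesis by blast
    qed
  qed
  then obtain b X Y where code: "\<And>i. x i = bp_code v (b i) (X i) (Y i)" and inv: "\<And>i. inv (b i) (X i) (Y i)"
    by metis
  have finXY: "finite (X i)" "finite (Y i)" for i
    using inv[of i] fin by (auto simp: inv_def intro: finite_subset)
  have X0: "X 0 = {q0}"
    using q0(2) code[of 0] finXY[of 0] by (simp add: bp_code_eq_iff)
  have next_det: "X (Suc i) = post A (X i) (w i) \<and> Y (Suc i) = (if bp_update A v (X i) (Y i) (w i) = post A (X i) (w i)
      then {} else bp_update A v (X i) (Y i) (w i))" if "b i" for i
  proof -
    have "finite (post A (X i) (w i))" "finite (bp_update A v (X i) (Y i) (w i))"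
      using fin[OF post_subset[OF wf wi]] inv[of i] finite_subset[OF bp_update_subset_post[of "Y i" "X i"]]
      by (auto simp: inv_def)
    then show ?thesis
      using step[OF code inv, of i] that finXY[of "Suc i"] unfolding code[of "Suc i"]
      by (simp add: bp_succ_def bp_code_eq_iff)
  qed
  have next_guess: "(\<exists>q'\<in>post A (X i) (w i). X (Suc i) = {q'}) \<and> Y (Suc i) = {}" if "\<not> b i" for i
    using step[OF code inv, of i] that finXY[of "Suc i"] unfolding code[of "Suc i"]
    by (auto simp: bp_succ_def bp_code_eq_iff)
  let ?E = "\<lambda>n q q'. q' \<in> set_pmf (trans A q (w n))"
  let ?G = "\<lambda>n q q'. v \<le> weight A q (w n) q'"
  let ?T = "\<lambda>n. {q'. \<exists>q\<in>X n. ?E n q q' \<and> (q \<in> Y n \<or> ?G n q q')}"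
  \<comment> \<open>The invariant \<open>Y \<subseteq> X\<close> makes \<open>bp_update\<close>
    literally the set used in the tree argument.\<close>
  have T: "bp_update A v (X n) (Y n) (w n) = ?T n" for n
    using inv[of n] by (auto simp: bp_update_def post_def good_def inv_def)
  \<comment> \<open>As \<open>\<eta>\<close> exceeds the default \<open>Min V\<close>, a transition
    counts only if it completes a breakpoint.\<close>
  have bp: "b i \<and> bp_update A v (X i) (Y i) (w i) = post A (X i) (w i) \<and> \<eta> \<le> real_of_rat v"
    if "\<eta> \<le> real_of_rat (weight_seq (bp_automaton A V) w x i)" for i
    using that \<eta> unfolding weight_seq_def code[of i] weight_bp_automaton[OF finXY]
    by (auto split: if_splits)
  have io': "\<exists>\<^sub>\<infinity>i. \<eta> \<le> real_of_rat (weight_seq (bp_automaton A V) w x i)"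
    using io by (simp add: io_ge_def)
  have reset: "\<exists>\<^sub>\<infinity>n. X (Suc n) \<subseteq> ?T n \<and> Y (Suc n) = {}"
    using io' by (rule INFM_mono) (use bp next_det T in auto)
  obtain r where r: "\<And>n. r n \<in> X n" "\<And>n. ?E n (r n) (r (Suc n))" "\<exists>\<^sub>\<infinity>n. ?G n (r n) (r (Suc n))"
  proof (rule koenig_breakpoint[of X ?E Y ?G])
    show "finite (X n)" "X n \<noteq> {}" for n
      using finXY inv[of n] by (auto simp: inv_def)
    show "\<exists>q\<in>X n. ?E n q q'" if "q' \<in> X (Suc n)" for n q'
      using that next_det[of n] next_guess[of n] by (cases "b n") (auto simp: post_def)
    show "Y (Suc n) \<subseteq> ?T n" for n
      using next_det[of n] next_guess[of n] T[of n] by (cases "b n") auto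
  qed (use reset in auto)
  have "is_run A w r"
    using r(1)[of 0] r(2) X0 q0(1) by (simp add: is_run_iff)
  moreover have "io_ge A w \<eta> r"
    unfolding io_ge_def
  proof (rule INFM_mono[OF r(3)])
    fix n assume "v \<le> weight A (r n) (w n) (r (Suc n))"
    moreover have "\<eta> \<le> real_of_rat v" using bp INFM_EX[OF io'] by blast
    ultimately show "\<eta> \<le> real_of_rat (weight_seq A w r n)"
      unfolding weight_seq_def by (meson of_rat_less_eq order_trans)
  qed
  ultimately show ?thesis by blast
qed

text \<open>The first component of the breakpoint automaton when it follows \<open>r\<close> and
  switches at time \<open>i\<close>.\<close>

primrec reach_from :: "pwa \<Rightarrow> (nat \<Rightarrow> nat) \<Rightarrow> (nat \<Rightarrow> nat) \<Rightarrow> nat \<Rightarrow> nat \<Rightarrow> nat set" where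
  "reach_from A w r i 0 = {r 0}"
| "reach_from A w r i (Suc k) = (if i \<le> k then post A (reach_from A w r i k) (w k) else {r (Suc k)})"

lemma reach_from_le: "k \<le> i \<Longrightarrow> reach_from A w r i k = {r k}"
  by (cases k) auto

lemma run_in_reach_from: "is_run A w r \<Longrightarrow> r k \<in> reach_from A w r i k"
  by (induction k) (auto simp: is_run_iff intro: postI)

text \<open>A later start keeps only the state of the run for longer, and that state also belongs to
  the sets started earlier.\<close>

lemma reach_from_antimono:
  assumes "is_run A w r" "i \<le> n"
  shows "reach_from A w r n k \<subseteq> reach_from A w r i k"
proof (induction k)
  case (Suc k)
  show ?case
  proof (cases "n \<le> k")
    case True
    then show ?thesis using assms(2) post_mono[OF Suc] by simp
  next
    case False
    then show ?thesis using run_in_reach_from[OF assms(1), of "Suc k" i] by simp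
  qed
qed simp

lemma reach_from_subset_states:
  assumes "wf_pwa \<Sigma> A" "range w \<subseteq> \<Sigma>" "is_run A w r"
  shows "reach_from A w r i k \<subseteq> states A"
proof (induction k)
  case (Suc k)
  have "w k \<in> \<Sigma>" using assms(2) by auto
  then show ?case
    using post_subset[OF assms(1) _ Suc] is_run_states[OF assms] by simp
qed (use is_run_states[OF assms] in simp)

text \<open>For fixed \<^term>\<open>k\<close> the sets reachable from the run decrease with the starting time, so a starting time
  that minimises their eventual cardinality is one from which all later ones merge.\<close>

lemma merging_start:
  assumes wf: "wf_pwa \<Sigma> A" and w: "range w \<subseteq> \<Sigma>" and r: "is_run A w r"
  obtains m where "0 < m" "\<And>n. m \<le> n \<Longrightarrow> \<exists>k\<ge>n. reach_from A w r n k = reach_from A w r m k"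
proof -
  let ?P = "reach_from A w r"
  have fin: "finite (?P i k)" for i k
    using finite_subset[OF reach_from_subset_states[OF assms]] wf by (simp add: wf_pwa_def)
  \<comment> \<open>Starting times are positive because the initial states of the automaton have the
    flag unset. "Infinitely often" suffices, as the sets may grow and shrink.\<close>
  define Q where "Q = (\<lambda>c. \<exists>m>0. \<exists>\<^sub>\<infinity>k. card (?P m k) \<le> c)"
  have "\<exists>\<^sub>\<infinity>k. card (?P 1 k) \<le> card (states A)"
    using card_mono[OF _ reach_from_subset_states[OF assms]] wf by (simp add: wf_pwa_def INFM_iff_infinite)
  then have "Q (card (states A))" unfolding Q_def by (intro exI[of _ 1]) simp
  then have Qc: "Q (Least Q)" by (rule LeastI)
  define c where "c = Least Q"
  obtain m where m: "0 < m" "\<exists>\<^sub>\<infinity>k. card (?P m k) \<le> c"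
    using Qc by (auto simp: Q_def c_def)
  have "\<exists>k\<ge>n. ?P n k = ?P m k" if "m \<le> n" for n
  proof -
    \<comment> \<open>By minimality of \<open>c\<close>, no later start can drop below
      \<open>c\<close> infinitely often; a subset of at least equal size is the whole set.\<close>
    have "\<not> (\<exists>\<^sub>\<infinity>k. card (?P n k) < c)"
    proof
      assume *: "\<exists>\<^sub>\<infinity>k. card (?P n k) < c"
      then have "c \<noteq> 0" by (auto dest: INFM_EX)
      moreover have "Q (c - 1)"
        unfolding Q_def using m(1) that by (intro exI[of _ n] conjI INFM_mono[OF *]) auto
      ultimately show False
        using not_less_Least[of "c - 1" Q] by (simp add: c_def)
    qed
    then have "\<forall>\<^sub>\<infinity>k. c \<le> card (?P n k)" by (simp add: not_less)
    then have "\<exists>\<^sub>\<infinity>k. card (?P m k) \<le> c \<and> c \<le> card (?P n k)"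
      by (rule INFM_conjI[OF m(2)])
    then obtain k where k: "n \<le> k" "card (?P m k) \<le> c" "c \<le> card (?P n k)"
      unfolding INFM_nat_le by blast
    have "?P n k = ?P m k"
      by (rule card_seteq[OF fin reach_from_antimono[OF r that]]) (use k in simp)
    with k(1) show ?thesis by blast
  qed
  with m(1) show thesis by (rule that)
qed

text \<open>The path that follows \<open>r\<close> and switches at the merging time \<open>m\<close>
  is deterministic afterwards, so this one path has positive probability.\<close>

lemma bp_run_of_run:
  assumes wf: "wf_pwa \<Sigma> A" and w: "range w \<subseteq> \<Sigma>" and V: "finite V" "V \<noteq> {}" and v: "v \<in> V"
    and r: "is_run A w r" and io: "io_ge A w (real_of_rat v) r"
  shows "measure (chain (init (bp_automaton A V)) (word_kernel (bp_automaton A V) w))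
    {x. io_ge (bp_automaton A V) w (real_of_rat v) x} > 0"
proof -
  let ?B = "bp_automaton A V"
  obtain m where m: "0 < m" "\<And>n. m \<le> n \<Longrightarrow> \<exists>k\<ge>n. reach_from A w r n k = reach_from A w r m k"
    using merging_start[OF wf w r] by blast
  define X where "X = reach_from A w r m"
  define Y where "Y = rec_nat {} (\<lambda>k Yk. if m \<le> k \<and> bp_update A v (X k) Yk (w k) \<noteq> X (Suc k)
    then bp_update A v (X k) Yk (w k) else {})"
  have Y0: "Y 0 = {}" and YS: "Y (Suc k) = (if m \<le> k \<and> bp_update A v (X k) (Y k) (w k) \<noteq> X (Suc k)
    then bp_update A v (X k) (Y k) (w k) else {})" for k
    by (simp_all add: Y_def)
  have Y_early: "k \<le> m \<Longrightarrow> Y k = {}" for k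
    by (cases k) (auto simp: Y0 YS)
  have XS: "X (Suc k) = post A (X k) (w k)" if "m \<le> k" for k
    using that by (simp add: X_def)
  have X_early: "k \<le> m \<Longrightarrow> X k = {r k}" for k
    by (simp add: X_def reach_from_le)
  have X_states: "X k \<subseteq> states A" for k
    unfolding X_def by (rule reach_from_subset_states[OF wf w r])
  have X_ne: "X k \<noteq> {}" for k
    using run_in_reach_from[OF r, of k m] by (auto simp: X_def)
  have YX: "Y k \<subseteq> X k" for k
  proof (induction k)
    case (Suc k)
    then show ?case using XS bp_update_subset_post[OF Suc] by (auto simp: YS)
  qed (simp add: Y0)
  have fin: "finite (X k)" "finite (Y k)" for k
    using X_states[of k] YX[of k] wf by (auto simp: wf_pwa_def dest: finite_subset)
  define x where "x = (\<lambda>k. bp_code v (m \<le> k) (X k) (Y k))"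
  have wi: "w i \<in> \<Sigma>" for i using w by auto
  have set_trans: "set_pmf (trans ?B (x k) (w k)) = bp_succ A v (m \<le> k) (X k) (Y k) (w k)" for k
    unfolding x_def using X_ne X_states YX by (intro set_trans_bp_automaton[OF wf wi]) blast+
  have "x 0 = bp_code v False {r 0} {}"
    using m(1) by (simp add: x_def X_early Y_early)
  then have x0: "x 0 \<in> set_pmf (init ?B)"
    unfolding set_init_bp_automaton[OF wf V] using v r by (auto simp: is_run_iff)
  have succ_det: "bp_succ A v (m \<le> k) (X k) (Y k) (w k) = {x (Suc k)}" if "m \<le> k" for k
    using that by (simp add: bp_succ_def x_def XS YS)
  have succ: "x (Suc k) \<in> bp_succ A v (m \<le> k) (X k) (Y k) (w k)" for k
  proof (cases "m \<le> k")
    case False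
    then have "r (Suc k) \<in> post A (X k) (w k)"
      using r by (simp add: X_early is_run_iff post_def)
    with False show ?thesis
      by (auto simp: bp_succ_def x_def X_early Y_early image_iff)
  next
    case True
    then show ?thesis using succ_det by blast
  qed
  have "measure (chain (init ?B) (word_kernel ?B w)) {x} > 0"
  proof (rule measure_chain_singleton_pos[where n=m])
    show "pmf (init ?B) (x 0) > 0" using x0 by (simp add: pmf_positive_iff)
    show "pmf (trans ?B (x i) (w i)) (x (Suc i)) > 0" for i
      using succ set_trans by (simp add: pmf_positive_iff)
    show "pmf (trans ?B (x i) (w i)) (x (Suc i)) = 1" if "m \<le> i" for i
      unfolding x_def[THEN fun_cong, of i] trans_bp_automaton[OF fin] succ_det[OF that]
      by (simp add: pmf_of_set_singleton)
  qed
  moreover have "io_ge ?B w (real_of_rat v) x"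
  proof (rule ccontr)
    assume "\<not> ?thesis"
    then obtain t where t: "\<And>k. t \<le> k \<Longrightarrow> \<not> v \<le> weight_seq ?B w x k"
      unfolding io_ge_def INFM_nat_le by (auto simp: of_rat_less_eq)
    have nobp: "bp_update A v (X k) (Y k) (w k) \<noteq> X (Suc k)" if "t \<le> k" "m \<le> k" for k
      using t[OF that(1)] that(2) fin
      by (auto simp: weight_seq_def x_def weight_bp_automaton XS)
    then have YS': "Y (Suc k) = bp_update A v (X k) (Y k) (w k)" if "t \<le> k" "m \<le> k" for k
      using that by (simp add: YS)
    \<comment> \<open>If breakpoints ceased, \<open>Y\<close> would never be reset again, and the
      next heavy transition of \<open>r\<close> would put its target into \<open>Y\<close> for
      good.\<close>
    obtain n where n: "max t m \<le> n" "v \<le> weight A (r n) (w n) (r (Suc n))"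
      using io unfolding io_ge_def INFM_nat_le weight_seq_def of_rat_less_eq by blast
    have "r n \<in> X n" unfolding X_def by (rule run_in_reach_from[OF r])
    then have "r (Suc n) \<in> Y (Suc n)"
      using n r by (auto simp: YS' bp_update_def good_def is_run_iff)
    have sub: "reach_from A w r (Suc n) k \<subseteq> Y k" if "Suc n \<le> k" for k
      using that
    proof (induction k rule: dec_induct)
      case base
      then show ?case using \<open>r (Suc n) \<in> Y (Suc n)\<close> by simp
    next
      case (step k)
      then show ?case
        using post_mono[OF step.IH] n by (auto simp: YS' bp_update_def)
    qed
    \<comment> \<open>The set started at \<open>Suc n\<close> lies in \<open>Y\<close> and merges
      with \<open>X\<close>, which forces a breakpoint after all.\<close>
    obtain k where k: "Suc n \<le> k" "reach_from A w r (Suc n) k = X k"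
      using m(2)[of "Suc n"] n(1) unfolding X_def by auto
    then obtain k' where k': "k = Suc k'" "n \<le> k'" by (cases k) auto
    have "Y k = X k" using sub[OF k(1)] k(2) YX[of k] by auto
    then show False
      using nobp[of k'] YS'[of k'] n(1) k' by simp
  qed
  then have "measure (chain (init ?B) (word_kernel ?B w)) {x} \<le>
      measure (chain (init ?B) (word_kernel ?B w)) {x. io_ge ?B w (real_of_rat v) x}"
    by (intro chain.finite_measure_mono) (auto simp: sets_io_ge)
  ultimately show ?thesis by linarith
qed

lemma reducible_max_pos: "reducible L_max L_pos"
  unfolding reducible_def
proof (intro allI impI)
  fix \<Sigma> :: "nat set" and A
  assume \<Sigma>: "finite \<Sigma>" and wf: "wf_pwa \<Sigma> A"
  define V where "V = weights \<Sigma> A"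
  define B where "B = bp_automaton A V"
  show "\<exists>B. wf_pwa \<Sigma> B \<and> (\<forall>w. range w \<subseteq> \<Sigma> \<longrightarrow> L_max A w = L_pos B w)"
  proof (cases "\<Sigma> = {}")
    case True
    with wf show ?thesis by auto
  next
    case False
    have V: "finite V" "V \<noteq> {}"
      using finite_weights[OF wf \<Sigma>] weights_nonempty[OF wf False] by (simp_all add: V_def)
    have wfB: "wf_pwa \<Sigma> B"
      unfolding B_def by (rule wf_bp_automaton[OF wf V])
    have "L_max A w = L_pos B w" if w: "range w \<subseteq> \<Sigma>" for w
    proof (rule eq_if_same_lower_bounds)
      fix \<eta>
      let ?P = "measure (chain (init B) (word_kernel B w)) {r. io_ge B w \<eta> r}"
      have "(\<exists>r. is_run A w r \<and> io_ge A w \<eta> r) \<longleftrightarrow> ?P > 0"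
      proof (cases "\<eta> \<le> real_of_rat (Min V)")
        case True
        have *: "\<eta> \<le> real_of_rat x" if "x \<in> V" for x
        proof -
          have "real_of_rat (Min V) \<le> real_of_rat x"
            using V that by (simp add: of_rat_less_eq)
          then show ?thesis using True by linarith
        qed
        have "?P = 1"
          using * weights_bp_automaton[OF wf V]
          by (intro measure_io_ge_eq_1_if_below_weights[OF wfB w]) (auto simp: B_def)
        moreover obtain r where "is_run A w r" by (rule ex_run)
        then have "\<exists>r. is_run A w r \<and> io_ge A w \<eta> r"
          using io_ge_if_below_weights[OF wf w] * by (auto simp: V_def)
        ultimately show ?thesis by simp
      next
        case False
        then have \<eta>: "real_of_rat (Min V) < \<eta>" by simp
        show ?thesis
        proof
          assume "?P > 0"
          have "\<exists>x. is_run B w x \<and> io_ge B w \<eta> x"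
          proof (rule ccontr)
            assume "\<nexists>x. is_run B w x \<and> io_ge B w \<eta> x"
            then have "AE x in chain (init B) (word_kernel B w). x \<notin> {r. io_ge B w \<eta> r}"
              using AE_is_run[of B w] by (auto elim: eventually_mono)
            then have "?P = 0" using sets_io_ge by (subst chain.prob_eq_0) auto
            with \<open>?P > 0\<close> show False by simp
          qed
          then show "\<exists>r. is_run A w r \<and> io_ge A w \<eta> r"
            using run_of_bp_run[OF wf w V _ _ \<eta>] by (auto simp: B_def)
        next
          assume "\<exists>r. is_run A w r \<and> io_ge A w \<eta> r"
          then obtain r where r: "is_run A w r" "\<exists>\<^sub>\<infinity>i. \<eta> \<le> real_of_rat (weight_seq A w r i)"
            by (auto simp: io_ge_def)
          define U where "U = {v \<in> V. \<eta> \<le> real_of_rat v}"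
          have inU: "weight_seq A w r i \<in> U" if "\<eta> \<le> real_of_rat (weight_seq A w r i)" for i
            using weight_seq_in_weights[OF wf w r(1)] that by (simp add: U_def V_def)
          have finU: "finite U" using V by (simp add: U_def)
          have "U \<noteq> {}" using inU INFM_EX[OF r(2)] by blast
          with finU have MU: "Min U \<in> U" by (rule Min_in)
          have "io_ge A w (real_of_rat (Min U)) r"
            unfolding io_ge_def
            by (rule INFM_mono[OF r(2)]) (use inU finU in \<open>auto simp: of_rat_less_eq\<close>)
          then have "measure (chain (init B) (word_kernel B w)) {x. io_ge B w (real_of_rat (Min U)) x} > 0"
            unfolding B_def using MU by (intro bp_run_of_run[OF wf w V _ r(1)]) (auto simp: U_def)
          also have "measure (chain (init B) (word_kernel B w)) {x. io_ge B w (real_of_rat (Min U)) x} \<le> ?P"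
          proof (rule chain.finite_measure_mono)
            show "{x. io_ge B w (real_of_rat (Min U)) x} \<subseteq> {x. io_ge B w \<eta> x}"
              using MU by (auto simp: io_ge_def U_def elim!: INFM_mono)
          qed (simp add: sets_io_ge)
          finally show "?P > 0" .
        qed
      qed
      then show "\<eta> \<le> L_max A w \<longleftrightarrow> \<eta> \<le> L_pos B w"
        by (simp add: le_L_max_iff[OF wf \<Sigma> w] le_L_pos_iff[OF wfB \<Sigma> w])
    qed
    with wfB show ?thesis by blast
  qed
qed

section \<open>A nondeterministic language that is not almost-sure\<close>

text \<open>State \<open>0\<close> guesses that only the letter \<open>1\<close> remains, state \<open>1\<close> checks it, and state \<open>2\<close> is a rejecting sink.\<close>

definition eventually_one_automaton :: pwa where
  "eventually_one_automaton = \<lparr>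
    states = {0, 1, 2},
    init = return_pmf 0,
    trans = (\<lambda>q \<sigma>. if q = 0 then (if \<sigma> = 1 then pmf_of_set {0, 1} else return_pmf 0)
      else if q = 1 \<and> \<sigma> = 1 then return_pmf 1 else return_pmf 2),
    weight = (\<lambda>q \<sigma> q'. if q = 1 then 1 else 0)\<rparr>"

lemma wf_eventually_one_automaton: "wf_pwa \<Sigma> eventually_one_automaton"
  by (auto simp: wf_pwa_def eventually_one_automaton_def)

lemma L_max_eventually_one:
  assumes \<Sigma>: "finite \<Sigma>" and w: "range w \<subseteq> \<Sigma>"
  shows "1 \<le> L_max eventually_one_automaton w \<longleftrightarrow> (\<forall>\<^sub>\<infinity>n. w n = 1)"
proof
  let ?A = eventually_one_automaton
  assume "\<forall>\<^sub>\<infinity>n. w n = 1"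
  then obtain N where N: "\<And>n. N \<le> n \<Longrightarrow> w n = 1"
    unfolding MOST_nat_le by blast
  \<comment> \<open>Letter \<open>w N\<close> is the first one that must be 1, and it is read on the
    step from \<open>N\<close> to \<open>Suc N\<close>.\<close>
  define r where "r = (\<lambda>n. if n \<le> N then 0 else 1 :: nat)"
  have "r (Suc i) \<in> set_pmf (trans ?A (r i) (w i))" for i
    using N[of i] by (cases "i < N"; cases "i = N") (auto simp: r_def eventually_one_automaton_def)
  then have "is_run ?A w r"
    by (simp add: is_run_iff) (simp add: r_def eventually_one_automaton_def)
  moreover have "io_ge ?A w 1 r"
    unfolding io_ge_def INFM_nat_le
  proof
    fix m
    show "\<exists>n\<ge>m. 1 \<le> real_of_rat (weight_seq ?A w r n)"
      by (rule exI[of _ "Suc (m + N)"]) (simp add: weight_seq_def r_def eventually_one_automaton_def)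
  qed
  ultimately show "1 \<le> L_max ?A w"
    using le_L_max_iff[OF wf_eventually_one_automaton \<Sigma> w] by blast
next
  let ?A = eventually_one_automaton
  assume "1 \<le> L_max ?A w"
  then obtain r where run: "is_run ?A w r" and io: "io_ge ?A w 1 r"
    using le_L_max_iff[OF wf_eventually_one_automaton \<Sigma> w] by blast
  have step: "r (Suc i) \<in> set_pmf (trans ?A (r i) (w i))" for i
    using run by (simp add: is_run_iff)
  have one: "\<exists>n\<ge>m. r n = 1" for m
    using io unfolding io_ge_def INFM_nat_le
    by (auto simp: weight_seq_def eventually_one_automaton_def split: if_splits)
  have sink: "r (n + j) = 2" if "r n = 2" for n j
  proof (induction j)
    case (Suc j)
    then show ?case using step[of "n + j"] by (simp add: eventually_one_automaton_def)
  qed (use that in simp)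
  obtain n where n: "r n = 1" using one by blast
  have r1: "r i = 1" if "n \<le> i" for i
    using that
  proof (induction i rule: dec_induct)
    case (step i)
    have "r (Suc i) \<noteq> 2"
    proof
      assume "r (Suc i) = 2"
      moreover obtain j where "Suc i \<le> j" "r j = 1" using one by blast
      ultimately show False using sink[of "Suc i" "j - Suc i"] by simp
    qed
    then show ?case
      using \<open>\<And>i. r (Suc i) \<in> set_pmf (trans ?A (r i) (w i))\<close>[of i] step.IH
      by (auto simp: eventually_one_automaton_def split: if_splits)
  qed (rule n)
  have "w i = 1" if "n \<le> i" for i
    using step[of i] r1[OF that] r1[of "Suc i"] that
    by (auto simp: eventually_one_automaton_def split: if_splits)
  then show "\<forall>\<^sub>\<infinity>n. w n = 1"
    unfolding MOST_nat_le by blast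
qed

section \<open>Almost-sure automata on ever sparser zeros\<close>

definition hits_in :: "pwa \<Rightarrow> (nat \<Rightarrow> nat) \<Rightarrow> nat \<Rightarrow> nat \<Rightarrow> (nat \<Rightarrow> nat) set" where
  "hits_in B w a N = {r. \<exists>i. a \<le> i \<and> i < N \<and> 1 \<le> real_of_rat (weight_seq B w r i)}"

lemma sets_hits_in: "hits_in B w a N \<in> sets path_space"
  unfolding hits_in_def
proof (rule sets_path_Collect)
  have "Measurable.pred path_space (\<lambda>r. 1 \<le> real_of_rat (weight_seq B w r i))" for i
    unfolding weight_seq_def by (rule pred_transition)
  then show "Measurable.pred path_space (\<lambda>r. \<exists>i. a \<le> i \<and> i < N \<and> 1 \<le> real_of_rat (weight_seq B w r i))"
    by measurable
qed

text \<open>Transitions before time \<open>N\<close> depend on the first \<open>N\<close> letters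
  only, so a letter 0 placed at \<open>N\<close> or later does not affect the window.\<close>

lemma measure_hits_in_cong:
  assumes "\<And>i. i < N \<Longrightarrow> w i = w' i"
  shows "measure (chain p (word_kernel B w)) (hits_in B w a N) =
    measure (chain p (word_kernel B w')) (hits_in B w' a N)"
proof -
  define P where "P = (\<lambda>l. \<exists>i. a \<le> i \<and> i < N \<and> 1 \<le> real_of_rat (weight B (l ! i) (w i) (l ! Suc i)))"
  have *: "hits_in B w'' a N = {r. P (map r [0..<Suc N])}" if "\<And>i. i < N \<Longrightarrow> w i = w'' i" for w''
    using that by (auto simp: hits_in_def P_def weight_seq_def simp del: upt_Suc)
  have "hits_in B w a N = {r. P (map r [0..<Suc N])}"
    by (rule *) simp
  moreover have "hits_in B w' a N = {r. P (map r [0..<Suc N])}"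
    by (rule *) (rule assms)
  ultimately show ?thesis
    by (simp only:) (rule measure_chain_prefix_event_cong, simp add: assms)
qed

lemma hits_in_almost_sure:
  assumes "measure (chain p (word_kernel B w)) {r. io_ge B w 1 r} = 1" "0 < \<epsilon>"
  shows "\<exists>N\<ge>a. 1 - \<epsilon> < measure (chain p (word_kernel B w)) (hits_in B w a N)"
proof -
  let ?M = "chain p (word_kernel B w)"
  have "(\<lambda>N. measure ?M (hits_in B w a N)) \<longlonglongrightarrow> measure ?M (\<Union>N. hits_in B w a N)"
    by (rule chain.finite_Lim_measure_incseq)
       (use sets_hits_in in \<open>auto simp: incseq_def hits_in_def intro: less_le_trans\<close>)
  moreover have "measure ?M (\<Union>N. hits_in B w a N) = 1"
  proof -
    have "{r. io_ge B w 1 r} \<subseteq> (\<Union>N. hits_in B w a N)"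
    proof
      fix r assume "r \<in> {r. io_ge B w 1 r}"
      then obtain i where "a \<le> i" "1 \<le> real_of_rat (weight_seq B w r i)"
        unfolding io_ge_def INFM_nat_le by blast
      then have "r \<in> hits_in B w a (Suc i)" by (auto simp: hits_in_def)
      then show "r \<in> (\<Union>N. hits_in B w a N)" by blast
    qed
    then have "measure ?M {r. io_ge B w 1 r} \<le> measure ?M (\<Union>N. hits_in B w a N)"
      using sets_hits_in by (intro chain.finite_measure_mono) auto
    then show ?thesis using assms(1) by (intro antisym) auto
  qed
  ultimately have "\<forall>\<^sub>F N in sequentially. 1 - \<epsilon> < measure ?M (hits_in B w a N)"
    using assms(2) by (intro order_tendstoD(1)) auto
  with eventually_ge_at_top[of a] have "\<forall>\<^sub>F N in sequentially. a \<le> N \<and> 1 - \<epsilon> < measure ?M (hits_in B w a N)"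
    by eventually_elim simp
  then show ?thesis by (auto dest: eventually_happens)
qed

text \<open>A diagonal word: finitely many zeros still force acceptance, so one can wait until a
  heavy transition is almost certain and only then place the next zero.\<close>

lemma not_reducible_max_as: "\<not> reducible L_max L_as"
proof
  let ?\<Sigma> = "{0, 1} :: nat set"
  assume "reducible L_max L_as"
  then obtain B where wf: "wf_pwa ?\<Sigma> B"
    and eq: "\<And>w. range w \<subseteq> ?\<Sigma> \<Longrightarrow> L_max eventually_one_automaton w = L_as B w"
    unfolding reducible_def using wf_eventually_one_automaton[of ?\<Sigma>]
    by (metis (no_types, lifting) finite.emptyI finite.insertI)
  have iff: "measure (chain (init B) (word_kernel B w)) {r. io_ge B w 1 r} = 1 \<longleftrightarrow> (\<forall>\<^sub>\<infinity>n. w n = 1)"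
    if "range w \<subseteq> ?\<Sigma>" for w
    using le_L_as_iff[OF wf _ that, of 1] L_max_eventually_one[OF _ that] eq[OF that] by simp
  define word where "word = (\<lambda>(X :: nat set) n. if n \<in> X then 0 else 1 :: nat)"
  have word: "range (word X) \<subseteq> ?\<Sigma>" for X by (auto simp: word_def)
  define P where "P = (\<lambda>w a N. measure (chain (init B) (word_kernel B w)) (hits_in B w a N))"
  \<comment> \<open>A pair holds the zeros placed so far and the first free position. The new zero
    lies just behind a window in which a hit has probability above
    \<open>1 - 1 / Suc i\<close>.\<close>
  define Q where "Q = (\<lambda>i (X, a) (X', a').
    \<exists>N\<ge>a. X' = insert N X \<and> a' = Suc N \<and> 1 - 1 / real (Suc i) < P (word X) a N)"
  have "\<exists>f. \<forall>i. finite (fst (f i)) \<and> Q i (f i) (f (Suc i))"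
  proof (rule dependent_nat_choice[where P="\<lambda>_ x. finite (fst x)" and Q=Q])
    show "\<exists>x :: nat set \<times> nat. finite (fst x)" by (rule exI[of _ "({}, 0)"]) simp
    fix x :: "nat set \<times> nat" and i
    assume fin: "finite (fst x)"
    have "\<forall>\<^sub>\<infinity>n. word (fst x) n = 1"
      using fin by (simp add: word_def MOST_iff_cofinite)
    then have "measure (chain (init B) (word_kernel B (word (fst x)))) {r. io_ge B (word (fst x)) 1 r} = 1"
      using iff[OF word] by simp
    from hits_in_almost_sure[OF this, of "1 / real (Suc i)" "snd x"]
    obtain N where "snd x \<le> N" "1 - 1 / real (Suc i) < P (word (fst x)) (snd x) N"
      by (auto simp: P_def)
    then have "finite (fst (insert N (fst x), Suc N)) \<and> Q i x (insert N (fst x), Suc N)"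
      using fin by (auto simp: Q_def split: prod.splits)
    then show "\<exists>y. finite (fst y) \<and> Q i x y" by blast
  qed
  then obtain f where "\<And>i. Q i (f i) (f (Suc i))" by blast
  then have "\<forall>i. \<exists>N\<ge>snd (f i). fst (f (Suc i)) = insert N (fst (f i)) \<and> snd (f (Suc i)) = Suc N \<and>
      1 - 1 / real (Suc i) < P (word (fst (f i))) (snd (f i)) N"
    by (simp add: Q_def case_prod_beta)
  then obtain N where N: "\<And>i. snd (f i) \<le> N i" "\<And>i. fst (f (Suc i)) = insert (N i) (fst (f i))"
    "\<And>i. snd (f (Suc i)) = Suc (N i)" "\<And>i. 1 - 1 / real (Suc i) < P (word (fst (f i))) (snd (f i)) (N i)"
    by metis
  have a_ge: "i \<le> snd (f i)" for i
  proof (induction i)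
    case (Suc i)
    then show ?case using N(1)[of i] by (simp add: N(3))
  qed simp
  have N_mono: "N i \<le> N j" if "i \<le> j" for i j
    using that
  proof (induction j rule: dec_induct)
    case (step j)
    then show ?case using N(1)[of "Suc j"] by (simp add: N(3))
  qed simp
  have X_mono: "fst (f i) \<subseteq> fst (f j)" if "i \<le> j" for i j
    using that by (induction j rule: dec_induct) (auto simp: N(2))
  \<comment> \<open>Zeros added from stage \<open>i\<close> on lie at or behind \<open>N i\<close>,
    so the limit word agrees with stage \<open>i\<close> on its window.\<close>
  have X_prefix: "n \<in> fst (f i)" if "n \<in> fst (f j)" "n < N i" for i j n
  proof (cases "i \<le> j")
    case True
    then show ?thesis
      using that
    proof (induction j rule: dec_induct)
      case (step j)
      then show ?case using N_mono[of i j] by (auto simp: N(2))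
    qed
  next
    case False
    then show ?thesis using X_mono[of j i] that(1) by auto
  qed
  define w where "w = word (\<Union>i. fst (f i))"
  have w: "range w \<subseteq> ?\<Sigma>" unfolding w_def by (rule word)
  have agree: "w n = word (fst (f i)) n" if "n < N i" for n i
    using X_prefix[OF _ that] by (auto simp: w_def word_def)
  have hit: "1 - 1 / real (Suc i) < P w (snd (f i)) (N i)" for i
    using N(4)[of i] measure_hits_in_cong[of "N i" w "word (fst (f i))"] agree by (simp add: P_def)
  let ?M = "chain (init B) (word_kernel B w)"
  let ?F = "\<lambda>j. {r. \<exists>i\<ge>j. 1 \<le> real_of_rat (weight_seq B w r i)}"
  have F: "?F j \<in> sets path_space" for j
  proof (rule sets_path_Collect)
    have "Measurable.pred path_space (\<lambda>r. 1 \<le> real_of_rat (weight_seq B w r i))" for i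
      unfolding weight_seq_def by (rule pred_transition)
    then show "Measurable.pred path_space (\<lambda>r. \<exists>i\<ge>j. 1 \<le> real_of_rat (weight_seq B w r i))"
      by measurable
  qed
  \<comment> \<open>All windows from stage \<open>j\<close> on start no earlier than
    \<open>j\<close>, and their hit probabilities tend to 1.\<close>
  have "measure ?M (?F j) = 1" for j
  proof (rule antisym)
    have "1 - 1 / real (Suc i) \<le> measure ?M (?F j)" if "j \<le> i" for i
    proof -
      have "P w (snd (f i)) (N i) \<le> measure ?M (?F j)"
        unfolding P_def
      proof (rule chain.finite_measure_mono)
        show "hits_in B w (snd (f i)) (N i) \<subseteq> ?F j"
        proof
          fix r assume "r \<in> hits_in B w (snd (f i)) (N i)"
          then obtain i' where "snd (f i) \<le> i'" "1 \<le> real_of_rat (weight_seq B w r i')"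
            unfolding hits_in_def by blast
          moreover from this(1) have "j \<le> i'" using that a_ge[of i] by linarith
          ultimately show "r \<in> ?F j" by blast
        qed
      qed (use F in simp)
      then show ?thesis using hit[of i] by linarith
    qed
    moreover have "(\<lambda>i. 1 - 1 / real (Suc i)) \<longlonglongrightarrow> 1 - 0"
      by (rule tendsto_diff[OF tendsto_const LIMSEQ_Suc[OF lim_1_over_n]])
    ultimately have "1 - 0 \<le> measure ?M (?F j)"
      by (meson LIMSEQ_le_const2)
    then show "1 \<le> measure ?M (?F j)" by simp
  qed simp
  then have "AE r in ?M. \<forall>j. r \<in> ?F j"
    unfolding AE_all_countable using F by (simp add: chain.prob_eq_1)
  then have "AE r in ?M. r \<in> {r. io_ge B w 1 r}"
    by eventually_elim (simp add: io_ge_def INFM_nat_le)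
  then have "measure ?M {r. io_ge B w 1 r} = 1"
    using sets_io_ge by (subst chain.prob_eq_1) auto
  then obtain m where m: "\<And>n. m \<le> n \<Longrightarrow> w n = 1"
    using iff[OF w] unfolding MOST_nat_le by blast
  have "m \<le> N m" using a_ge[of m] N(1)[of m] by linarith
  moreover have "w (N m) = 0"
  proof -
    have "N m \<in> fst (f (Suc m))" by (simp add: N(2))
    then have "N m \<in> (\<Union>i. fst (f i))" by blast
    then show ?thesis by (simp add: w_def word_def)
  qed
  ultimately show False using m by force
qed

section \<open>An almost-sure language that is not nondeterministic\<close>

text \<open>A block of \<open>n\<close> letters \<open>0\<close> followed by the letter \<open>1\<close> moves from state \<open>0\<close> to the accepting sink \<open>2\<close>
  with probability \<open>1 / 2 ^ n\<close> and back to \<open>0\<close> otherwise.\<close>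

definition block_automaton :: pwa where
  "block_automaton = \<lparr>
    states = {0, 1, 2},
    init = return_pmf 0,
    trans = (\<lambda>q \<sigma>. if q = 0 then (if \<sigma> = 0 then pmf_of_set {0, 1} else return_pmf 2)
      else if q = 1 then (if \<sigma> = 0 then return_pmf 1 else return_pmf 0) else return_pmf 2),
    weight = (\<lambda>q \<sigma> q'. if q = 2 then 1 else 0)\<rparr>"

lemma wf_block_automaton: "wf_pwa \<Sigma> block_automaton"
  by (auto simp: wf_pwa_def block_automaton_def)

definition block_prob :: "(nat \<Rightarrow> nat) \<Rightarrow> nat \<Rightarrow> nat \<Rightarrow> real" where
  "block_prob w n q = pmf (marginal (init block_automaton) (word_kernel block_automaton w) n) q"

lemma set_marginal_block:
  "set_pmf (marginal (init block_automaton) (word_kernel block_automaton w) n) \<subseteq> {0, 1, 2}"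
proof (induction n)
  case (Suc n)
  then show ?case by (force simp: block_automaton_def split: if_splits)
qed (simp add: block_automaton_def)

lemma block_prob_Suc:
  "block_prob w (Suc n) q' = (\<Sum>q\<in>{0, 1, 2}. pmf (trans block_automaton q (w n)) q' * block_prob w n q)"
  unfolding block_prob_def
  by (simp only: marginal.simps pmf_bind, rule integral_measure_pmf_real)
     (use set_marginal_block in auto)

lemma block_prob_0: "block_prob w 0 0 = 1" "block_prob w 0 1 = 0" "block_prob w 0 2 = 0"
  by (simp_all add: block_prob_def block_automaton_def)

lemma block_prob_step_0:
  assumes "w n = 0"
  shows "block_prob w (Suc n) 0 = block_prob w n 0 / 2"
    "block_prob w (Suc n) 1 = block_prob w n 1 + block_prob w n 0 / 2"
    "block_prob w (Suc n) 2 = block_prob w n 2"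
  using assms by (simp_all add: block_prob_Suc block_automaton_def indicator_def)

lemma block_prob_step_1:
  assumes "w n \<noteq> 0"
  shows "block_prob w (Suc n) 0 = block_prob w n 1"
    "block_prob w (Suc n) 1 = 0"
    "block_prob w (Suc n) 2 = block_prob w n 2 + block_prob w n 0"
  using assms by (simp_all add: block_prob_Suc block_automaton_def indicator_def)

lemma block_prob_sum: "block_prob w n 0 + block_prob w n 1 + block_prob w n 2 = 1"
proof (induction n)
  case (Suc n)
  show ?case
  proof (cases "w n = 0")
    case True
    from block_prob_step_0[of w n, OF this] Suc show ?thesis by linarith
  next
    case False
    from block_prob_step_1[of w n, OF this] Suc show ?thesis by linarith
  qed
qed (simp add: block_prob_0[simplified])

lemma block_prob_bounds: "0 \<le> block_prob w n q" "block_prob w n q \<le> 1"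
  by (simp_all add: block_prob_def pmf_le_1)

lemma block_sink:
  assumes "is_run block_automaton w r" "r n = 2" "n \<le> m"
  shows "r m = 2"
  using assms(3)
proof (induction m rule: dec_induct)
  case (step m)
  have "r (Suc m) \<in> set_pmf (trans block_automaton (r m) (w m))"
    using assms(1) by (simp add: is_run_iff)
  with step.IH show ?case by (simp add: block_automaton_def)
qed (rule assms(2))

lemma io_ge_block_iff: "io_ge block_automaton w 1 r \<longleftrightarrow> (\<exists>\<^sub>\<infinity>n. r n = 2)"
proof -
  have "1 \<le> real_of_rat (weight_seq block_automaton w r n) \<longleftrightarrow> r n = 2" for n
    by (simp add: weight_seq_def block_automaton_def)
  then show ?thesis by (simp add: io_ge_def)
qed

abbreviation block_chain :: "(nat \<Rightarrow> nat) \<Rightarrow> (nat \<Rightarrow> nat) measure" where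
  "block_chain w \<equiv> chain (init block_automaton) (word_kernel block_automaton w)"

lemma block_prob_le_measure:
  "block_prob w n 2 \<le> measure (block_chain w) {r. io_ge block_automaton w 1 r}"
proof -
  have "block_prob w n 2 = measure (block_chain w) {r. r n = 2}"
    by (simp add: measure_chain_state block_prob_def)
  also have "\<dots> \<le> measure (block_chain w) {r. io_ge block_automaton w 1 r}"
  proof (rule chain.finite_measure_mono_AE)
    show "AE r in block_chain w. r \<in> {r. r n = 2} \<longrightarrow> r \<in> {r. io_ge block_automaton w 1 r}"
      using AE_is_run
    proof eventually_elim
      fix r assume r: "is_run block_automaton w r"
      have "\<exists>n'\<ge>m. r n' = 2" if "r n = 2" for m
        using block_sink[OF r that, of "max n m"] by (intro exI[of _ "max n m"]) simp
      then show "r \<in> {r. r n = 2} \<longrightarrow> r \<in> {r. io_ge block_automaton w 1 r}"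
        unfolding io_ge_block_iff INFM_nat_le by blast
    qed
  qed (simp add: sets_io_ge)
  finally show ?thesis .
qed

text \<open>Acceptance is absorption in state 2, an increasing union of events whose probabilities
  are the masses of the sink.\<close>

lemma measure_block_le:
  assumes "\<And>n. block_prob w n 2 \<le> c"
  shows "measure (block_chain w) {r. io_ge block_automaton w 1 r} \<le> c"
proof -
  let ?A = "\<lambda>n. {r :: nat \<Rightarrow> nat. \<exists>i\<le>n. r i = 2}"
  have A: "?A n \<in> sets path_space" for n
    by (rule sets_path_Collect) measurable
  have eq: "measure (block_chain w) (?A n) = block_prob w n 2" for n
  proof -
    have S: "{r :: nat \<Rightarrow> nat. r n = 2} \<in> sets path_space"
      by (rule sets_path_Collect) measurable
    have "measure (block_chain w) (?A n) = measure (block_chain w) {r. r n = 2}"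
    proof (rule chain.finite_measure_eq_AE)
      show "AE r in block_chain w. r \<in> ?A n \<longleftrightarrow> r \<in> {r. r n = 2}"
        using AE_is_run by eventually_elim (auto dest: block_sink)
    qed (use A S in auto)
    then show ?thesis by (simp add: measure_chain_state block_prob_def)
  qed
  have "(\<lambda>n. measure (block_chain w) (?A n)) \<longlonglongrightarrow> measure (block_chain w) (\<Union>n. ?A n)"
    by (rule chain.finite_Lim_measure_incseq) (use A in \<open>auto simp: incseq_def intro: le_trans\<close>)
  then have "measure (block_chain w) (\<Union>n. ?A n) \<le> c"
    by (rule LIMSEQ_le_const2) (use assms eq in auto)
  moreover have "{r. io_ge block_automaton w 1 r} \<subseteq> (\<Union>n. ?A n)"
    unfolding io_ge_block_iff by (auto dest!: INFM_EX)
  then have "measure (block_chain w) {r. io_ge block_automaton w 1 r} \<le> measure (block_chain w) (\<Union>n. ?A n)"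
    using A by (intro chain.finite_measure_mono) auto
  ultimately show ?thesis by linarith
qed

section \<open>Words with blocks of equal length\<close>

definition block_word :: "nat \<Rightarrow> nat \<Rightarrow> nat" where
  "block_word K n = (if n mod Suc K = K then 1 else 0)"

lemma block_word_in_block: "j \<le> K \<Longrightarrow> block_word K (i * Suc K + j) = (if j = K then 1 else 0)"
proof -
  assume "j \<le> K"
  then have "(i * Suc K + j) mod Suc K = j"
    by (metis le_imp_less_Suc mod_less mod_mult_self3)
  then show ?thesis by (simp add: block_word_def)
qed

text \<open>Inside a block the mass drains from state 0 to 1 by halving. The closing letter absorbs
  what is left in 0 and returns the rest, so each block keeps the fraction
  \<open>1 - 1 / 2 ^ K\<close>.\<close>

lemma block_prob_periodic:
  "block_prob (block_word K) (i * Suc K) 0 = (1 - 1 / 2 ^ K) ^ i"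
  "block_prob (block_word K) (i * Suc K) 1 = 0"
proof (induction i)
  case 0
  {
    case 1
    then show ?case by (simp add: block_prob_0)
  next
    case 2
    then show ?case using block_prob_0(2) by simp
  }
next
  case (Suc i)
  let ?w = "block_word K"
  define X :: real where "X = (1 - 1 / 2 ^ K) ^ i"
  have *: "block_prob ?w (i * Suc K + j) 0 = X / 2 ^ j \<and> block_prob ?w (i * Suc K + j) 1 = X - X / 2 ^ j"
    if "j \<le> K" for j
    using that
  proof (induction j)
    case 0
    then show ?case using Suc.IH by (simp add: X_def del: mult_Suc_right)
  next
    case (Suc j)
    then have "?w (i * Suc K + j) = 0" by (simp add: block_word_in_block del: mult_Suc_right)
    note step = block_prob_step_0[of ?w "i * Suc K + j", OF this]
    have IH: "block_prob ?w (i * Suc K + j) 0 = X / 2 ^ j" "block_prob ?w (i * Suc K + j) 1 = X - X / 2 ^ j"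
      using Suc by auto
    show ?case
      unfolding add_Suc_right step IH by (simp add: field_simps)
  qed
  have "?w (i * Suc K + K) \<noteq> 0" by (simp add: block_word_in_block del: mult_Suc_right)
  note step = block_prob_step_1[of ?w "i * Suc K + K", OF this]
  have pos: "Suc i * Suc K = Suc (i * Suc K + K)" by simp
  {
    case 1
    show ?case unfolding pos step(1) using *[of K] by (simp add: X_def[symmetric] algebra_simps del: mult_Suc_right)
  next
    case 2
    show ?case unfolding pos by (rule step(2))
  }
qed

lemma measure_block_periodic: "measure (block_chain (block_word K)) {r. io_ge block_automaton (block_word K) 1 r} = 1"
proof (rule antisym)
  let ?P = "measure (block_chain (block_word K)) {r. io_ge block_automaton (block_word K) 1 r}"
  have "1 - (1 - 1 / 2 ^ K) ^ i \<le> ?P" for i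
    using block_prob_le_measure[of "block_word K" "i * Suc K"]
      block_prob_sum[of "block_word K" "i * Suc K"] block_prob_periodic[of K i] by linarith
  moreover have "(\<lambda>i. 1 - (1 - 1 / 2 ^ K) ^ i :: real) \<longlonglongrightarrow> 1 - 0"
    by (intro tendsto_diff tendsto_const LIMSEQ_realpow_zero) auto
  ultimately have "1 - 0 \<le> ?P"
    by (meson LIMSEQ_le_const2)
  then show "1 \<le> ?P" by simp
qed simp

text \<open>A time change of the run: at position \<open>t i - 1\<close> in block \<open>i\<close> the walk jumps back to position \<open>s i\<close>,
  where the run is in the same state as at \<open>t i\<close>, until the total number of jumps is \<^term>\<open>pump_count (Suc i)\<close>.\<close>

definition pump_count :: "nat \<Rightarrow> nat" where
  "pump_count i = (\<Sum>j<i. j + 2)"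

lemma pump_count_Suc: "pump_count (Suc i) = pump_count i + i + 2"
  by (simp add: pump_count_def)

lemma pump_count_mono: "i \<le> j \<Longrightarrow> pump_count i \<le> pump_count j"
  unfolding pump_count_def by (intro sum_mono2) auto

text \<open>As \<open>t i\<close> is at most the position of the letter 1 closing block
  \<open>i\<close>, the loop from \<open>s i\<close> to \<open>t i\<close> reads only zeros.\<close>

locale pumping =
  fixes K :: nat and s t :: "nat \<Rightarrow> nat"
  assumes s_ge: "i * Suc K \<le> s i" and s_less_t: "s i < t i" and t_le: "t i \<le> i * Suc K + K"
begin

abbreviation "blk p \<equiv> p div Suc K"

lemma blk_eqI: "i * Suc K \<le> p \<Longrightarrow> p \<le> i * Suc K + K \<Longrightarrow> blk p = i"
  by (rule div_nat_eqI) (simp_all add: algebra_simps)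

lemma blk_bounds: "blk p * Suc K \<le> p" "p \<le> blk p * Suc K + K"
  using div_mult_mod_eq[of p "Suc K"] mod_less_divisor[of "Suc K" p] by linarith+

definition step :: "nat \<times> nat \<Rightarrow> nat \<times> nat" where
  "step = (\<lambda>(p, c). if Suc p = t (blk p) \<and> c < pump_count (Suc (blk p)) then (s (blk p), Suc c) else (Suc p, c))"

definition walk :: "nat \<Rightarrow> nat \<times> nat" where
  "walk n = (step ^^ n) (0, 0)"

abbreviation "pos n \<equiv> fst (walk n)"
abbreviation "jumps n \<equiv> snd (walk n)"

lemma walk_0 [simp]: "walk 0 = (0, 0)"
  by (simp add: walk_def)

lemma walk_Suc_cases:
  obtains (jump) "Suc (pos n) = t (blk (pos n))" "jumps n < pump_count (Suc (blk (pos n)))"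
      "walk (Suc n) = (s (blk (pos n)), Suc (jumps n))"
  | (move) "\<not> (Suc (pos n) = t (blk (pos n)) \<and> jumps n < pump_count (Suc (blk (pos n))))"
      "walk (Suc n) = (Suc (pos n), jumps n)"
  using that by (cases "Suc (pos n) = t (blk (pos n)) \<and> jumps n < pump_count (Suc (blk (pos n)))")
    (auto simp: walk_def step_def case_prod_beta)

lemma blk_s: "blk (s i) = i"
  using s_ge[of i] s_less_t[of i] t_le[of i] by (intro blk_eqI) auto

lemma jumps_le: "jumps n \<le> pump_count (Suc (blk (pos n)))"
proof (induction n)
  case (Suc n)
  show ?case
  proof (cases n rule: walk_Suc_cases)
    case jump
    then show ?thesis by (simp add: blk_s)
  next
    case move
    have "pump_count (Suc (blk (pos n))) \<le> pump_count (Suc (blk (Suc (pos n))))"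
      by (intro pump_count_mono Suc_le_mono[THEN iffD2] div_le_mono) simp
    then show ?thesis using Suc unfolding move(2) fst_conv snd_conv by linarith
  qed
qed simp

text \<open>A jump goes back from \<open>pos n\<close> by at most \<open>K\<close> but adds
  \<open>Suc K\<close> on the right, so the right-hand side grows in every step.\<close>

lemma potential: "n \<le> pos n + jumps n * Suc K"
proof (induction n)
  case (Suc n)
  show ?case
  proof (cases n rule: walk_Suc_cases)
    case jump
    have "pos n \<le> s (blk (pos n)) + K"
      using blk_bounds[of "pos n"] s_ge[of "blk (pos n)"] by linarith
    then show ?thesis using Suc unfolding jump(3) by simp
  qed (use Suc in simp)
qed simp

lemma pos_unbounded: "\<exists>n. M \<le> pos n"
proof (rule ccontr)
  assume "\<not> ?thesis"
  then have less: "pos n < M" for n by (simp add: not_le)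
  \<comment> \<open>Bounded positions allow only boundedly many jumps, which contradicts the
    potential at this time.\<close>
  let ?b = "M + pump_count (Suc (blk M)) * Suc K"
  have "jumps ?b \<le> pump_count (Suc (blk M))"
    using jumps_le[of ?b] pump_count_mono[of "Suc (blk (pos ?b))" "Suc (blk M)"] less[of ?b]
    by (meson Suc_le_mono div_le_mono le_trans less_imp_le)
  then have "jumps ?b * Suc K \<le> pump_count (Suc (blk M)) * Suc K"
    by (rule mult_le_mono1)
  then show False using potential[of ?b] less[of ?b] by linarith
qed

lemma pos_Suc_le: "pos (Suc n) \<le> Suc (pos n)"
proof (cases n rule: walk_Suc_cases)
  case jump
  then show ?thesis using s_less_t[of "blk (pos n)"] by simp
qed simp

text \<open>The walk never advances by more than one position, so it skips none; hence no heavy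
  transition of the original run is lost.\<close>

lemma pos_surj: "\<exists>n. pos n = M"
proof -
  define n where "n = (LEAST n. M \<le> pos n)"
  have n: "M \<le> pos n" unfolding n_def using pos_unbounded by (rule LeastI_ex)
  show ?thesis
  proof (cases n)
    case 0
    then show ?thesis using n by (intro exI[of _ 0]) simp
  next
    case (Suc m)
    then have "\<not> M \<le> pos m" using not_less_Least[of m "\<lambda>n. M \<le> pos n"] by (simp add: n_def)
    then have "pos n = M" using n pos_Suc_le[of m] Suc by simp
    then show ?thesis by blast
  qed
qed

lemma INFM_pos: "(\<exists>\<^sub>\<infinity>p. P p) \<Longrightarrow> (\<exists>\<^sub>\<infinity>n. P (pos n))"
proof (rule ccontr)
  assume inf: "\<exists>\<^sub>\<infinity>p. P p" and "\<not> (\<exists>\<^sub>\<infinity>n. P (pos n))"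
  then have "finite (pos ` {n. P (pos n)})" by (simp add: INFM_iff_infinite)
  moreover have "{p. P p} \<subseteq> pos ` {n. P (pos n)}"
  proof
    fix p assume "p \<in> {p. P p}"
    moreover obtain n where "pos n = p" using pos_surj by blast
    ultimately show "p \<in> pos ` {n. P (pos n)}" by auto
  qed
  ultimately show False using inf finite_subset by (auto simp: INFM_iff_infinite)
qed

definition pumped_word :: "nat \<Rightarrow> nat" where
  "pumped_word n = block_word K (pos n)"

text \<open>Every jump reads a 0 and halves the mass of state 0. The walk passes \<open>t i\<close>
  only after all \<open>i + 2\<close> jumps of block \<open>i\<close>, so that block is accepted
  with probability at most \<open>1 / 2 ^ (i + 2)\<close>; the bound on state 2 sums these over the
  completed blocks.\<close>

lemma pumped_invariant:
  defines "i \<equiv> \<lambda>n. blk (pos n)"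
  shows "block_prob pumped_word n 0 * 2 ^ jumps n \<le> 2 ^ pump_count (i n) \<and>
    (t (i n) \<le> pos n \<longrightarrow> jumps n = pump_count (Suc (i n))) \<and>
    block_prob pumped_word n 2 \<le> 1 / 2 - 1 / 2 ^ Suc (i n)"
proof (induction n)
  case 0
  have "0 < t 0" using s_less_t[of 0] by simp
  then show ?case by (simp add: i_def block_prob_0 pump_count_def)
next
  case (Suc n)
  let ?x = "block_prob pumped_word n 0"
  have letter: "pumped_word n = (if pos n = i n * Suc K + K then 1 else 0)"
  proof -
    obtain j where "pos n = i n * Suc K + j" "j \<le> K"
      using blk_bounds[of "pos n"] unfolding i_def by (metis add_le_cancel_left le_Suc_ex)
    then show ?thesis using block_word_in_block[of j K "i n"] by (simp add: pumped_word_def)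
  qed
  show ?case
  proof (cases n rule: walk_Suc_cases)
    case jump
    then have "pos n \<noteq> i n * Suc K + K" using t_le[of "i n"] by (simp add: i_def)
    then have "pumped_word n = 0" using letter by simp
    note next_prob = block_prob_step_0[of pumped_word n, OF this]
    have i_Suc: "i (Suc n) = i n" using jump(3) by (simp add: i_def blk_s)
    have "\<not> t (i n) \<le> pos (Suc n)" using jump(3) s_less_t[of "i n"] by (simp add: i_def)
    then show ?thesis
      unfolding i_Suc next_prob using Suc jump(3) by simp
  next
    case move
    show ?thesis
    proof (cases "pos n = i n * Suc K + K")
      case False
      then have "pumped_word n = 0" using letter by simp
      note next_prob = block_prob_step_0[of pumped_word n, OF this]
      have i_Suc: "i (Suc n) = i n"
        using blk_bounds[of "pos n"] False unfolding i_def move(2) fst_conv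
        by (intro blk_eqI) auto
      have "jumps n = pump_count (Suc (i n))" if "t (i n) \<le> Suc (pos n)"
        using that move(1) Suc jumps_le[of n] by (auto simp: i_def le_Suc_eq)
      moreover have "?x / 2 * 2 ^ jumps n \<le> ?x * 2 ^ jumps n"
        using block_prob_bounds(1)[of pumped_word n 0] by (intro mult_right_mono) auto
      ultimately show ?thesis
        unfolding i_Suc next_prob move(2) using Suc by auto
    next
      case True
      then have "pumped_word n \<noteq> 0" using letter by simp
      note next_prob = block_prob_step_1[of pumped_word n, OF this]
      have pos_Suc: "pos (Suc n) = Suc (i n) * Suc K" using True by (simp add: move(2))
      have "i (Suc n) = blk (Suc (i n) * Suc K)"
        unfolding pos_Suc[symmetric] by (simp only: i_def)
      also have "\<dots> = Suc (i n)"
        by (rule nonzero_mult_div_cancel_right) simp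
      finally have i_Suc: "i (Suc n) = Suc (i n)" .
      have J: "jumps n = pump_count (Suc (i n))"
        using Suc t_le[of "i n"] True by simp
      have "?x * 2 ^ pump_count (Suc (i n)) \<le> 2 ^ pump_count (i n)"
        using Suc unfolding J by simp
      moreover have "pump_count (Suc (i n)) = (i n + 2) + pump_count (i n)"
        by (simp add: pump_count_Suc)
      ultimately have "(?x * 2 ^ (i n + 2)) * 2 ^ pump_count (i n) \<le> 1 * 2 ^ pump_count (i n)"
        by (simp only: power_add mult.assoc mult_1)
      then have "?x * 2 ^ (i n + 2) \<le> 1"
        by (rule mult_right_le_imp_le) simp
      then have x: "?x \<le> 1 / 2 ^ (i n + 2)"
        by (simp add: field_simps)
      \<comment> \<open>For the new block the first bound restarts: the mass entering state 0 is at
        most 1, and \<open>jumps n\<close> equals the new \<open>pump_count\<close>.\<close>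
      have "block_prob pumped_word n 1 * 2 ^ jumps n \<le> 1 * 2 ^ jumps n"
        using block_prob_bounds(2)[of pumped_word n 1] by (intro mult_right_mono) auto
      moreover have "\<not> t (Suc (i n)) \<le> pos (Suc n)"
        unfolding pos_Suc using s_ge[of "Suc (i n)"] s_less_t[of "Suc (i n)"] by linarith
      moreover have "block_prob pumped_word n 2 + ?x \<le> 1 / 2 - 1 / 2 ^ Suc (Suc (i n))"
      proof -
        have "1 / 2 ^ Suc (i n) = 2 * (1 / 2 ^ (i n + 2) :: real)" by simp
        moreover have "block_prob pumped_word n 2 \<le> 1 / 2 - 1 / 2 ^ Suc (i n)" using Suc by blast
        ultimately show ?thesis using x by simp
      qed
      moreover have "jumps (Suc n) = jumps n" by (simp add: move(2))
      ultimately show ?thesis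
        unfolding i_Suc next_prob J by simp
    qed
  qed
qed

lemma measure_block_pumped: "measure (block_chain pumped_word) {r. io_ge block_automaton pumped_word 1 r} \<le> 1 / 2"
proof (rule measure_block_le)
  fix n
  have "block_prob pumped_word n 2 \<le> 1 / 2 - 1 / 2 ^ Suc (blk (pos n))"
    using pumped_invariant[of n] by blast
  also have "\<dots> \<le> 1 / 2" by simp
  finally show "block_prob pumped_word n 2 \<le> 1 / 2" .
qed

end

lemma not_reducible_as_max: "\<not> reducible L_as L_max"
proof
  let ?\<Sigma> = "{0, 1} :: nat set"
  assume "reducible L_as L_max"
  then obtain B where wf: "wf_pwa ?\<Sigma> B"
    and eq: "\<And>w. range w \<subseteq> ?\<Sigma> \<Longrightarrow> L_as block_automaton w = L_max B w"
    unfolding reducible_def using wf_block_automaton[of ?\<Sigma>]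
    by (metis (no_types, lifting) finite.emptyI finite.insertI)
  have iff: "measure (block_chain w) {r. io_ge block_automaton w 1 r} = 1 \<longleftrightarrow>
      (\<exists>r. is_run B w r \<and> io_ge B w 1 r)" if "range w \<subseteq> ?\<Sigma>" for w
    using le_L_as_iff[OF wf_block_automaton _ that, of 1] le_L_max_iff[OF wf _ that, of 1] eq[OF that] by simp
  \<comment> \<open>A block then has \<open>K + 1\<close> positions, one more than there are states,
    so the run repeats a state inside each block.\<close>
  define K where "K = card (states B)"
  have w: "range (block_word K) \<subseteq> ?\<Sigma>" by (auto simp: block_word_def)
  obtain r where run: "is_run B (block_word K) r" and io: "io_ge B (block_word K) 1 r"
    using iff[OF w] measure_block_periodic[of K] by blast
  have "\<exists>a b. i * Suc K \<le> a \<and> a < b \<and> b \<le> i * Suc K + K \<and> r a = r b" for i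
  proof -
    let ?I = "{i * Suc K..i * Suc K + K}"
    have "r ` ?I \<subseteq> states B" using is_run_states[OF wf w run] by blast
    then have "card (r ` ?I) \<le> K"
      unfolding K_def using wf by (intro card_mono) (simp_all add: wf_pwa_def)
    then have "card (r ` ?I) < card ?I" by simp
    then have "\<not> inj_on r ?I" by (rule pigeonhole)
    then obtain a b where ab: "a \<in> ?I" "b \<in> ?I" "r a = r b" and "a \<noteq> b"
      unfolding inj_on_def by blast
    then consider "a < b" | "b < a" by linarith
    then show ?thesis
    proof cases
      case 1
      with ab show ?thesis by auto
    next
      case 2
      with ab show ?thesis by (intro exI[of _ b] exI[of _ a]) auto
    qed
  qed
  then obtain s t where st: "\<And>i. i * Suc K \<le> s i" "\<And>i. s i < t i" "\<And>i. t i \<le> i * Suc K + K"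
    "\<And>i. r (s i) = r (t i)" by metis
  interpret pumping K s t by unfold_locales (rule st)+
  \<comment> \<open>A jump replaces position \<open>t i\<close> by \<open>s i\<close>, where the run
    is in the same state, so the time-changed sequence uses only transitions of
    \<open>r\<close>.\<close>
  have r_Suc: "r (pos (Suc n)) = r (Suc (pos n))" for n
    by (cases n rule: walk_Suc_cases) (simp_all add: st(4))
  have "is_run B pumped_word (\<lambda>n. r (pos n))"
    unfolding is_run_iff r_Suc using run by (simp add: is_run_iff pumped_word_def)
  moreover have "weight_seq B pumped_word (\<lambda>n. r (pos n)) n = weight_seq B (block_word K) r (pos n)" for n
    unfolding weight_seq_def r_Suc by (simp add: pumped_word_def)
  then have "io_ge B pumped_word 1 (\<lambda>n. r (pos n))"
    using INFM_pos io unfolding io_ge_def by simp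
  moreover have "range pumped_word \<subseteq> ?\<Sigma>"
    by (auto simp: pumped_word_def block_word_def)
  ultimately have "measure (block_chain pumped_word) {r. io_ge block_automaton pumped_word 1 r} = 1"
    using iff by blast
  with measure_block_pumped show False by simp
qed

lemma reducible_trans: "reducible L1 L2 \<Longrightarrow> reducible L2 L3 \<Longrightarrow> reducible L1 L3"
  unfolding reducible_def by metis

theorem theorem4:
  shows "\<not> reducible L_as L_max \<and> \<not> reducible L_max L_as \<and>
         reducible L_as L_pos \<and> reducible L_max L_pos \<and>
         \<not> reducible L_pos L_as \<and> \<not> reducible L_pos L_max"
  using not_reducible_as_max not_reducible_max_as reducible_as_pos reducible_max_pos reducible_trans
  by blast

end
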